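(* Let $k\ge 0$ and let $D$ be a non-split $k$-almost alternating link diagram without a nugatory crossing. Then $D$ is $H$-$(k,k)$-thick and $TH$-$(k,k-1)$-thick.
   Context: Khovanov homology (framed unoriented version). A link diagram $D$ is a diagram on the disc of an unoriented framed link in the 3-ball. A Kauffman state $s$ of $D$ assigns to each crossing a marker $+1$ or $-1$. The smoothing of a crossing given by a positive marker joins the two regions swept out when the over-strand is rotated counterclockwise towards the under-strand (Kauffman's $A$-smoothing); a negative marker gives the other smoothing. $D_s$ is the system of circles obtained by smoothing all crossings according to $s$, $|s|$ is the number of circles of $D_s$, and $\sigma(s)$ is the number of positive markers minus the number of negative markers. $s_+$ (resp. $s_-$) is the state with all markers positive (resp. negative). An enhanced state $S$ is a Kauffman state $s$ with a sign $+$ or $-$ assigned to each circle of $D_s$; $D_S=D_s$, $\sigma(S)=\sigma(s)$, and $\tau(S)$ is the number of positive circles minus the number of negative circles. $\mathcal{C}_{i,j}(D)$ is the free abelian group on the enhanced states $S$ with $\sigma(S)=i$ and $\sigma(S)+2\tau(S)=j$. After ordering the crossings, $d_{i,j}:\mathcal{C}_{i,j}(D)\to\mathcal{C}_{i-2,j}(D)$ is $d(S)=\sum_{S'}(-1)^{t(S:S')}[S:S']S'$, summed over enhanced states $S'$ generating $\mathcal{C}_{i-2,j}(D)$, where $[S:S']=1$ if the markers of $S$ and $S'$ differ at exactly one crossing $c$ and all circles of $D_S$ and $D_{S'}$ not touching $c$ have the same signs in $S$ and $S'$, and $[S:S']=0$ otherwise; $t(S:S')$ is the number of negative markers of $S$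 at crossings bigger than $c$. $H_{i,j}(D)=\ker(d_{i,j})/d_{i+2,j}(\mathcal{C}_{i+2,j}(D))$, and $T_{i,j}(D)$ denotes its torsion subgroup. Thickness. A link diagram $D$ with $N$ crossings is $H$-$(k_1,k_2)$-thick (resp. $TH$-$(k_1,k_2)$-thick) if $H_{i,j}(D)=0$ (resp. $T_{i,j}(D)=0$) with a possible exception of $i,j$ satisfying $N-2|s_-|-4k_2\le j-2i\le 2|s_+|-N+4k_1$. A diagram is $k$-almost alternating if it becomes alternating after changing $k$ of its crossings. A crossing is nugatory if some simple closed curve in the plane meets the diagram only at that crossing, transversally, and separates the rest of the diagram into two nonempty parts. A non-split diagram is one that is connected as a planar graph. *)

theory Defs
  imports "HOL-Algebra.Free_Abelian_Groups"
begin

text \<open>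
  A link diagram is a 4-valent plane graph with over/under information, encoded as a combinatorial
  map. The four ends of strands at a crossing \<open>c\<close> are the darts \<open>(c,0), (c,1), (c,2), (c,3)\<close>,
  listed counterclockwise; the two strands through \<open>c\<close> are \<open>{(c,0),(c,2)}\<close> and \<open>{(c,1),(c,3)}\<close>.
  The edges of the graph are the pairs \<open>{x, joined D x}\<close>. The over-strand is the one consisting of
  the even darts iff \<open>even_over D c\<close>. The field \<open>free_circles\<close> counts the components of the diagram
  that pass through no crossing. The ordering of the crossings is that of their names in \<open>nat\<close>.
\<close>

type_synonym dart = "nat \<times> nat"

record diagram =
  crossings :: "nat set"
  joined :: "dart \<Rightarrow> dart"
  even_over :: "nat \<Rightarrow> bool"
  free_circles :: nat

definition darts :: "diagram \<Rightarrow> dart set" where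
  "darts D = crossings D \<times> {..<4}"

text \<open>
  The orbits on \<open>X\<close> of the maps in \<open>F\<close>. This is used only for bijections of a finite \<open>X\<close>, for which
  forward reachability is an equivalence relation.
\<close>

definition orbit_classes :: "'a set \<Rightarrow> ('a \<Rightarrow> 'a) set \<Rightarrow> 'a set set" where
  "orbit_classes X F = X // {(x, f x) | x f. x \<in> X \<and> f \<in> F}\<^sup>*"

definition rot :: "dart \<Rightarrow> dart" where
  "rot = (\<lambda>(c, p). (c, (p + 1) mod 4))"

definition rot_inv :: "dart \<Rightarrow> dart" where
  "rot_inv = (\<lambda>(c, p). (c, (p + 3) mod 4))"

text \<open>The connected components of the underlying graph, crossing-free circles excluded.\<close>

definition graph_components :: "diagram \<Rightarrow> dart set set" where
  "graph_components D = orbit_classes (darts D) {joined D, rot}"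

text \<open>
  The dart \<open>(c,p)\<close> also stands for the corner at \<open>c\<close> between the ends \<open>p\<close> and \<open>p + 1\<close> (mod 4), which
  lies to the left when leaving \<open>c\<close> along \<open>(c,p)\<close>. Walking along the edge with this region on the
  left leads to the corner \<open>rot_inv (joined D (c,p))\<close>, so a face is the set of its corners.
\<close>

definition faces :: "diagram \<Rightarrow> dart set set" where
  "faces D = orbit_classes (darts D) {rot_inv \<circ> joined D}"

text \<open>
  Planarity is Euler's formula: there are \<open>card (crossings D)\<close> vertices and twice as many edges, and
  as no component of the map has Euler characteristic greater than 2, the equation below says that
  every component is drawn on the sphere. The numbers of faces are counted component by component.
\<close>

definition link_diagram :: "diagram \<Rightarrow> bool" where
  "link_diagram D \<longleftrightarrow>
     finite (crossings D) \<and>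
     (\<forall>x \<in> darts D. joined D x \<in> darts D \<and> joined D x \<noteq> x \<and> joined D (joined D x) = x) \<and>
     card (faces D) = card (crossings D) + 2 * card (graph_components D)"

definition non_split :: "diagram \<Rightarrow> bool" where
  "non_split D \<longleftrightarrow> card (graph_components D) + free_circles D = 1"

text \<open>
  A closed curve that meets the diagram only at \<open>c\<close>, transversally to both strands, passes there
  from a corner to the opposite one and otherwise runs inside a single face. It has two of the four
  ends at \<open>c\<close> on either side, so both parts of the rest of the diagram are nonempty.
\<close>

definition nugatory :: "diagram \<Rightarrow> nat \<Rightarrow> bool" where
  "nugatory D c \<longleftrightarrow>
     c \<in> crossings D \<and> (\<exists>F \<in> faces D. \<exists>p<4. (c, p) \<in> F \<and> (c, (p + 2) mod 4) \<in> F)"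

definition is_over :: "diagram \<Rightarrow> dart \<Rightarrow> bool" where
  "is_over D = (\<lambda>(c, p). even p \<longleftrightarrow> even_over D c)"

text \<open>Consecutive passages through crossings along a component are the two ends of an edge.\<close>

definition alternating :: "diagram \<Rightarrow> bool" where
  "alternating D \<longleftrightarrow> (\<forall>x \<in> darts D. is_over D x \<noteq> is_over D (joined D x))"

definition change_crossings :: "nat set \<Rightarrow> diagram \<Rightarrow> diagram" where
  "change_crossings A D = D\<lparr>even_over := (\<lambda>c. if c \<in> A then \<not> even_over D c else even_over D c)\<rparr>"

definition almost_alternating :: "nat \<Rightarrow> diagram \<Rightarrow> bool" where
  "almost_alternating k D \<longleftrightarrow>
     (\<exists>A \<subseteq> crossings D. card A = k \<and> alternating (change_crossings A D))"

text \<open>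
  A Kauffman state is represented by the set \<open>s \<subseteq> crossings D\<close> of crossings with a positive marker.
  If the even strand is over, rotating it counterclockwise sweeps out the corners between 0 and 1 and
  between 2 and 3; joining these regions leaves the arcs \<open>{1,2}\<close> and \<open>{3,0}\<close>. The smoothing of the
  other sign, and likewise the positive one if the odd strand is over, has the arcs \<open>{0,1}\<close> and
  \<open>{2,3}\<close>. The function \<open>smoothing D s\<close> maps a dart to the other end of its arc.
\<close>

definition smoothing :: "diagram \<Rightarrow> nat set \<Rightarrow> dart \<Rightarrow> dart" where
  "smoothing D s = (\<lambda>(c, p).
     if (c \<in> s \<longleftrightarrow> even_over D c) then (c, if even p then (p + 3) mod 4 else (p + 1) mod 4)
     else (c, if even p then (p + 1) mod 4 else (p + 3) mod 4))"

type_synonym circle = "dart set + nat"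

text \<open>
  A circle of \<open>D\<^sub>s\<close> that passes near crossings is identified with the set of darts it traverses, so
  that a circle not touching the crossing \<open>c\<close> is unaffected by a change of the marker at \<open>c\<close>.
\<close>

definition circles :: "diagram \<Rightarrow> nat set \<Rightarrow> circle set" where
  "circles D s = Inl ` orbit_classes (darts D) {joined D, smoothing D s} \<union> Inr ` {..<free_circles D}"

definition touches :: "circle \<Rightarrow> nat \<Rightarrow> bool" where
  "touches C c \<longleftrightarrow> (\<exists>A p. C = Inl A \<and> (c, p) \<in> A)"

text \<open>An enhanced state is a Kauffman state together with its set of positive circles.\<close>

type_synonym enhanced_state = "nat set \<times> circle set"

definition \<sigma> :: "diagram \<Rightarrow> enhanced_state \<Rightarrow> int" where
  "\<sigma> D S = int (card (fst S)) - int (card (crossings D - fst S))"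

definition \<tau> :: "diagram \<Rightarrow> enhanced_state \<Rightarrow> int" where
  "\<tau> D S = int (card (snd S)) - int (card (circles D (fst S) - snd S))"

definition enhanced_states :: "diagram \<Rightarrow> int \<Rightarrow> int \<Rightarrow> enhanced_state set" where
  "enhanced_states D i j =
     {S. fst S \<subseteq> crossings D \<and> snd S \<subseteq> circles D (fst S) \<and> \<sigma> D S = i \<and> \<sigma> D S + 2 * \<tau> D S = j}"

definition chain_group :: "diagram \<Rightarrow> int \<Rightarrow> int \<Rightarrow> (enhanced_state \<Rightarrow>\<^sub>0 int) monoid" where
  "chain_group D i j = free_Abelian_group (enhanced_states D i j)"

definition incidence :: "diagram \<Rightarrow> enhanced_state \<Rightarrow> enhanced_state \<Rightarrow> int" where
  "incidence D S S' =
     (if \<exists>c. sym_diff (fst S) (fst S') = {c} \<and>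
             (\<forall>C \<in> circles D (fst S) \<union> circles D (fst S').
                \<not> touches C c \<longrightarrow> (C \<in> snd S \<longleftrightarrow> C \<in> snd S'))
      then 1 else 0)"

text \<open>The exponent \<open>t(S:S')\<close>; it matters only if the markers differ at exactly one crossing.\<close>

definition sign_exponent :: "diagram \<Rightarrow> enhanced_state \<Rightarrow> enhanced_state \<Rightarrow> nat" where
  "sign_exponent D S S' =
     card {b \<in> crossings D - fst S. the_elem (sym_diff (fst S) (fst S')) < b}"

definition boundary ::
  "diagram \<Rightarrow> int \<Rightarrow> int \<Rightarrow> (enhanced_state \<Rightarrow>\<^sub>0 int) \<Rightarrow> (enhanced_state \<Rightarrow>\<^sub>0 int)" where
  "boundary D i j = frag_extend (\<lambda>S. \<Sum>S' \<in> enhanced_states D (i - 2) j.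
     frag_cmul ((-1) ^ sign_exponent D S S' * incidence D S S') (frag_of S'))"

definition cycle_group :: "diagram \<Rightarrow> int \<Rightarrow> int \<Rightarrow> (enhanced_state \<Rightarrow>\<^sub>0 int) monoid" where
  "cycle_group D i j = subgroup_generated (chain_group D i j)
     (kernel (chain_group D i j) (chain_group D (i - 2) j) (boundary D i j))"

definition Khovanov_homology ::
  "diagram \<Rightarrow> int \<Rightarrow> int \<Rightarrow> (enhanced_state \<Rightarrow>\<^sub>0 int) set monoid" where
  "Khovanov_homology D i j =
     cycle_group D i j Mod (boundary D (i + 2) j ` carrier (chain_group D (i + 2) j))"

definition torsion_subgroup :: "'a monoid \<Rightarrow> 'a monoid" where
  "torsion_subgroup G = subgroup_generated G {x \<in> carrier G. \<exists>n::nat. 0 < n \<and> x [^]\<^bsub>G\<^esub> n = \<one>\<^bsub>G\<^esub>}"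

definition thick_range :: "diagram \<Rightarrow> int \<Rightarrow> int \<Rightarrow> int \<Rightarrow> int \<Rightarrow> bool" where
  "thick_range D k\<^sub>1 k\<^sub>2 i j \<longleftrightarrow>
     (let N = int (card (crossings D));
          s_plus = int (card (circles D (crossings D)));
          s_minus = int (card (circles D {}))
      in N - 2 * s_minus - 4 * k\<^sub>2 \<le> j - 2 * i \<and> j - 2 * i \<le> 2 * s_plus - N + 4 * k\<^sub>1)"

definition H_thick :: "int \<Rightarrow> int \<Rightarrow> diagram \<Rightarrow> bool" where
  "H_thick k\<^sub>1 k\<^sub>2 D \<longleftrightarrow>
     (\<forall>i j. \<not> thick_range D k\<^sub>1 k\<^sub>2 i j \<longrightarrow> trivial_group (Khovanov_homology D i j))"

definition TH_thick :: "int \<Rightarrow> int \<Rightarrow> diagram \<Rightarrow> bool" where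
  "TH_thick k\<^sub>1 k\<^sub>2 D \<longleftrightarrow>
     (\<forall>i j. \<not> thick_range D k\<^sub>1 k\<^sub>2 i j \<longrightarrow>
        trivial_group (torsion_subgroup (Khovanov_homology D i j)))"

end

theory Submission
  imports Defs
begin

text \<open>
  A generator with \<open>\<sigma> = i\<close> and \<open>\<sigma> + 2\<tau> = j\<close> is given the degree \<open>\<delta> = j - 2i = 2\<tau> - \<sigma>\<close>; the differential
  raises \<open>\<delta>\<close> by 4. The theorem bounds \<open>\<delta>\<close>, and it follows from two statements of different nature.

  \<^item> For a non-split diagram with \<open>N\<close> crossings whose edges can be oriented so that in- and outgoing
    ends alternate around every crossing, homology lives in
    \<open>2|s\<^sub>+| - N - 4 \<le> \<delta> \<le> N - 2|s\<^sub>-| + 4\<close> and is torsion free in the lowest degree (\<open>homology_support\<close>).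

  \<^item> For a \<open>k\<close>-almost alternating diagram, \<open>|s\<^sub>+| + |s\<^sub>-| \<ge> N + 2 - 2k\<close>
    (\<open>extreme_circles_almost_alternating\<close>), so this range lies inside the one that the theorem asserts.

  For the first statement resolve the crossings one after the other. At each stage there is a set \<open>L\<close>
  of crossings with marker +, a set \<open>R\<close> of unresolved ones, and the subcube of all states between
  \<open>L\<close> and \<open>U = L \<union> R\<close>. Write \<open>b\<close> for the number of components of the graph whose vertices are the
  circles of one such state and whose edges are the crossings of \<open>R\<close>; it is the same for all these states.
  The homology of the subcube lies between \<open>\<delta>\<close> of the state \<open>U\<close> with all circles positive, minus
  \<open>4b\<close>, and \<open>\<delta>\<close> of the state \<open>L\<close> with all circles negative, plus \<open>4b\<close> (\<open>supported_subcube\<close>). The proof is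
  by induction on \<open>R\<close>. If both smoothings of some crossing leave \<open>b\<close> unchanged, the long exact
  sequence of that crossing gives the bounds, because one smoothing keeps \<open>U\<close>, the other keeps \<open>L\<close>, and
  the number of circles changes only by 1. Otherwise the state that cuts every crossing off yields a
  forest. A leaf of the forest is a circle attached by a kink, and the argument for the first
  Reidemeister move removes it (\<open>supported_leaf_above\<close>, \<open>supported_leaf_below\<close>). The lowest degree of a
  subcube stays torsion free since nothing below it can hit it.

  All this needs \<open>d\<^sup>2 = 0\<close>, hence that a change of marker never turns one circle into one circle.
  The alternating diagram behind \<open>D\<close> supplies this: orienting every edge from its overcrossing to its
  undercrossing makes in- and outgoing ends alternate at each crossing, all smoothings respect this
  orientation, and a change of marker composes a permutation with a transposition.

  Planarity enters only in the second statement. In the alternating diagram the circles of the two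
  extreme states are the boundaries of the faces, so there are \<open>N + 2\<close> of them by Euler's formula, and
  every change of a crossing changes each of the two numbers by at most one.
\<close>

section \<open>Homology of complexes spanned by finite sets\<close>

text \<open>
  The only complexes needed are spanned by subsets of one finite set \<open>E\<close> of generators, with the matrix
  of the differential cut down to the subset. Sub- and quotient complexes are then subsets again, and no
  quotient has to be formed. The degree is the \<open>\<delta>\<close> above.
\<close>

locale based_complex =
  fixes E :: "'e set" and d :: "'e \<Rightarrow> 'e \<Rightarrow> int" and deg :: "'e \<Rightarrow> int"
  assumes finite_E: "finite E"
    and d_d: "\<lbrakk>s \<in> E; t \<in> E\<rbrakk> \<Longrightarrow> (\<Sum>r\<in>E. d s r * d r t) = 0"
    and deg_d: "\<lbrakk>s \<in> E; t \<in> E; d s t \<noteq> 0\<rbrakk> \<Longrightarrow> deg t = deg s + 4"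
begin

definition chains :: "'e set \<Rightarrow> int \<Rightarrow> ('e \<Rightarrow> int) set" where
  "chains X e = {z. \<forall>s. z s \<noteq> 0 \<longrightarrow> s \<in> X \<and> deg s = e}"

definition bd :: "'e set \<Rightarrow> ('e \<Rightarrow> int) \<Rightarrow> 'e \<Rightarrow> int" where
  "bd X z t = (if t \<in> X then \<Sum>s\<in>X. z s * d s t else 0)"

text \<open>
  On a subset that contains everything between its elements the restricted matrix still has square zero.
\<close>

definition convex :: "'e set \<Rightarrow> bool" where
  "convex X \<longleftrightarrow> X \<subseteq> E \<and> (\<forall>s\<in>X. \<forall>t\<in>X. \<forall>r\<in>E. d s r \<noteq> 0 \<longrightarrow> d r t \<noteq> 0 \<longrightarrow> r \<in> X)"

definition exact_at :: "'e set \<Rightarrow> int \<Rightarrow> bool" where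
  "exact_at X e \<longleftrightarrow>
     (\<forall>z \<in> chains X e. bd X z = (\<lambda>_. 0) \<longrightarrow> (\<exists>y \<in> chains X (e - 4). bd X y = z))"

text \<open>
  Chains form a torsion free group, so a chain \<open>z\<close> of which a nonzero multiple bounds is a cycle, and its
  class is a torsion class.
\<close>

definition torsion_free_at :: "'e set \<Rightarrow> int \<Rightarrow> bool" where
  "torsion_free_at X e \<longleftrightarrow>
     (\<forall>z \<in> chains X e. \<forall>n. n \<noteq> 0 \<longrightarrow> (\<exists>y \<in> chains X (e - 4). bd X y = (\<lambda>s. n * z s))
        \<longrightarrow> (\<exists>y \<in> chains X (e - 4). bd X y = z))"

text \<open>
  Torsion is excluded in a window of width 4 above \<open>m\<close>, which covers the lowest degree that can
  carry homology whatever the residue of the degrees modulo 4.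
\<close>

definition supported :: "'e set \<Rightarrow> int \<Rightarrow> int \<Rightarrow> bool" where
  "supported X m M \<longleftrightarrow>
     (\<forall>e. e < m \<or> M < e \<longrightarrow> exact_at X e) \<and> (\<forall>e < m + 4. torsion_free_at X e)"

lemma exact_atE:
  assumes "exact_at X e" "z \<in> chains X e" "bd X z = (\<lambda>_. 0)"
  obtains y where "y \<in> chains X (e - 4)" "bd X y = z"
  using assms by (auto simp: exact_at_def)

lemma torsion_free_atE:
  assumes "torsion_free_at X e" "z \<in> chains X e" "n \<noteq> 0"
    and "y \<in> chains X (e - 4)" "bd X y = (\<lambda>s. n * z s)"
  obtains x where "x \<in> chains X (e - 4)" "bd X x = z"
  using assms unfolding torsion_free_at_def by metis

lemma supported_mono: "\<lbrakk>supported X m M; m' \<le> m; M \<le> M'\<rbrakk> \<Longrightarrow> supported X m' M'"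
  by (auto simp: supported_def)

lemma convexD: "convex X \<Longrightarrow> X \<subseteq> E"
  by (simp add: convex_def)

lemma bd_chains:
  assumes "X \<subseteq> E" "z \<in> chains X e"
  shows "bd X z \<in> chains X (e + 4)"
proof -
  have "t \<in> X \<and> deg t = e + 4" if "bd X z t \<noteq> 0" for t
  proof -
    have t: "t \<in> X" and "(\<Sum>s\<in>X. z s * d s t) \<noteq> 0"
      using that by (auto simp: bd_def split: if_splits)
    then obtain s where "s \<in> X" "z s * d s t \<noteq> 0"
      by (meson sum.neutral)
    then show ?thesis
      using t assms deg_d[of s t] by (auto simp: chains_def)
  qed
  then show ?thesis
    by (auto simp: chains_def)
qed

lemma bd_bd:
  assumes "convex X"
  shows "bd X (bd X z) = (\<lambda>_. 0)"
proof
  fix t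
  show "bd X (bd X z) t = 0"
  proof (cases "t \<in> X")
    case True
    have X: "X \<subseteq> E" using assms by (rule convexD)
    have *: "(\<Sum>r\<in>X. d s r * d r t) = 0" if "s \<in> X" for s
    proof -
      have "(\<Sum>r\<in>X. d s r * d r t) = (\<Sum>r\<in>E. d s r * d r t)"
      proof (rule sum.mono_neutral_left[OF finite_E X], rule ballI)
        fix r assume "r \<in> E - X"
        then have "d s r = 0 \<or> d r t = 0"
          using assms that True unfolding convex_def by blast
        then show "d s r * d r t = 0" by auto
      qed
      then show ?thesis using d_d that True X by auto
    qed
    have "bd X (bd X z) t = (\<Sum>r\<in>X. (\<Sum>s\<in>X. z s * d s r) * d r t)"
      using True by (simp add: bd_def)
    also have "\<dots> = (\<Sum>s\<in>X. z s * (\<Sum>r\<in>X. d s r * d r t))"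
      unfolding sum_distrib_left sum_distrib_right by (subst sum.swap) (simp add: mult.assoc)
    finally show ?thesis by (simp add: *)
  qed (simp add: bd_def)
qed

lemma bd_add: "bd X (\<lambda>s. y s + z s) = (\<lambda>s. bd X y s + bd X z s)"
  by (auto simp: bd_def sum.distrib algebra_simps)

lemma bd_diff: "bd X (\<lambda>s. y s - z s) = (\<lambda>s. bd X y s - bd X z s)"
  by (auto simp: bd_def sum_subtractf algebra_simps)

lemma bd_scale: "bd X (\<lambda>s. n * z s) = (\<lambda>s. n * bd X z s)"
  by (auto simp: bd_def sum_distrib_left algebra_simps)

lemma bd_zero [simp]: "bd X (\<lambda>_. 0) = (\<lambda>_. 0)"
  by (auto simp: bd_def)

lemma chains_diff: "\<lbrakk>y \<in> chains X e; z \<in> chains X e\<rbrakk> \<Longrightarrow> (\<lambda>s. y s - z s) \<in> chains X e"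
  by (simp add: chains_def) (metis diff_self)

lemma chains_add: "\<lbrakk>y \<in> chains X e; z \<in> chains X e\<rbrakk> \<Longrightarrow> (\<lambda>s. y s + z s) \<in> chains X e"
  by (simp add: chains_def) (metis add_0)

lemma chains_scale: "z \<in> chains X e \<Longrightarrow> (\<lambda>s. n * z s) \<in> chains X e"
  by (simp add: chains_def)

lemma chains_mono: "\<lbrakk>z \<in> chains X e; X \<subseteq> Y\<rbrakk> \<Longrightarrow> z \<in> chains Y e"
  by (auto simp: chains_def)

lemma chains_subset: "\<lbrakk>z \<in> chains X e; \<And>s. s \<in> X \<Longrightarrow> s \<notin> Y \<Longrightarrow> z s = 0\<rbrakk> \<Longrightarrow> z \<in> chains Y e"
  by (auto simp: chains_def)

lemma exact_torsion_free:
  assumes "convex X" "exact_at X e"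
  shows "torsion_free_at X e"
  unfolding torsion_free_at_def
proof (intro ballI allI impI)
  fix z n assume z: "z \<in> chains X e" and n: "n \<noteq> (0::int)"
    and "\<exists>y \<in> chains X (e - 4). bd X y = (\<lambda>s. n * z s)"
  then obtain y where "bd X y = (\<lambda>s. n * z s)" by blast
  then have "(\<lambda>s. n * bd X z s) = (\<lambda>_. 0)"
    using bd_bd[OF assms(1), of y] bd_scale[of X n z] by simp
  then have "bd X z = (\<lambda>_. 0)"
    using n by (metis mult_eq_0_iff)
  then show "\<exists>y \<in> chains X (e - 4). bd X y = z"
    using assms(2) z by (auto simp: exact_at_def)
qed

text \<open>
  In this context \<open>0 \<rightarrow> S \<rightarrow> X \<rightarrow> Q \<rightarrow> 0\<close> is a short exact sequence of complexes. The lemmas replace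
  the parts of its long exact homology sequence that are needed.
\<close>

context
  fixes X Q S :: "'e set"
  assumes X: "convex X" and split: "X = Q \<union> S" and disj: "Q \<inter> S = {}"
    and closed: "\<And>s t. \<lbrakk>s \<in> S; t \<in> Q\<rbrakk> \<Longrightarrow> d s t = 0"
begin

lemma finite_terms: "finite Q" "finite S"
  using convexD[OF X] split finite_E finite_subset by blast+

lemma bd_quotient: "t \<in> Q \<Longrightarrow> bd X z t = bd Q z t"
  using finite_terms disj by (auto simp: bd_def split sum.union_disjoint closed)

lemma bd_sub:
  assumes "z \<in> chains S e"
  shows "bd X z = bd S z"
proof
  fix t
  have 0: "(\<Sum>s\<in>Q. z s * d s t) = 0"
    using assms disj by (intro sum.neutral) (auto simp: chains_def)
  show "bd X z t = bd S z t"
    using finite_terms disj 0 closed by (auto simp: bd_def split sum.union_disjoint)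
qed

lemma restrict_chains: "z \<in> chains X e \<Longrightarrow> (\<lambda>s. if s \<in> Q then z s else 0) \<in> chains Q e"
  by (auto simp: chains_def)

lemma bd_restrict: "bd Q (\<lambda>s. if s \<in> Q then z s else 0) = bd Q z"
  by (auto simp: bd_def)

lemma bd_quotient_fun: "(\<lambda>t. if t \<in> Q then bd X z t else 0) = bd Q z"
proof
  fix t show "(if t \<in> Q then bd X z t else 0) = bd Q z t"
    by (cases "t \<in> Q") (simp_all add: bd_quotient, simp add: bd_def)
qed

lemma exact_lift:
  assumes Q: "exact_at Q e" and y: "y \<in> chains X e"
    and closed_y: "\<And>t. t \<in> Q \<Longrightarrow> bd X y t = 0"
  obtains v where "v \<in> chains X (e - 4)" "(\<lambda>s. y s - bd X v s) \<in> chains S e"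
proof -
  let ?yQ = "\<lambda>s. if s \<in> Q then y s else 0"
  have "bd Q ?yQ = (\<lambda>_. 0)"
    unfolding bd_restrict bd_quotient_fun [symmetric] using closed_y by auto
  then obtain v where v: "v \<in> chains Q (e - 4)" "bd Q v = ?yQ"
    using Q restrict_chains[OF y] by (auto simp: exact_at_def)
  have vX: "v \<in> chains X (e - 4)"
    using v(1) split by (auto intro: chains_mono)
  have "bd X v \<in> chains X e"
    using bd_chains[OF convexD[OF X] vX] by simp
  then have "(\<lambda>s. y s - bd X v s) \<in> chains X e"
    by (rule chains_diff[OF y])
  then have "(\<lambda>s. y s - bd X v s) \<in> chains S e"
  proof (rule chains_subset)
    fix s assume "s \<in> X" "s \<notin> S"
    then have "s \<in> Q" using split by blast
    then show "y s - bd X v s = 0" using v(2) by (simp add: bd_quotient)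
  qed
  then show thesis using that vX by blast
qed

lemma exact_extension:
  assumes "exact_at Q e" "exact_at S e"
  shows "exact_at X e"
  unfolding exact_at_def
proof (intro ballI impI)
  fix z assume z: "z \<in> chains X e" "bd X z = (\<lambda>_. 0)"
  obtain v where v: "v \<in> chains X (e - 4)" "(\<lambda>s. z s - bd X v s) \<in> chains S e"
    using exact_lift[OF assms(1) z(1)] z(2) by metis
  have "bd S (\<lambda>s. z s - bd X v s) = (\<lambda>_. 0)"
    using bd_sub[OF v(2)] z(2) bd_bd[OF X, of v] by (simp add: bd_diff)
  then obtain w where w: "w \<in> chains S (e - 4)" "bd S w = (\<lambda>s. z s - bd X v s)"
    using assms(2) v(2) by (auto simp: exact_at_def)
  have wX: "w \<in> chains X (e - 4)"
    using w(1) split by (auto intro: chains_mono)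
  have "bd X (\<lambda>s. v s + w s) = z"
    using w(2) bd_sub[OF w(1)] by (auto simp: bd_add)
  then show "\<exists>y \<in> chains X (e - 4). bd X y = z"
    using chains_add[OF v(1) wX] by blast
qed

text \<open>
  Let \<open>n z\<close> bound \<open>y\<close>. As \<open>Q\<close> is torsion free, \<open>z\<close> can be moved into \<open>S\<close>; the corrected \<open>y\<close> is then a
  cycle modulo \<open>S\<close>, and exactness of \<open>Q\<close> one step below moves it into \<open>S\<close> as well. So the connecting
  homomorphism cannot create torsion.
\<close>

lemma torsion_free_extension:
  assumes Q: "torsion_free_at Q e" "exact_at Q (e - 4)" and S: "torsion_free_at S e"
  shows "torsion_free_at X e"
  unfolding torsion_free_at_def
proof (intro ballI allI impI)
  fix z and n :: int assume z: "z \<in> chains X e" and n: "n \<noteq> 0"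
    and "\<exists>y \<in> chains X (e - 4). bd X y = (\<lambda>s. n * z s)"
  then obtain y where y: "y \<in> chains X (e - 4)" "bd X y = (\<lambda>s. n * z s)" by blast
  let ?r = "\<lambda>z s. if s \<in> Q then z s else 0"
  have "bd Q (?r y) = (\<lambda>s. n * ?r z s)"
    unfolding bd_restrict bd_quotient_fun [symmetric] y(2) by (auto simp: fun_eq_iff)
  then obtain v where v: "v \<in> chains Q (e - 4)" "bd Q v = ?r z"
    by (rule torsion_free_atE[OF Q(1) restrict_chains[OF z] n restrict_chains[OF y(1)]])
  have vX: "v \<in> chains X (e - 4)"
    using v(1) split by (auto intro: chains_mono)
  \<comment> \<open>\<open>z\<close> is homologous to a chain \<open>z'\<close> of \<open>S\<close>, and \<open>n z'\<close> bounds in \<open>X\<close>\<close>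
  define z' where "z' = (\<lambda>s. z s - bd X v s)"
  define u where "u = (\<lambda>s. y s - n * v s)"
  have u: "u \<in> chains X (e - 4)"
    unfolding u_def by (intro chains_diff y chains_scale vX)
  have bd_u: "bd X u = (\<lambda>s. n * z' s)"
    unfolding u_def z'_def bd_diff bd_scale y(2) by (simp add: algebra_simps)
  have z'Q: "z' s = 0" if "s \<in> Q" for s
    using v(2) that by (simp add: bd_quotient z'_def)
  have "z' \<in> chains X e"
    unfolding z'_def using bd_chains[OF convexD[OF X] vX] by (intro chains_diff z) simp
  then have z': "z' \<in> chains S e"
    by (rule chains_subset) (use split z'Q in auto)
  obtain w where w: "w \<in> chains X (e - 4 - 4)" "(\<lambda>s. u s - bd X w s) \<in> chains S (e - 4)"
    using exact_lift[OF Q(2) u] bd_u z'Q by auto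
  have "bd S (\<lambda>s. u s - bd X w s) = (\<lambda>s. n * z' s)"
    using bd_sub[OF w(2)] bd_bd[OF X, of w] bd_u by (simp add: bd_diff)
  then obtain x where x: "x \<in> chains S (e - 4)" "bd S x = z'"
    by (rule torsion_free_atE[OF S z' n w(2)])
  have xX: "x \<in> chains X (e - 4)"
    using x(1) split by (auto intro: chains_mono)
  have "bd X (\<lambda>s. v s + x s) = z"
    using x(2) bd_sub[OF x(1)] by (auto simp: bd_add z'_def)
  then show "\<exists>y \<in> chains X (e - 4). bd X y = z"
    using chains_add[OF vX xX] by blast
qed

text \<open>
  The exactness one step below, which the torsion statement asks for, is available because
  \<open>e < m + 4\<close> means \<open>e - 4 < m\<close>.
\<close>

lemma supported_extension:
  assumes "supported Q m M" "supported S m M"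
  shows "supported X m M"
  using assms unfolding supported_def by (auto intro!: exact_extension torsion_free_extension)

lemma supported_summands:
  assumes direct: "\<And>s t. \<lbrakk>s \<in> Q; t \<in> S\<rbrakk> \<Longrightarrow> d s t = 0" and "supported X m M"
  shows "supported Q m M"
proof -
  have bdX: "bd X z = bd Q z" if "z \<in> chains Q e" for z e
  proof
    fix t
    have "(\<Sum>s\<in>S. z s * d s t) = 0"
      using that disj by (intro sum.neutral) (auto simp: chains_def)
    then show "bd X z t = bd Q z t"
      using finite_terms disj direct by (auto simp: bd_def split sum.union_disjoint)
  qed
  have QX: "z \<in> chains X e" if "z \<in> chains Q e" for z e
    using that split by (auto intro: chains_mono)
  have lift: "\<exists>y \<in> chains Q e'. bd Q y = z" if "y \<in> chains X e'" "bd X y = z" "z \<in> chains Q e"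
    for y z e e'
  proof (intro bexI)
    show "bd Q (\<lambda>s. if s \<in> Q then y s else 0) = z"
      unfolding bd_restrict bd_quotient_fun [symmetric] using that by (auto simp: chains_def fun_eq_iff)
  qed (rule restrict_chains[OF that(1)])
  have "exact_at Q e" if "exact_at X e" for e
    using that lift QX bdX unfolding exact_at_def by metis
  moreover have "torsion_free_at Q e" if X: "torsion_free_at X e" for e
    unfolding torsion_free_at_def
  proof (intro ballI allI impI)
    fix z and n :: int assume z: "z \<in> chains Q e" and n: "n \<noteq> 0"
      and "\<exists>y \<in> chains Q (e - 4). bd Q y = (\<lambda>s. n * z s)"
    then obtain x where "x \<in> chains X (e - 4)" "bd X x = (\<lambda>s. n * z s)"
      using QX bdX by metis
    then obtain y where "y \<in> chains X (e - 4)" "bd X y = z"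
      using torsion_free_atE[OF X QX[OF z] n] by metis
    then show "\<exists>y \<in> chains Q (e - 4). bd Q y = z"
      using lift z by blast
  qed
  ultimately show ?thesis
    using assms(2) by (auto simp: supported_def)
qed

text \<open>
  The differential from \<open>Q\<close> to \<open>S\<close> is an isomorphism here, so a cycle is determined by its part in \<open>S\<close>,
  which is hit by exactly one chain of \<open>Q\<close>.
\<close>

lemma exact_cone:
  assumes h: "bij_betw h Q S"
    and unit: "\<And>s. s \<in> Q \<Longrightarrow> \<bar>d s (h s)\<bar> = 1"
    and other: "\<And>s t. \<lbrakk>s \<in> Q; t \<in> S; t \<noteq> h s\<rbrakk> \<Longrightarrow> d s t = 0"
  shows "exact_at X e"
  unfolding exact_at_def
proof (intro ballI impI)
  fix z assume z: "z \<in> chains X e" "bd X z = (\<lambda>_. 0)"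
  have bdh: "bd X y (h s) = y s * d s (h s)"
    if "s \<in> Q" and y: "\<And>t. t \<in> S \<Longrightarrow> y t = 0" for y s
  proof -
    have hs: "h s \<in> S" using h that by (auto simp: bij_betw_def)
    have "(\<Sum>r\<in>Q. y r * d r (h s)) = (\<Sum>r\<in>Q. if r = s then y s * d s (h s) else 0)"
    proof (rule sum.cong)
      fix r assume r: "r \<in> Q"
      have "d r (h s) = 0" if "r \<noteq> s"
        using other[OF r hs] bij_betw_inv_into_left[OF h] r \<open>s \<in> Q\<close> that by metis
      then show "y r * d r (h s) = (if r = s then y s * d s (h s) else 0)" by auto
    qed simp
    then have "(\<Sum>r\<in>Q. y r * d r (h s)) = y s * d s (h s)"
      using finite_terms that by simp
    then show ?thesis
      using finite_terms disj hs y by (simp add: bd_def split sum.union_disjoint)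
  qed
  define y where "y = (\<lambda>s. if s \<in> Q then z (h s) * d s (h s) else 0)"
  have y0: "y t = 0" if "t \<in> S" for t
    using disj that by (auto simp: y_def)
  have hS: "h s \<in> S" if "s \<in> Q" for s
    using h that by (auto simp: bij_betw_def)
  have sq: "d s (h s) * d s (h s) = 1" if "s \<in> Q" for s
    using unit[OF that] by (metis abs_mult_self_eq mult_1)
  have "y s \<noteq> 0 \<longrightarrow> s \<in> X \<and> deg s = e - 4" for s
  proof
    assume "y s \<noteq> 0"
    then have s: "s \<in> Q" "z (h s) \<noteq> 0" "d s (h s) \<noteq> 0" by (auto simp: y_def split: if_splits)
    then show "s \<in> X \<and> deg s = e - 4"
      using z(1) hS[OF s(1)] deg_d[of s "h s"] convexD[OF X] split by (force simp: chains_def)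
  qed
  then have y: "y \<in> chains X (e - 4)"
    by (simp add: chains_def)
  define w where "w = (\<lambda>s. z s - bd X y s)"
  have wS: "w t = 0" if "t \<in> S" for t
  proof -
    obtain s where s: "s \<in> Q" "t = h s" using h \<open>t \<in> S\<close> by (auto simp: bij_betw_def)
    have "bd X y t = z t"
      using sq s bdh[OF s(1), of y] y0 by (simp add: y_def mult.assoc)
    then show ?thesis by (simp add: w_def)
  qed
  have "bd X w = (\<lambda>_. 0)"
    unfolding w_def bd_diff bd_bd[OF X] z(2) by simp
  then have wQ: "w s = 0" if "s \<in> Q" for s
    using bdh[OF that, of w] wS unit[OF that] by (auto dest: fun_cong[of _ _ "h s"])
  have "w s = 0" if "s \<notin> X" for s
    using that z(1) by (auto simp: w_def chains_def bd_def)
  then have "w s = 0" for s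
    using wS wQ split by blast
  then have "bd X y = z"
    by (auto simp: w_def)
  with y show "\<exists>y \<in> chains X (e - 4). bd X y = z" by blast
qed

lemma supported_cone:
  assumes "bij_betw h Q S"
    and "\<And>s. s \<in> Q \<Longrightarrow> \<bar>d s (h s)\<bar> = 1"
    and "\<And>s t. \<lbrakk>s \<in> Q; t \<in> S; t \<noteq> h s\<rbrakk> \<Longrightarrow> d s t = 0"
  shows "supported X m M"
  unfolding supported_def using exact_torsion_free[OF X] exact_cone[OF assms] by blast

end

lemma supported_shift:
  assumes h: "bij_betw h X Y" and Y: "Y \<subseteq> E"
    and d_h: "\<And>s t. \<lbrakk>s \<in> X; t \<in> X\<rbrakk> \<Longrightarrow> d (h s) (h t) = d s t"
    and deg_h: "\<And>s. s \<in> X \<Longrightarrow> deg (h s) = deg s + k"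
    and "supported X m M"
  shows "supported Y (m + k) (M + k)"
proof -
  define pull where "pull = (\<lambda>z s. if s \<in> X then z (h s) else (0::int))"
  define push where "push = (\<lambda>z t. if t \<in> Y then z (inv_into X h t) else (0::int))"
  have hY: "h s \<in> Y" if "s \<in> X" for s
    using h that by (auto simp: bij_betw_def)
  have hi: "inv_into X h t \<in> X" "h (inv_into X h t) = t" if "t \<in> Y" for t
    using h that by (auto simp: bij_betw_def inv_into_into f_inv_into_f)
  have ih: "inv_into X h (h s) = s" if "s \<in> X" for s
    using h that by (simp add: bij_betw_def)
  have pull: "pull z \<in> chains X e" if "z \<in> chains Y (e + k)" for z e
    using that hY deg_h by (fastforce simp: chains_def pull_def)
  have push: "push z \<in> chains Y (e + k)" if "z \<in> chains X e" for z e
    using that hi deg_h by (fastforce simp: chains_def push_def)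
  have push_pull: "push (pull z) = z" if "z \<in> chains Y e" for z e
    using that hi by (fastforce simp: chains_def push_def pull_def)
  have bd_pull: "bd X (pull z) = pull (bd Y z)" for z
  proof
    fix t
    have "(\<Sum>s\<in>X. pull z s * d s t) = (\<Sum>s\<in>Y. z s * d s (h t))" if "t \<in> X"
      using that d_h by (subst sum.reindex_bij_betw[OF h, symmetric]) (auto simp: pull_def)
    then show "bd X (pull z) t = pull (bd Y z) t"
      using hY by (auto simp: bd_def pull_def)
  qed
  have bd_push: "bd Y (push z) = push (bd X z)" for z
  proof
    fix t
    have "(\<Sum>s\<in>Y. push z s * d s t) = (\<Sum>s\<in>X. z s * d s (inv_into X h t))" if "t \<in> Y"
      using that d_h hi hY ih
      by (subst sum.reindex_bij_betw[OF h, symmetric]) (auto simp: push_def intro!: sum.cong, metis)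
    then show "bd Y (push z) t = push (bd X z) t"
      using hi by (auto simp: bd_def push_def)
  qed
  have ex: "exact_at Y e" if X: "exact_at X (e - k)" for e
    unfolding exact_at_def
  proof (intro ballI impI)
    fix z assume z: "z \<in> chains Y e" "bd Y z = (\<lambda>_. 0)"
    then have "pull z \<in> chains X (e - k)" "bd X (pull z) = (\<lambda>_. 0)"
      using pull[of z "e - k"] bd_pull[of z] by (auto simp: pull_def)
    then obtain y where y: "y \<in> chains X (e - k - 4)" "bd X y = pull z"
      using exact_atE[OF X] by blast
    then have "bd Y (push y) = z"
      using bd_push[of y] push_pull[OF z(1)] by simp
    moreover have "push y \<in> chains Y (e - 4)"
      using push[OF y(1)] by (simp add: algebra_simps)
    ultimately show "\<exists>y \<in> chains Y (e - 4). bd Y y = z" by blast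
  qed
  have tf: "torsion_free_at Y e" if X: "torsion_free_at X (e - k)" for e
    unfolding torsion_free_at_def
  proof (intro ballI allI impI)
    fix z and n :: int assume z: "z \<in> chains Y e" and n: "n \<noteq> 0"
      and "\<exists>y \<in> chains Y (e - 4). bd Y y = (\<lambda>s. n * z s)"
    then obtain y where y: "y \<in> chains Y (e - 4)" "bd Y y = (\<lambda>s. n * z s)" by blast
    have "pull z \<in> chains X (e - k)" "pull y \<in> chains X (e - k - 4)"
      using pull[of z "e - k"] pull[of y "e - k - 4"] z y(1) by (simp_all add: algebra_simps)
    moreover have "bd X (pull y) = (\<lambda>s. n * pull z s)"
      unfolding bd_pull y(2) by (auto simp: pull_def)
    ultimately obtain x where x: "x \<in> chains X (e - k - 4)" "bd X x = pull z"
      using torsion_free_atE[OF X _ n] by metis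
    then have "bd Y (push x) = z"
      using bd_push[of x] push_pull[OF z] by simp
    moreover have "push x \<in> chains Y (e - 4)"
      using push[OF x(1)] by (simp add: algebra_simps)
    ultimately show "\<exists>y \<in> chains Y (e - 4). bd Y y = z" by blast
  qed
  show ?thesis
    using assms(5) ex tf by (auto simp: supported_def)
qed

end

section \<open>Cubes of circle systems and their differential\<close>

definition flip :: "nat \<Rightarrow> nat set \<Rightarrow> nat set" where
  "flip c s = (if c \<in> s then s - {c} else insert c s)"

lemma flip_flip [simp]: "flip c (flip c s) = s"
  by (auto simp: flip_def)

lemma flip_subset: "\<lbrakk>s \<subseteq> N; c \<in> N\<rbrakk> \<Longrightarrow> flip c s \<subseteq> N"
  by (auto simp: flip_def)

lemma flip_remove: "c \<in> s \<Longrightarrow> flip c s = s - {c}"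
  by (simp add: flip_def)

lemma sum_antisymmetric:
  fixes F :: "'a \<Rightarrow> 'a \<Rightarrow> int"
  assumes "\<And>x y. F x y = - F y x"
  shows "(\<Sum>x\<in>A. \<Sum>y\<in>A. F x y) = 0"
proof -
  have "(\<Sum>x\<in>A. \<Sum>y\<in>A. F x y) = (\<Sum>y\<in>A. \<Sum>x\<in>A. F x y)"
    by (rule sum.swap)
  also have "\<dots> = (\<Sum>y\<in>A. \<Sum>x\<in>A. - F y x)"
    by (intro sum.cong refl assms)
  also have "\<dots> = - (\<Sum>x\<in>A. \<Sum>y\<in>A. F x y)"
    by (simp add: sum_negf)
  finally show ?thesis by simp
qed

text \<open>
  What is kept of a diagram: for every state \<open>s\<close> the map \<open>cl s\<close> from points to the circles they lie on,
  and for every crossing two points \<open>a c\<close> and \<open>b c\<close> that lie on the two arcs at \<open>c\<close> in both smoothings.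
  Changing the marker at \<open>c\<close> joins the circles of \<open>a c\<close> and \<open>b c\<close> if they differ and separates these
  points if they are on one circle; other circles remain the same objects.
\<close>

locale state_cube =
  fixes N :: "nat set" and Pts :: "'p set" and cl :: "nat set \<Rightarrow> 'p \<Rightarrow> 'c" and a b :: "nat \<Rightarrow> 'p"
  assumes finite_N: "finite N" and finite_Pts: "finite Pts"
    and a_Pts: "c \<in> N \<Longrightarrow> a c \<in> Pts" and b_Pts: "c \<in> N \<Longrightarrow> b c \<in> Pts"
    and merge: "\<lbrakk>s \<subseteq> N; c \<in> N; cl s (a c) \<noteq> cl s (b c); x \<in> Pts; y \<in> Pts\<rbrakk> \<Longrightarrow>
      cl (flip c s) x = cl (flip c s) y \<longleftrightarrow>
        cl s x = cl s y \<or> {cl s x, cl s y} = {cl s (a c), cl s (b c)}"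
    and split: "\<lbrakk>s \<subseteq> N; c \<in> N; cl s (a c) = cl s (b c)\<rbrakk> \<Longrightarrow>
      cl (flip c s) (a c) \<noteq> cl (flip c s) (b c)"
    and unaffected: "\<lbrakk>s \<subseteq> N; c \<in> N; x \<in> Pts; cl s x \<noteq> cl s (a c); cl s x \<noteq> cl s (b c)\<rbrakk> \<Longrightarrow>
      cl (flip c s) x = cl s x"
begin

definition merges :: "nat set \<Rightarrow> nat \<Rightarrow> bool" where
  "merges s c \<longleftrightarrow> cl s (a c) \<noteq> cl s (b c)"

definition circ :: "nat set \<Rightarrow> 'c set" where
  "circ s = cl s ` Pts"

lemma finite_circ [simp]: "finite (circ s)"
  by (simp add: circ_def finite_Pts)

lemma merges_flip: "\<lbrakk>s \<subseteq> N; c \<in> N\<rbrakk> \<Longrightarrow> merges (flip c s) c \<longleftrightarrow> \<not> merges s c"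
  using merge[of s c "a c" "b c"] split[of s c] a_Pts b_Pts by (auto simp: merges_def)

lemma split_iff:
  assumes "s \<subseteq> N" "c \<in> N" "\<not> merges s c" "x \<in> Pts" "y \<in> Pts"
  shows "cl s x = cl s y \<longleftrightarrow> cl (flip c s) x = cl (flip c s) y \<or>
    {cl (flip c s) x, cl (flip c s) y} = {cl (flip c s) (a c), cl (flip c s) (b c)}"
  using merge[of "flip c s" c x y] merges_flip[of s c] flip_subset[of s N c] assms
  by (simp add: merges_def)

lemma split_cases:
  assumes "s \<subseteq> N" "c \<in> N" "\<not> merges s c" "x \<in> Pts" "cl s x = cl s (a c)"
  shows "cl (flip c s) x = cl (flip c s) (a c) \<or> cl (flip c s) x = cl (flip c s) (b c)"
  using split_iff[OF assms(1-4) a_Pts[OF assms(2)]] assms(5) by (auto simp: doubleton_eq_iff)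

lemma away:
  assumes "s \<subseteq> N" "c \<in> N" "x \<in> Pts" "cl s x \<noteq> cl s (a c)" "cl s x \<noteq> cl s (b c)"
  shows "cl (flip c s) x \<noteq> cl (flip c s) (a c)" "cl (flip c s) x \<noteq> cl (flip c s) (b c)"
proof -
  have *: "cl (flip c s) x \<noteq> cl (flip c s) y"
    if "y \<in> Pts" "cl s y = cl s (a c) \<or> cl s y = cl s (b c)" for y
  proof (cases "merges s c")
    case True
    then have "cl (flip c s) x = cl (flip c s) y \<longleftrightarrow>
        cl s x = cl s y \<or> {cl s x, cl s y} = {cl s (a c), cl s (b c)}"
      using assms that by (intro merge) (auto simp: merges_def)
    then show ?thesis
      using assms(4,5) that unfolding doubleton_eq_iff by metis
  next
    case False
    then have "cl s x = cl s y" if "cl (flip c s) x = cl (flip c s) y"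
      using split_iff[of s c x y] assms \<open>y \<in> Pts\<close> that by metis
    then show ?thesis
      using assms(4,5) that by metis
  qed
  show "cl (flip c s) x \<noteq> cl (flip c s) (a c)" "cl (flip c s) x \<noteq> cl (flip c s) (b c)"
    using * a_Pts b_Pts assms(2) by auto
qed

definition near :: "nat set \<Rightarrow> nat \<Rightarrow> 'c set" where
  "near s c = {cl s (a c), cl s (b c)}"

lemma near_circ: "c \<in> N \<Longrightarrow> near s c \<subseteq> circ s"
  by (auto simp: near_def circ_def a_Pts b_Pts)

lemma card_near: "card (near s c) = (if merges s c then 2 else 1)"
  by (simp add: near_def merges_def)

lemma away_near:
  assumes "s \<subseteq> N" "c \<in> N" "x \<in> Pts" "cl s x \<notin> near s c"
  shows "cl (flip c s) x = cl s x" "cl (flip c s) x \<notin> near (flip c s) c"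
  using assms away[of s c x] unaffected[of s c x] by (auto simp: near_def)

lemma circ_far:
  assumes "s \<subseteq> N" "c \<in> N"
  shows "circ (flip c s) - near (flip c s) c = circ s - near s c"
proof -
  have "circ s - near s c \<subseteq> circ (flip c s) - near (flip c s) c" if "s \<subseteq> N" for s
  proof
    fix C assume "C \<in> circ s - near s c"
    then obtain x where "x \<in> Pts" "C = cl s x" "cl s x \<notin> near s c" by (auto simp: circ_def)
    then show "C \<in> circ (flip c s) - near (flip c s) c"
      using away_near[OF that assms(2), of x] imageI[of x Pts "cl (flip c s)"]
      unfolding circ_def by simp
  qed
  from this[OF assms(1)] this[OF flip_subset[OF assms]] show ?thesis by auto
qed

lemma card_circ_flip:
  assumes "s \<subseteq> N" "c \<in> N"
  shows "int (card (circ (flip c s))) = int (card (circ s)) + (if merges s c then -1 else 1)"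
proof -
  have *: "int (card (circ s)) = int (card (circ s - near s c)) + int (card (near s c))" for s
  proof -
    have "card (circ s) = card (circ s \<inter> near s c) + card (circ s - near s c)"
      by (rule card_Int_Diff) simp
    then show ?thesis
      using near_circ[OF assms(2), of s] by (simp add: Int_absorb1)
  qed
  show ?thesis
    using *[of s] *[of "flip c s"] circ_far[OF assms] merges_flip[OF assms]
    by (auto simp: card_near)
qed

definition \<sigma>\<^sub>s :: "nat set \<Rightarrow> int" where
  "\<sigma>\<^sub>s s = int (card s) - int (card (N - s))"

definition \<tau>\<^sub>s :: "nat set \<times> 'c set \<Rightarrow> int" where
  "\<tau>\<^sub>s S = int (card (snd S)) - int (card (circ (fst S) - snd S))"

definition gens :: "(nat set \<times> 'c set) set" where
  "gens = (SIGMA s : Pow N. Pow (circ s))"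

text \<open>
  Instead of the degree \<open>j\<close>, which is constant along the differential, the change of \<open>\<tau>\<close> is prescribed.
\<close>

definition adj :: "nat \<Rightarrow> nat set \<Rightarrow> 'c set \<Rightarrow> 'c set \<Rightarrow> bool" where
  "adj c s T T' \<longleftrightarrow> T - near s c = T' - near (s - {c}) c \<and> \<tau>\<^sub>s (s - {c}, T') = \<tau>\<^sub>s (s, T) + 1"

definition sgn_at :: "nat \<Rightarrow> nat set \<Rightarrow> int" where
  "sgn_at c s = (-1) ^ card {x \<in> N - s. c < x}"

text \<open>
  At most one summand differs from 0: the one of the crossing at which the two states differ.
\<close>

definition diff :: "nat set \<times> 'c set \<Rightarrow> nat set \<times> 'c set \<Rightarrow> int" where
  "diff S S' = (\<Sum>c\<in>fst S. if fst S' = fst S - {c} \<and> adj c (fst S) (snd S) (snd S')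
     then sgn_at c (fst S) else 0)"

definition delta :: "nat set \<times> 'c set \<Rightarrow> int" where
  "delta S = 2 * \<tau>\<^sub>s S - \<sigma>\<^sub>s (fst S)"

lemma finite_gens [simp]: "finite gens"
  by (auto simp: gens_def finite_N intro!: finite_SigmaI)

lemma diff_remove:
  assumes "c \<in> s" "s \<subseteq> N"
  shows "diff (s, T) (s - {c}, T') = (if adj c s T T' then sgn_at c s else 0)"
proof -
  have "finite s" using assms finite_N finite_subset by blast
  have "diff (s, T) (s - {c}, T') =
    (\<Sum>c'\<in>s. if c' = c then (if adj c s T T' then sgn_at c s else 0) else 0)"
    unfolding diff_def fst_conv snd_conv using assms by (intro sum.cong) auto
  then show ?thesis using assms \<open>finite s\<close> by simp
qed

lemma diff_nonzero:
  assumes "diff (s, T) (s', T') \<noteq> 0"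
  obtains c where "c \<in> s" "s' = s - {c}" "adj c s T T'"
proof -
  have "(\<Sum>c\<in>s. if s' = s - {c} \<and> adj c s T T' then sgn_at c s else 0) \<noteq> 0"
    using assms unfolding diff_def fst_conv snd_conv .
  then obtain c where "c \<in> s" "(if s' = s - {c} \<and> adj c s T T' then sgn_at c s else 0) \<noteq> 0"
    by (rule sum.not_neutral_contains_not_neutral)
  then show thesis using that by (metis (no_types))
qed

lemma \<sigma>_remove: "\<lbrakk>c \<in> s; s \<subseteq> N\<rbrakk> \<Longrightarrow> \<sigma>\<^sub>s (s - {c}) = \<sigma>\<^sub>s s - 2"
proof -
  assume c: "c \<in> s" "s \<subseteq> N"
  have fs: "finite s" using c finite_N finite_subset by blast
  have "N - (s - {c}) = insert c (N - s)" using c by blast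
  then have "card (N - (s - {c})) = Suc (card (N - s))"
    using c finite_N by simp
  moreover have "card s = Suc (card (s - {c}))"
    using card_Suc_Diff1[OF fs c(1)] by simp
  ultimately show "\<sigma>\<^sub>s (s - {c}) = \<sigma>\<^sub>s s - 2"
    by (simp add: \<sigma>\<^sub>s_def)
qed

lemma delta_diff:
  assumes "S \<in> gens" "diff S S' \<noteq> 0"
  shows "delta S' = delta S + 4"
proof -
  obtain s T s' T' where S: "S = (s, T)" "S' = (s', T')" by fastforce
  obtain c where "c \<in> s" "s' = s - {c}" "adj c s T T'"
    using assms(2) unfolding S by (rule diff_nonzero)
  then show ?thesis
    using assms(1) \<sigma>_remove[of c s] by (auto simp: S gens_def delta_def adj_def)
qed

lemma \<tau>_eq: "T \<subseteq> circ s \<Longrightarrow> \<tau>\<^sub>s (s, T) = 2 * int (card T) - int (card (circ s))"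
  by (simp add: \<tau>\<^sub>s_def card_Diff_subset finite_subset[OF _ finite_circ] card_mono of_nat_diff)

lemma adj_card:
  assumes "c \<in> s" "s \<subseteq> N" "T \<subseteq> circ s" "V \<subseteq> circ (s - {c})"
  shows "adj c s T V \<longleftrightarrow> T - near s c = V - near (s - {c}) c \<and>
    card V = card T + (if merges s c then 0 else 1)"
  using card_circ_flip[of s c] assms
  by (auto simp: adj_def \<tau>_eq flip_remove)

text \<open>
  A circle with sign \<open>-\<close> or \<open>+\<close> stands for \<open>1\<close> or \<open>x\<close> in \<open>\<int>[x]/(x\<^sup>2)\<close>, so an enhanced state is a squarefree
  monomial in variables \<open>x\<^sub>C\<close>, one for each circle. A word of points denotes the product of the variables
  of their circles, which vanishes if two letters share a circle; \<open>ev s w T\<close> is the coefficient in it of the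
  monomial with set of positive circles \<open>T\<close>. The same word makes sense in every state, which makes the
  maps of different states comparable.
\<close>

definition ev :: "nat set \<Rightarrow> 'p list \<Rightarrow> 'c set \<Rightarrow> int" where
  "ev s w T = of_bool (distinct (map (cl s) w) \<and> cl s ` set w = T)"

text \<open>
  In the ring of the previous definition a merger is the quotient map that identifies two variables,
  and a split is multiplication by the sum of the variables of the two new circles.
\<close>

definition act :: "nat \<Rightarrow> nat set \<Rightarrow> 'p list \<Rightarrow> 'p list list" where
  "act c s w = (if merges s c then [w] else [a c # w, b c # w])"

text \<open>
  Circles in \<open>M\<close> and outside of it can be examined separately.
\<close>

lemma ev_near_far:
  "ev s v V =
     of_bool (distinct (map (cl s) (filter (\<lambda>x. cl s x \<notin> M) v)) \<and>
       cl s ` set (filter (\<lambda>x. cl s x \<notin> M) v) = V - M) *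
     of_bool (distinct (map (cl s) (filter (\<lambda>x. cl s x \<in> M) v)) \<and>
       cl s ` set (filter (\<lambda>x. cl s x \<in> M) v) = V \<inter> M)"
proof -
  have "distinct (map (cl s) v) \<longleftrightarrow>
    distinct (map (cl s) (filter (\<lambda>x. cl s x \<notin> M) v)) \<and>
    distinct (map (cl s) (filter (\<lambda>x. cl s x \<in> M) v))"
    by (induction v) (auto simp: image_iff)
  moreover have "cl s ` set v = V \<longleftrightarrow>
    cl s ` set (filter (\<lambda>x. cl s x \<notin> M) v) = V - M \<and>
    cl s ` set (filter (\<lambda>x. cl s x \<in> M) v) = V \<inter> M"
  proof -
    have "cl s ` set (filter (\<lambda>x. cl s x \<notin> M) v) = cl s ` set v - M"
      "cl s ` set (filter (\<lambda>x. cl s x \<in> M) v) = cl s ` set v \<inter> M"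
      by auto
    then show ?thesis by (simp only:) blast
  qed
  ultimately show ?thesis by (auto simp: ev_def)
qed

text \<open>
  Away from \<open>c\<close> both sides require the same circles. At \<open>c\<close> it is a comparison of the numbers of positive
  circles before and after: a merger keeps it, a split raises it by one.
\<close>

lemma adj_word:
  assumes cs: "c \<in> s" "s \<subseteq> N" and w: "set w \<subseteq> Pts" "distinct (map (cl s) w)"
    and V: "V \<subseteq> circ (s - {c})"
  shows "of_bool (adj c s (cl s ` set w) V) = (\<Sum>v\<leftarrow>act c s w. ev (s - {c}) v V)"
proof -
  define s' where "s' = s - {c}"
  have fl: "flip c s = s'" using cs by (simp add: s'_def flip_remove)
  have cN: "c \<in> N" using cs by blast
  define T where "T = cl s ` set w"
  define M where "M = near s' c"
  define wf where "wf = filter (\<lambda>x. cl s x \<notin> near s c) w"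
  define wn where "wn = filter (\<lambda>x. cl s x \<in> near s c) w"
  have T: "T \<subseteq> circ s" using w by (auto simp: T_def circ_def)
  have fin: "finite T" "finite V"
    using T V finite_subset[OF _ finite_circ] by blast+
  have far: "cl s' x = cl s x \<and> cl s' x \<notin> M" if "x \<in> set w" "cl s x \<notin> near s c" for x
    using away_near[OF cs(2) cN, of x] that w(1) fl by (auto simp: M_def)
  have near: "cl s' x \<in> M" if "x \<in> set w" "cl s x \<in> near s c" for x
  proof (rule ccontr)
    assume "cl s' x \<notin> M"
    moreover have "s' \<subseteq> N" "flip c s' = s" using fl cs flip_flip[of c s] by (auto simp: s'_def)
    ultimately have "cl s x = cl s' x" "cl s' x \<notin> near s' c" "cl s x \<notin> near s c"
      using away_near[of s' c x] cN that(1) w(1) by (auto simp: M_def)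
    then show False using that(2) by simp
  qed
  have filt: "filter (\<lambda>x. cl s' x \<notin> M) w = wf" "filter (\<lambda>x. cl s' x \<in> M) w = wn"
    unfolding wf_def wn_def using far near by (auto intro!: filter_cong)
  have map_wf: "map (cl s') wf = map (cl s) wf"
    using far by (auto simp: wf_def)
  have dist: "distinct (map (cl s) wf)" "distinct (map (cl s) wn)"
    unfolding wf_def wn_def using w(2) by (auto simp: distinct_map_filter)
  have T_far: "cl s ` set wf = T - near s c" and T_near: "cl s ` set wn = T \<inter> near s c"
    by (auto simp: wf_def wn_def T_def)
  have ev_w: "ev s' (u @ w) V = of_bool (T - near s c = V - M) *
      of_bool (distinct (map (cl s') (u @ wn)) \<and> cl s' ` set (u @ wn) = V \<inter> M)"
    if "\<forall>x \<in> set u. cl s' x \<in> M" for u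
  proof -
    have "filter (\<lambda>x. cl s' x \<notin> M) (u @ w) = wf" "filter (\<lambda>x. cl s' x \<in> M) (u @ w) = u @ wn"
      using that filt by (auto simp: filter_empty_conv filter_id_conv)
    moreover have "cl s' ` set wf = T - near s c"
      using map_wf T_far by (metis list.set_map)
    ultimately show ?thesis
      by (subst ev_near_far[of _ _ _ M]) (simp only: map_wf dist, auto)
  qed
  have cardT: "card T = card (T - near s c) + length wn"
    using dist(2) T_near fin(1) card_Int_Diff[of T "near s c"] distinct_card[of "map (cl s) wn"]
    by simp
  have cardV: "card V = card (V - M) + card (V \<inter> M)"
    using fin(2) card_Int_Diff[of V M] by simp
  have adj: "adj c s T V \<longleftrightarrow> T - near s c = V - M \<and>
      card (V \<inter> M) = length wn + (if merges s c then 0 else 1)"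
    using adj_card[OF cs T V] cardT cardV by (auto simp: M_def s'_def)
  have wn: "set wn \<subseteq> set w" by (auto simp: wn_def)
  have wnM: "cl s' x \<in> M" if "x \<in> set wn" for x
    using that near by (auto simp: wn_def)
  show ?thesis
  proof (cases "merges s c")
    case True
    then have "\<not> merges s' c"
      using merges_flip[OF cs(2) cN] fl by simp
    then obtain C where M: "M = {C}"
      by (auto simp: M_def near_def merges_def)
    then have C: "cl s' x = C" if "x \<in> set wn" for x
      using wnM that by auto
    have "distinct (map (cl s') wn) \<and> cl s' ` set wn = V \<inter> {C} \<longleftrightarrow> card (V \<inter> {C}) = length wn"
    proof -
      consider "wn = []" | x where "wn = [x]" | x y zs where "wn = x # y # zs"
        by (metis neq_Nil_conv)
      then show ?thesis
        using C by cases (cases "C \<in> V"; auto)+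
    qed
    then show ?thesis
      using True ev_w[of "[]"] by (simp add: adj act_def M T_def [symmetric] s'_def [symmetric])
  next
    case False
    then have "merges s' c"
      using merges_flip[OF cs(2) cN] fl by simp
    then obtain A B where AB: "cl s' (a c) = A" "cl s' (b c) = B" "A \<noteq> B" and M: "M = {A, B}"
      by (auto simp: M_def near_def merges_def)
    have nr: "near s c = {cl s (a c)}"
      using False by (auto simp: near_def merges_def)
    have sum: "of_bool (card (V \<inter> {A, B}) = Suc (length wn)) =
      (of_bool (distinct (A # map (cl s') wn) \<and> insert A (cl s' ` set wn) = V \<inter> {A, B}) +
       of_bool (distinct (B # map (cl s') wn) \<and> insert B (cl s' ` set wn) = V \<inter> {A, B}) :: int)"
    proof -
      have "length wn \<le> 1"
        using dist(2) T_near nr distinct_card[of "map (cl s) wn"] card_mono[of "{cl s (a c)}" "T \<inter> near s c"]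
        by simp
      then consider "wn = []" | x where "wn = [x]" "cl s' x = A \<or> cl s' x = B"
        using wnM M by (cases wn) auto
      moreover have "V \<inter> {A, B} = {} \<or> V \<inter> {A, B} = {A} \<or> V \<inter> {A, B} = {B} \<or> V \<inter> {A, B} = {A, B}"
        by blast
      ultimately show ?thesis
        using AB(3) by cases (elim disjE; force)+
    qed
    have "ev s' (a c # w) V = of_bool (T - near s c = V - M) *
        of_bool (distinct (A # map (cl s') wn) \<and> insert A (cl s' ` set wn) = V \<inter> {A, B})"
      "ev s' (b c # w) V = of_bool (T - near s c = V - M) *
        of_bool (distinct (B # map (cl s') wn) \<and> insert B (cl s' ` set wn) = V \<inter> {A, B})"
      using ev_w[of "[a c]"] ev_w[of "[b c]"] AB M by simp_all
    then have "ev s' (a c # w) V + ev s' (b c # w) V =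
        of_bool (T - near s c = V - M) * of_bool (card (V \<inter> {A, B}) = Suc (length wn))"
      by (simp only: sum distrib_left)
    then show ?thesis
      using False by (simp add: adj act_def M T_def [symmetric] s'_def [symmetric])
  qed
qed

text \<open>
  The same as \<open>adj_word\<close>, extended linearly to all words. Words that vanish have to be sent to 0, since
  the words that result from one step may vanish.
\<close>

lemma adj_word_sum:
  assumes cs: "c \<in> s" "s \<subseteq> N" and w: "set w \<subseteq> Pts" and V: "V \<subseteq> circ (s - {c})"
  shows "(\<Sum>R\<in>Pow (circ s). ev s w R * of_bool (adj c s R V)) = (\<Sum>v\<leftarrow>act c s w. ev (s - {c}) v V)"
proof (cases "distinct (map (cl s) w)")
  case True
  have "ev s w R * of_bool (adj c s R V) =
      (if R = cl s ` set w then of_bool (adj c s (cl s ` set w) V) else 0)" for R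
    using True by (auto simp: ev_def)
  moreover have "cl s ` set w \<in> Pow (circ s)"
    using w by (auto simp: circ_def)
  ultimately show ?thesis
    using adj_word[OF cs w True V] by simp
next
  case False
  have cN: "c \<in> N" using cs by blast
  have fl: "flip c s = s - {c}" using cs by (simp add: flip_remove)
  obtain u x v y z where w_eq: "w = u @ x # v @ y # z" and xy: "cl s x = cl s y"
    using not_distinct_decomp[OF False] by (force simp: map_eq_append_conv map_eq_Cons_conv append_eq_map_conv Cons_eq_map_conv)
  have Pts: "x \<in> Pts" "y \<in> Pts" using w w_eq by auto
  have "ev (s - {c}) v' V = 0" if "v' \<in> set (act c s w)" for v'
  proof (cases "merges s c")
    case True
    then have "cl (s - {c}) x = cl (s - {c}) y"
      using merge[OF cs(2) cN _ Pts] xy fl by (simp add: merges_def)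
    then show ?thesis
      using that True by (auto simp: act_def ev_def w_eq)
  next
    case False
    \<comment> \<open>two letters on the circle that splits stay together, or one of them meets the new letter\<close>
    have "cl (s - {c}) x = cl (s - {c}) y \<or>
      {cl (s - {c}) x, cl (s - {c}) y} = {cl (s - {c}) (a c), cl (s - {c}) (b c)}"
      using split_iff[OF cs(2) cN False Pts] xy fl by simp
    then show ?thesis
      using that False by (auto simp: act_def ev_def w_eq doubleton_eq_iff)
  qed
  then have "(\<Sum>v\<leftarrow>act c s w. ev (s - {c}) v V) = 0"
    by (simp add: act_def split: if_splits)
  moreover have "ev s w R = 0" for R
    using False by (auto simp: ev_def)
  ultimately show ?thesis by simp
qed

lemma act_Pts: "\<lbrakk>c \<in> N; set w \<subseteq> Pts; v \<in> set (act c s w)\<rbrakk> \<Longrightarrow> set v \<subseteq> Pts"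
  by (auto simp: act_def a_Pts b_Pts split: if_splits)

lemma ev_swap: "ev s (x # y # w) = ev s (y # x # w)"
  by (auto simp: ev_def fun_eq_iff insert_commute)

lemma ev_Cons_cong: "cl s x = cl s y \<Longrightarrow> ev s (x # w) = ev s (y # w)"
  by (auto simp: ev_def fun_eq_iff)

text \<open>
  The two composites along a square are both given by words over the same final state. The numbers of
  circles leave six combinations of mergers and splits. In four of them the lists of words agree up to the
  order of letters; in the other two the words contain ends of \<open>c\<close> in one list and ends of \<open>e\<close> in the
  other, and these lie on the same circles.
\<close>

lemma act_commute:
  assumes s: "s \<subseteq> N" and c: "c \<in> s" "e \<in> s" "c \<noteq> e" and w: "set w \<subseteq> Pts"
  shows "(\<Sum>u\<leftarrow>act c s w. \<Sum>v\<leftarrow>act e (s - {c}) u. ev (s - {c} - {e}) v V) =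
    (\<Sum>u\<leftarrow>act e s w. \<Sum>v\<leftarrow>act c (s - {e}) u. ev (s - {c} - {e}) v V)"
proof -
  define t where "t = s - {c} - {e}"
  have fl: "flip c s = s - {c}" "flip e s = s - {e}" "flip e (s - {c}) = t" "flip c (s - {e}) = t"
    using c by (auto simp: flip_def t_def)
  have sub: "s - {c} \<subseteq> N" "s - {e} \<subseteq> N" and N: "c \<in> N" "e \<in> N"
    using s c by auto
  note Pts = a_Pts[OF N(1)] b_Pts[OF N(1)] a_Pts[OF N(2)] b_Pts[OF N(2)]
  have count: "(if merges s c then -1 else 1) + (if merges (s - {c}) e then -1 else 1) =
    (if merges s e then -1 else 1) + (if merges (s - {e}) c then -1 else (1::int))"
    using card_circ_flip[OF s N(1)] card_circ_flip[OF s N(2)]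
      card_circ_flip[OF sub(1) N(2)] card_circ_flip[OF sub(2) N(1)] unfolding fl by linarith
  have ss: "\<not> merges s c \<Longrightarrow> merges (s - {c}) e \<Longrightarrow> \<not> merges s e \<Longrightarrow>
      cl t (a c) = cl t (a e) \<and> cl t (b c) = cl t (b e)"
  proof -
    \<comment> \<open>\<open>c\<close> and \<open>e\<close> are interlaced on one circle, which survives as one circle\<close>
    assume m: "\<not> merges s c" "merges (s - {c}) e" "\<not> merges s e"
    have "{cl (s - {c}) (a e), cl (s - {c}) (b e)} = {cl (s - {c}) (a c), cl (s - {c}) (b c)}"
      using split_iff[OF s N(1) m(1) Pts(3,4)] m(2,3) by (auto simp: merges_def fl)
    moreover have "cl t x = cl t y \<longleftrightarrow> cl (s - {c}) x = cl (s - {c}) y \<or>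
        {cl (s - {c}) x, cl (s - {c}) y} = {cl (s - {c}) (a e), cl (s - {c}) (b e)}"
      if "x \<in> Pts" "y \<in> Pts" for x y
      using merge[OF sub(1) N(2) _ that] m(2) by (simp add: merges_def fl)
    ultimately show "cl t (a c) = cl t (a e) \<and> cl t (b c) = cl t (b e)"
      using Pts by (metis doubleton_eq_iff)
  qed
  have mm: "merges s c \<Longrightarrow> \<not> merges (s - {c}) e \<Longrightarrow> merges s e \<Longrightarrow> \<not> merges (s - {e}) c \<Longrightarrow>
      (cl t (a c) = cl t (a e) \<and> cl t (b c) = cl t (b e)) \<or>
      (cl t (a c) = cl t (b e) \<and> cl t (b c) = cl t (a e))"
  proof -
    \<comment> \<open>\<open>c\<close> and \<open>e\<close> join the same two circles, before and after\<close>
    assume m: "merges s c" "\<not> merges (s - {c}) e" "merges s e" "\<not> merges (s - {e}) c"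
    have meq: "cl (s - {c}) x = cl (s - {c}) y \<longleftrightarrow> cl s x = cl s y \<or>
        {cl s x, cl s y} = {cl s (a c), cl s (b c)}"
      if "x \<in> Pts" "y \<in> Pts" for x y
      using merge[OF s N(1) _ that] m(1) by (simp add: merges_def fl)
    have "{cl s (a e), cl s (b e)} = {cl s (a c), cl s (b c)}"
      using meq[OF Pts(3,4)] m(2,3) by (auto simp: merges_def)
    then have "cl (s - {c}) (a c) = cl (s - {c}) (a e)" "cl (s - {c}) (b c) = cl (s - {c}) (a e)"
      using meq[OF Pts(1,3)] meq[OF Pts(2,3)] by (auto simp: doubleton_eq_iff)
    then have "cl t (a c) = cl t (a e) \<or> cl t (a c) = cl t (b e)"
      "cl t (b c) = cl t (a e) \<or> cl t (b c) = cl t (b e)"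
      using split_cases[OF sub(1) N(2) m(2) Pts(1)] split_cases[OF sub(1) N(2) m(2) Pts(2)]
      by (auto simp: fl)
    moreover have "cl t (a c) \<noteq> cl t (b c)"
      using split[OF sub(2) N(1)] m(4) by (simp add: merges_def fl)
    ultimately show ?thesis by metis
  qed
  have eqs: "ev t (a c # w) V = ev t (a e # w) V \<and> ev t (b c # w) V = ev t (b e # w) V"
    if "cl t (a c) = cl t (a e) \<and> cl t (b c) = cl t (b e)"
    using that ev_Cons_cong by metis
  have eqs': "ev t (a c # w) V = ev t (b e # w) V \<and> ev t (b c # w) V = ev t (a e # w) V"
    if "cl t (a c) = cl t (b e) \<and> cl t (b c) = cl t (a e)"
    using that ev_Cons_cong by metis
  have exch: "ev t (a c # w) V + ev t (b c # w) V = ev t (a e # w) V + ev t (b e # w) V"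
    if "(cl t (a c) = cl t (a e) \<and> cl t (b c) = cl t (b e)) \<or>
      (cl t (a c) = cl t (b e) \<and> cl t (b c) = cl t (a e))"
    using that
  proof
    assume "cl t (a c) = cl t (a e) \<and> cl t (b c) = cl t (b e)"
    then show ?thesis using ev_Cons_cong[of t "a c" "a e" w] ev_Cons_cong[of t "b c" "b e" w] by simp
  next
    assume "cl t (a c) = cl t (b e) \<and> cl t (b c) = cl t (a e)"
    then show ?thesis using ev_Cons_cong[of t "a c" "b e" w] ev_Cons_cong[of t "b c" "a e" w] by simp
  qed
  consider (merge_merge) "merges s c" "merges (s - {c}) e" "merges s e" "merges (s - {e}) c"
    | (split_split) "\<not> merges s c" "\<not> merges (s - {c}) e" "\<not> merges s e" "\<not> merges (s - {e}) c"
    | (merge_split) "merges s c" "\<not> merges (s - {c}) e" "merges s e" "\<not> merges (s - {e}) c"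
    | (split_merge) "\<not> merges s c" "merges (s - {c}) e" "\<not> merges s e" "merges (s - {e}) c"
    | (mixed1) "merges s c" "\<not> merges (s - {c}) e" "\<not> merges s e" "merges (s - {e}) c"
    | (mixed2) "\<not> merges s c" "merges (s - {c}) e" "merges s e" "\<not> merges (s - {e}) c"
    using count
    by (cases "merges s c"; cases "merges (s - {c}) e"; cases "merges s e"; cases "merges (s - {e}) c"; simp)
  then show ?thesis
  proof cases
    case split_split
    then show ?thesis
      using ev_swap[of t "a e" "a c" w] ev_swap[of t "a e" "b c" w]
        ev_swap[of t "b e" "a c" w] ev_swap[of t "b e" "b c" w]
      by (simp add: act_def t_def [symmetric])
  next
    case merge_split
    then show ?thesis using exch[OF mm] by (simp add: act_def t_def [symmetric])
  next
    case split_merge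
    then show ?thesis using exch[OF disjI1[OF ss]] by (simp add: act_def t_def [symmetric])
  qed (simp_all add: act_def)
qed

lemma adj_commute:
  assumes s: "s \<subseteq> N" and c: "c \<in> s" "e \<in> s" "c \<noteq> e" and T: "T \<subseteq> circ s"
    and V: "V \<subseteq> circ (s - {c} - {e})"
  shows "(\<Sum>R\<in>Pow (circ (s - {c})). of_bool (adj c s T R) * of_bool (adj e (s - {c}) R V)) =
    (\<Sum>R\<in>Pow (circ (s - {e})). of_bool (adj e s T R) * (of_bool (adj c (s - {e}) R V) :: int))"
proof -
  obtain w where w: "set w \<subseteq> Pts" "distinct (map (cl s) w)" "cl s ` set w = T"
  proof -
    obtain W where W: "W \<subseteq> Pts" "inj_on (cl s) W" "T = cl s ` W"
      using T unfolding circ_def subset_image_inj by blast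
    moreover obtain w where "set w = W" "distinct w"
      using finite_distinct_list[of W] W finite_Pts finite_subset by blast
    ultimately show thesis using that[of w] by (auto simp: distinct_map)
  qed
  have *: "(\<Sum>R\<in>Pow (circ (s - {c})). of_bool (adj c s T R) * of_bool (adj e (s - {c}) R V)) =
      (\<Sum>u\<leftarrow>act c s w. \<Sum>v\<leftarrow>act e (s - {c}) u. ev (s - {c} - {e}) v V)"
    if c: "c \<in> s" "e \<in> s" "c \<noteq> e" and V: "V \<subseteq> circ (s - {c} - {e})" for c e
  proof -
    have cN: "c \<in> N" "e \<in> N" "s - {c} \<subseteq> N" using c s by auto
    have "(\<Sum>R\<in>Pow (circ (s - {c})). of_bool (adj c s T R) * of_bool (adj e (s - {c}) R V)) =
      (\<Sum>R\<in>Pow (circ (s - {c})). (\<Sum>v\<leftarrow>act c s w. ev (s - {c}) v R * of_bool (adj e (s - {c}) R V)))"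
    proof (rule sum.cong)
      fix R assume "R \<in> Pow (circ (s - {c}))"
      then have "of_bool (adj c s T R) = (\<Sum>v\<leftarrow>act c s w. ev (s - {c}) v R)"
        using adj_word[OF c(1) s w(1,2), of R] w(3) by simp
      then show "of_bool (adj c s T R) * of_bool (adj e (s - {c}) R V) =
          (\<Sum>v\<leftarrow>act c s w. ev (s - {c}) v R * of_bool (adj e (s - {c}) R V))"
        by (simp add: sum_list_mult_const)
    qed simp
    also have "\<dots> = (\<Sum>u\<leftarrow>act c s w. \<Sum>R\<in>Pow (circ (s - {c})). ev (s - {c}) u R * of_bool (adj e (s - {c}) R V))"
      by (simp add: act_def sum.distrib)
    also have "\<dots> = (\<Sum>u\<leftarrow>act c s w. \<Sum>v\<leftarrow>act e (s - {c}) u. ev (s - {c} - {e}) v V)"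
    proof (intro arg_cong[of _ _ sum_list] map_cong refl)
      fix u assume "u \<in> set (act c s w)"
      then have "set u \<subseteq> Pts" using act_Pts[OF cN(1) w(1)] by blast
      then show "(\<Sum>R\<in>Pow (circ (s - {c})). ev (s - {c}) u R * of_bool (adj e (s - {c}) R V)) =
          (\<Sum>v\<leftarrow>act e (s - {c}) u. ev (s - {c} - {e}) v V)"
        using c cN V by (intro adj_word_sum) auto
    qed
    finally show ?thesis .
  qed
  have "s - {e} - {c} = s - {c} - {e}" by blast
  then show ?thesis
    using *[OF c V] *[of e c] c V act_commute[OF s c w(1), of V] by simp
qed

lemma sgn_at_anticommute:
  assumes "s \<subseteq> N" "c \<in> s" "e \<in> s" "c \<noteq> e"
  shows "sgn_at c s * sgn_at e (s - {c}) = - (sgn_at e s * sgn_at c (s - {e}))"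
proof -
  have *: "sgn_at c s * sgn_at e (s - {c}) = - (sgn_at e s * sgn_at c (s - {e}))"
    if ce: "c < e" "c \<in> s" "e \<in> s" for c e
  proof -
    have "{x \<in> N - (s - {c}). e < x} = {x \<in> N - s. e < x}"
      using ce by auto
    moreover have "{x \<in> N - (s - {e}). c < x} = insert e {x \<in> N - s. c < x}"
      using ce assms(1) by auto
    moreover have "card (insert e {x \<in> N - s. c < x}) = Suc (card {x \<in> N - s. c < x})"
      using finite_N ce by (intro card_insert_disjoint) auto
    ultimately show ?thesis
      by (simp only: sgn_at_def power_Suc) simp
  qed
  show ?thesis
    using *[of c e] *[of e c] assms by (cases "c < e") auto
qed

lemma diff_diff:
  assumes S: "S \<in> gens" and S'': "S'' \<in> gens"
  shows "(\<Sum>S'\<in>gens. diff S S' * diff S' S'') = 0"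
proof -
  obtain s T u V where eq: "S = (s, T)" "S'' = (u, V)" by fastforce
  have s: "s \<subseteq> N" and T: "T \<subseteq> circ s" and V: "V \<subseteq> circ u"
    using assms by (auto simp: eq gens_def)
  have fs: "finite s" using s finite_N finite_subset by blast
  define P where "P c e = (\<Sum>R\<in>Pow (circ (s - {c})). of_bool (adj c s T R) * (of_bool (adj e (s - {c}) R V) :: int))" for c e
  define F where "F c e = (if c \<in> s \<and> e \<in> s \<and> c \<noteq> e \<and> u = s - {c} - {e}
     then sgn_at c s * sgn_at e (s - {c}) * P c e else 0)" for c e
  have "F c e = - F e c" for c e
    using sgn_at_anticommute[OF s, of c e] adj_commute[OF s _ _ _ T, of c e V] V
    by (auto simp: F_def P_def Diff_insert2 [symmetric] insert_commute)
  then have F0: "(\<Sum>c\<in>s. \<Sum>e\<in>s. F c e) = 0"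
    by (rule sum_antisymmetric)
  have "(\<Sum>S'\<in>gens. diff S S' * diff S' S'') =
      (\<Sum>r\<in>Pow N. \<Sum>R\<in>Pow (circ r). diff (s, T) (r, R) * diff (r, R) (u, V))"
    unfolding gens_def eq using finite_N by (simp add: sum.Sigma)
  also have "\<dots> = (\<Sum>r\<in>(\<lambda>c. s - {c}) ` s. \<Sum>R\<in>Pow (circ r). diff (s, T) (r, R) * diff (r, R) (u, V))"
  proof (rule sum.mono_neutral_right)
    show "\<forall>r\<in>Pow N - (\<lambda>c. s - {c}) ` s. (\<Sum>R\<in>Pow (circ r). diff (s, T) (r, R) * diff (r, R) (u, V)) = 0"
    proof
      fix r assume "r \<in> Pow N - (\<lambda>c. s - {c}) ` s"
      then have "diff (s, T) (r, R) = 0" for R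
        using diff_nonzero[of s T r R] by blast
      then show "(\<Sum>R\<in>Pow (circ r). diff (s, T) (r, R) * diff (r, R) (u, V)) = 0"
        by simp
    qed
  qed (use s finite_N in auto)
  also have "\<dots> = (\<Sum>c\<in>s. \<Sum>R\<in>Pow (circ (s - {c})). diff (s, T) (s - {c}, R) * diff (s - {c}, R) (u, V))"
    by (rule sum.reindex_cong[of "\<lambda>c. s - {c}"]) (auto simp: inj_on_def)
  also have "\<dots> = (\<Sum>c\<in>s. \<Sum>e\<in>s. F c e)"
  proof (rule sum.cong)
    fix c assume c: "c \<in> s"
    have "(\<Sum>R\<in>Pow (circ (s - {c})). diff (s, T) (s - {c}, R) * diff (s - {c}, R) (u, V)) =
      (\<Sum>R\<in>Pow (circ (s - {c})). \<Sum>e\<in>s - {c}. if u = s - {c} - {e}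
        then sgn_at c s * sgn_at e (s - {c}) * (of_bool (adj c s T R) * of_bool (adj e (s - {c}) R V)) else 0)"
      unfolding diff_remove[OF c s] unfolding diff_def fst_conv snd_conv sum_distrib_left
      by (intro sum.cong refl) (simp split: if_split)
    also have "\<dots> = (\<Sum>e\<in>s - {c}. F c e)"
    proof (subst sum.swap, rule sum.cong[OF refl])
      fix e assume "e \<in> s - {c}"
      then have e: "e \<in> s" "e \<noteq> c" by auto
      show "(\<Sum>R\<in>Pow (circ (s - {c})). if u = s - {c} - {e} then sgn_at c s * sgn_at e (s - {c}) *
          (of_bool (adj c s T R) * of_bool (adj e (s - {c}) R V)) else 0) = F c e"
        unfolding F_def P_def sum_distrib_left using c e by (cases "u = s - {c} - {e}") simp_all
    qed
    also have "\<dots> = (\<Sum>e\<in>s. F c e)"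
      by (rule sum.mono_neutral_left) (auto simp: F_def fs)
    finally show "(\<Sum>R\<in>Pow (circ (s - {c})). diff (s, T) (s - {c}, R) * diff (s - {c}, R) (u, V)) =
      (\<Sum>e\<in>s. F c e)" .
  qed simp
  finally show ?thesis using F0 by simp
qed

sublocale based_complex gens diff delta
  by unfold_locales (auto simp: diff_diff intro: delta_diff)

end

section \<open>Components and bridges\<close>

context state_cube
begin

text \<open>
  Connectedness in the graph whose vertices are the circles of \<open>s\<close> and whose edges are the crossings
  in \<open>R\<close>, as a relation on points.
\<close>

definition link :: "nat set \<Rightarrow> nat set \<Rightarrow> ('p \<times> 'p) set" where
  "link s R = ({(x, y). x \<in> Pts \<and> y \<in> Pts \<and> cl s x = cl s y} \<union>
     {(a c, b c) | c. c \<in> R} \<union> {(b c, a c) | c. c \<in> R})\<^sup>*"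

definition ncomp :: "nat set \<Rightarrow> nat set \<Rightarrow> nat" where
  "ncomp s R = card (Pts // link s R)"

lemma link_refl [simp]: "(x, x) \<in> link s R"
  by (simp add: link_def)

lemma link_trans: "\<lbrakk>(x, y) \<in> link s R; (y, z) \<in> link s R\<rbrakk> \<Longrightarrow> (x, z) \<in> link s R"
  unfolding link_def by (rule rtrancl_trans)

lemma link_sym: "(x, y) \<in> link s R \<Longrightarrow> (y, x) \<in> link s R"
  unfolding link_def by (rule symD[OF sym_rtrancl]) (auto simp: sym_def)

lemma equiv_link: "equiv UNIV (link s R)"
  by (auto intro!: equivI refl_onI symI transI intro: link_sym link_trans)

lemma link_cl: "\<lbrakk>x \<in> Pts; y \<in> Pts; cl s x = cl s y\<rbrakk> \<Longrightarrow> (x, y) \<in> link s R"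
  unfolding link_def by (rule r_into_rtrancl) auto

lemma link_edge: "c \<in> R \<Longrightarrow> (a c, b c) \<in> link s R"
  unfolding link_def by (rule r_into_rtrancl) auto

lemma link_induct [consumes 1, case_names refl circle edge edge']:
  assumes "(x, y) \<in> link s R"
    and "P x"
    and "\<And>y z. \<lbrakk>(x, y) \<in> link s R; P y; y \<in> Pts; z \<in> Pts; cl s y = cl s z\<rbrakk> \<Longrightarrow> P z"
    and "\<And>c. \<lbrakk>(x, a c) \<in> link s R; P (a c); c \<in> R\<rbrakk> \<Longrightarrow> P (b c)"
    and "\<And>c. \<lbrakk>(x, b c) \<in> link s R; P (b c); c \<in> R\<rbrakk> \<Longrightarrow> P (a c)"
  shows "P y"
  using assms(1) unfolding link_def
proof (induction rule: rtrancl_induct)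
  case base
  then show ?case using assms(2) .
next
  case (step y z)
  then show ?case using assms(3-5) unfolding link_def by blast
qed

lemma link_least:
  assumes "\<And>x y. \<lbrakk>x \<in> Pts; y \<in> Pts; cl s x = cl s y\<rbrakk> \<Longrightarrow> (x, y) \<in> link s' R'"
    and "\<And>c. c \<in> R \<Longrightarrow> (a c, b c) \<in> link s' R'"
  shows "link s R \<subseteq> link s' R'"
proof
  fix p assume "p \<in> link s R"
  then obtain x y where p: "p = (x, y)" and "(x, y) \<in> link s R" by (cases p) auto
  from this(2) have "(x, y) \<in> link s' R'"
    by (induction rule: link_induct) (auto intro: link_trans link_sym assms)
  then show "p \<in> link s' R'" by (simp add: p)
qed

lemma link_mono: "R \<subseteq> R' \<Longrightarrow> link s R \<subseteq> link s R'"
  by (rule link_least) (auto intro: link_cl link_edge)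

text \<open>
  A change of marker at \<open>c\<close> joins or separates only circles at the ends of \<open>c\<close>, and these ends
  are connected by the edge \<open>c\<close> before and after. So the graph of a subcube has the same components for
  all of its states.
\<close>

lemma link_flip:
  assumes "s \<subseteq> N" "R \<subseteq> N" "c \<in> R"
  shows "link (flip c s) R = link s R"
proof -
  have "link (flip c s) R \<subseteq> link s R" if s: "s \<subseteq> N" for s
  proof (rule link_least)
    fix x y assume Pts: "x \<in> Pts" "y \<in> Pts" and eq: "cl (flip c s) x = cl (flip c s) y"
    have cN: "c \<in> N" using assms by blast
    show "(x, y) \<in> link s R"
    proof (cases "merges s c")
      case True
      then consider "cl s x = cl s y" | "cl s x = cl s (a c)" "cl s y = cl s (b c)"
        | "cl s x = cl s (b c)" "cl s y = cl s (a c)"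
        using merge[OF s cN _ Pts] eq by (auto simp: merges_def doubleton_eq_iff)
      then show ?thesis
      proof cases
        case 2
        then show ?thesis
          using link_cl[of x "a c"] link_edge[OF assms(3)] link_cl[of "b c" y] a_Pts b_Pts cN Pts
          by (metis link_trans)
      next
        case 3
        then show ?thesis
          using link_cl[of x "b c"] link_sym[OF link_edge[OF assms(3)]] link_cl[of "a c" y]
            a_Pts b_Pts cN Pts
          by (metis link_trans)
      qed (rule link_cl[OF Pts])
    next
      case False
      then show ?thesis
        using split_iff[OF s cN False Pts] eq by (auto intro: link_cl Pts)
    qed
  qed (rule link_edge)
  from this[OF assms(1)] this[OF flip_subset[OF assms(1)], of c] show ?thesis
    using assms by auto
qed

lemma link_Un:
  assumes "finite F" "F \<subseteq> R" "s \<subseteq> N" "R \<subseteq> N"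
  shows "link (s \<union> F) R = link s R"
  using assms
proof (induction F)
  case (insert c F)
  show ?case
  proof (cases "c \<in> s")
    case True
    then show ?thesis using insert by (simp add: insert_absorb)
  next
    case False
    then have "s \<union> insert c F = flip c (s \<union> F)"
      using insert by (auto simp: flip_def)
    moreover have "s \<union> F \<subseteq> N" using insert by auto
    ultimately show ?thesis
      using link_flip[of "s \<union> F" R c] insert by auto
  qed
qed simp

lemma link_interval:
  assumes "L \<subseteq> s" "s \<subseteq> U" "U \<subseteq> N" "U - L \<subseteq> R" "R \<subseteq> N"
  shows "link s R = link L R"
proof -
  have "finite (s - L)" using assms finite_N by (meson Diff_subset finite_subset order_trans)
  moreover have "s = L \<union> (s - L)" using assms by blast
  moreover have "s - L \<subseteq> R" "L \<subseteq> N" using assms by auto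
  ultimately show ?thesis using link_Un[of "s - L" R L] assms by simp
qed

lemma link_nonbridge:
  assumes "(a c, b c) \<in> link s (R - {c})"
  shows "link s R = link s (R - {c})"
proof
  have "(a e, b e) \<in> link s (R - {c})" if "e \<in> R" for e
    using that assms by (cases "e = c") (auto intro: link_edge)
  then show "link s R \<subseteq> link s (R - {c})"
    by (intro link_least) (auto intro: link_cl)
qed (rule link_mono, blast)

text \<open>
  Putting the edge \<open>c\<close> back identifies only the components of its two ends.
\<close>

lemma link_remove_cases:
  assumes "(x, y) \<in> link s R" and r_def: "r = link s (R - {c})"
  shows "(x, y) \<in> r \<or> ((x, a c) \<in> r \<or> (x, b c) \<in> r) \<and> ((y, a c) \<in> r \<or> (y, b c) \<in> r)"
  using assms(1)
proof -
  let ?P = "\<lambda>y. (x, y) \<in> r \<or> ((x, a c) \<in> r \<or> (x, b c) \<in> r) \<and> ((y, a c) \<in> r \<or> (y, b c) \<in> r)"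
  have transfer: "?P z" if "(y, z) \<in> r" "?P y" for y z
    using that link_trans[of x y s "R - {c}" z] link_trans[OF link_sym[of y z s "R - {c}"]]
    unfolding r_def by blast
  show ?thesis
    using assms(1)
  proof (induction rule: link_induct)
    case (circle y z)
    show ?case using transfer[OF _ circle.IH, of z] circle.hyps by (simp add: r_def link_cl)
  next
    case (edge e)
    show ?case
    proof (cases "e = c")
      case True
      then show ?thesis using edge.IH by (auto simp: r_def)
    next
      case False
      then show ?thesis using transfer[OF _ edge.IH] edge.hyps by (simp add: r_def link_edge)
    qed
  next
    case (edge' e)
    show ?case
    proof (cases "e = c")
      case True
      then show ?thesis using edge'.IH by (auto simp: r_def)
    next
      case False
      then show ?thesis using transfer[OF _ edge'.IH] edge'.hyps by (simp add: r_def link_edge link_sym)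
    qed
  qed (simp add: r_def)
qed

lemma ncomp_remove_le: "ncomp s (R - {c}) \<le> ncomp s R + 1"
proof -
  define r where "r = link s (R - {c})"
  define r' where "r' = link s R"
  have eq: "equiv UNIV r" "equiv UNIV r'" unfolding r_def r'_def by (rule equiv_link)+
  have sub: "r \<subseteq> r'" unfolding r_def r'_def by (rule link_mono) blast
  have img: "r' `` (r `` {x}) = r' `` {x}" for x
  proof
    show "r' `` (r `` {x}) \<subseteq> r' `` {x}"
      using link_trans sub unfolding r_def r'_def by blast
    show "r' `` {x} \<subseteq> r' `` (r `` {x})"
      by (auto simp: r_def intro: link_refl)
  qed
  have fin: "finite (Pts // r')" "finite (Pts // r)"
    using finite_Pts by (auto simp: quotient_def)
  have "card (Pts // r - {r `` {a c}}) \<le> card (Pts // r')"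
  proof (rule card_inj_on_le[OF _ _ fin(1)])
    show "(\<lambda>X. r' `` X) ` (Pts // r - {r `` {a c}}) \<subseteq> Pts // r'"
      by (auto simp: quotient_def img)
    show "inj_on (\<lambda>X. r' `` X) (Pts // r - {r `` {a c}})"
    proof (rule inj_onI)
      fix X Y assume XY: "X \<in> Pts // r - {r `` {a c}}" "Y \<in> Pts // r - {r `` {a c}}"
        and "r' `` X = r' `` Y"
      then obtain x y where xy: "X = r `` {x}" "Y = r `` {y}" by (auto simp: quotient_def)
      then have "(x, y) \<in> r'"
        using \<open>r' `` X = r' `` Y\<close> eq(2) by (simp add: img eq_equiv_class_iff)
      then have "(x, y) \<in> r \<or> ((x, a c) \<in> r \<or> (x, b c) \<in> r) \<and> ((y, a c) \<in> r \<or> (y, b c) \<in> r)"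
        unfolding r'_def by (rule link_remove_cases) (rule r_def)
      moreover have "(x, a c) \<notin> r" "(y, a c) \<notin> r"
        using XY xy eq(1) equiv_class_eq by (metis DiffD2 singletonI)+
      ultimately have "(x, y) \<in> r"
        using eq(1) unfolding r_def by (metis link_sym link_trans)
      then show "X = Y" using xy eq(1) equiv_class_eq by metis
    qed
  qed
  moreover have "card (Pts // r) \<le> card (Pts // r - {r `` {a c}}) + 1"
    by (cases "r `` {a c} \<in> Pts // r") (simp_all add: card_Diff_singleton)
  ultimately show ?thesis unfolding ncomp_def r_def r'_def by linarith
qed

lemma link_empty: "(x, y) \<in> link s {} \<Longrightarrow> cl s x = cl s y"
  by (induction rule: link_induct) auto

lemma card_circ_le_ncomp: "card (circ s) \<le> ncomp s {}"
  unfolding ncomp_def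
proof (rule card_inj_on_le)
  let ?rep = "inv_into Pts (cl s)"
  have rep: "?rep C \<in> Pts" "cl s (?rep C) = C" if "C \<in> circ s" for C
    using that unfolding circ_def by (rule inv_into_into, rule f_inv_into_f)
  show "(\<lambda>C. link s {} `` {?rep C}) ` circ s \<subseteq> Pts // link s {}"
    using rep by (auto simp: quotient_def)
  show "inj_on (\<lambda>C. link s {} `` {?rep C}) (circ s)"
  proof (rule inj_onI)
    fix C C' assume C: "C \<in> circ s" "C' \<in> circ s"
      and "link s {} `` {?rep C} = link s {} `` {?rep C'}"
    then have "(?rep C, ?rep C') \<in> link s {}"
      by (simp add: eq_equiv_class_iff[OF equiv_link])
    then show "C = C'" using link_empty rep C by metis
  qed
qed (simp add: quotient_def finite_Pts)

lemma link_avoid: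
  assumes "(x, y) \<in> link s R" "(x, a c) \<notin> link s R"
  shows "(x, y) \<in> link s (R - {c})"
  using assms(1)
proof (induction rule: link_induct)
  case (circle y z)
  then show ?case by (metis link_cl link_trans)
next
  case (edge e)
  then have "e \<noteq> c" using assms(2) by blast
  then show ?case using edge by (metis DiffI link_edge link_trans singletonD)
next
  case (edge' e)
  then have "e \<noteq> c" using assms(2) by (metis link_edge link_sym link_trans)
  then show ?case using edge' by (metis DiffI link_edge link_sym link_trans singletonD)
qed simp

text \<open>
  If every edge is a bridge, some edge ends in a circle that no other edge touches: take an end of an
  edge beyond which there are as few edges as possible. Any edge beyond it would have an end with
  strictly fewer edges beyond.
\<close>

lemma forest_leaf:
  assumes R: "finite R" "R \<noteq> {}" "R \<subseteq> N"
    and bridge: "\<And>c. c \<in> R \<Longrightarrow> (a c, b c) \<notin> link s (R - {c})"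
  obtains c x where "c \<in> R" "x = a c \<or> x = b c"
    "\<And>c'. c' \<in> R - {c} \<Longrightarrow> cl s (a c') \<noteq> cl s x \<and> cl s (b c') \<noteq> cl s x"
proof -
  define beyond where "beyond = (\<lambda>(c, x). {c' \<in> R - {c}. (x, a c') \<in> link s (R - {c})})"
  define ends where "ends = {(c, x). c \<in> R \<and> (x = a c \<or> x = b c)}"
  obtain c0 where "c0 \<in> R" using R(2) by blast
  then have "(c0, a c0) \<in> ends" by (simp add: ends_def)
  then have "\<exists>p. p \<in> ends \<and> (\<forall>q. q \<in> ends \<longrightarrow> card (beyond p) \<le> card (beyond q))"
    by (rule ex_has_least_nat)
  then obtain c x where p: "(c, x) \<in> ends"
    and min: "\<And>q. q \<in> ends \<Longrightarrow> card (beyond (c, x)) \<le> card (beyond q)"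
    by (metis surj_pair)
  have c: "c \<in> R" and x: "x = a c \<or> x = b c" using p by (auto simp: ends_def)
  have empty: "beyond (c, x) = {}"
  proof (rule ccontr)
    assume "beyond (c, x) \<noteq> {}"
    then obtain e where e: "e \<in> R" "e \<noteq> c" "(x, a e) \<in> link s (R - {c})"
      by (auto simp: beyond_def)
    then have xe: "(x, y) \<in> link s (R - {c})" if "y = a e \<or> y = b e" for y
      using that link_edge[of e "R - {c}"] by (metis DiffI link_trans singletonD)
    \<comment> \<open>removing \<open>e\<close> separates its ends, so one of them is cut off from \<open>c\<close>\<close>
    obtain y where y: "y = a e \<or> y = b e" "(y, a c) \<notin> link s (R - {e})"
      using bridge[OF e(1)] link_sym link_trans by metis
    have "beyond (e, y) \<subset> beyond (c, x)"
    proof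
      show "beyond (e, y) \<subseteq> beyond (c, x)"
      proof
        fix d assume "d \<in> beyond (e, y)"
        then have d: "d \<in> R" "d \<noteq> e" "(y, a d) \<in> link s (R - {e})"
          by (auto simp: beyond_def)
        then have "d \<noteq> c" using y(2) by blast
        have "(y, a d) \<in> link s (R - {e} - {c})"
          using link_avoid[OF d(3) y(2)] .
        then have "(y, a d) \<in> link s (R - {c})"
          using link_mono[of "R - {e} - {c}" "R - {c}" s] by blast
        then have "(x, a d) \<in> link s (R - {c})"
          using xe[OF y(1)] link_trans by blast
        then show "d \<in> beyond (c, x)" using d \<open>d \<noteq> c\<close> by (simp add: beyond_def)
      qed
      show "beyond (e, y) \<noteq> beyond (c, x)"
        using e by (auto simp: beyond_def)
    qed
    then have "card (beyond (e, y)) < card (beyond (c, x))"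
      using R(1) by (intro psubset_card_mono) (simp add: beyond_def)
    moreover have "(e, y) \<in> ends" using e y by (simp add: ends_def)
    ultimately show False using min by (meson not_le)
  qed
  have "cl s (a d) \<noteq> cl s x \<and> cl s (b d) \<noteq> cl s x" if d: "d \<in> R - {c}" for d
  proof -
    have Pts: "x \<in> Pts" "a d \<in> Pts" "b d \<in> Pts"
      using x c d R(3) a_Pts b_Pts by auto
    have "(x, a d) \<notin> link s (R - {c})"
      using empty d by (auto simp: beyond_def)
    moreover have "(b d, a d) \<in> link s (R - {c})"
      using link_edge[OF d] by (rule link_sym)
    ultimately show ?thesis
      using link_cl[OF Pts(1,2)] link_cl[OF Pts(1,3)] link_trans by metis
  qed
  with that c x show thesis by blast
qed

end

section \<open>Isolated circles and the removal of a kink\<close>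

context state_cube
begin

definition subcube :: "nat set \<Rightarrow> nat set \<Rightarrow> (nat set \<times> 'c set) set" where
  "subcube L U = {S \<in> gens. L \<subseteq> fst S \<and> fst S \<subseteq> U}"

lemma subcube_gens: "subcube L U \<subseteq> gens"
  by (auto simp: subcube_def)

lemma diff_subset: "diff S S' \<noteq> 0 \<Longrightarrow> fst S' \<subseteq> fst S"
  by (metis diff_nonzero Diff_subset prod.collapse)

lemma supported_inter:
  "\<lbrakk>supported X m M; supported X m' M'\<rbrakk> \<Longrightarrow> supported X (max m m') (min M M')"
  unfolding supported_def by (simp add: max_def min_def)

definition isolated :: "'c \<Rightarrow> nat set \<Rightarrow> nat set \<Rightarrow> bool" where
  "isolated K L U \<longleftrightarrow> (\<forall>s. L \<subseteq> s \<longrightarrow> s \<subseteq> U \<longrightarrow> K \<in> circ s \<and> (\<forall>c\<in>U - L. K \<notin> near s c))"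

lemma isolated_diff:
  assumes "isolated K L U" "S \<in> subcube L U" "S' \<in> subcube L U" "diff S S' \<noteq> 0"
  shows "K \<in> snd S \<longleftrightarrow> K \<in> snd S'"
proof -
  obtain s T s' T' where eq: "S = (s, T)" "S' = (s', T')" by fastforce
  obtain c where c: "c \<in> s" "s' = s - {c}" "adj c s T T'"
    using assms(4) unfolding eq by (rule diff_nonzero)
  have "L \<subseteq> s" "s \<subseteq> U" "L \<subseteq> s'" "s' \<subseteq> U"
    using assms(2,3) by (auto simp: eq subcube_def)
  moreover from this have "c \<in> U - L" using c by auto
  ultimately have "K \<notin> near s c" "K \<notin> near s' c"
    using assms(1) unfolding isolated_def by blast+
  moreover have "T - near s c = T' - near s' c"
    using c by (simp add: adj_def)
  ultimately show ?thesis by (auto simp: eq)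
qed

lemma convex_subcube: "convex (subcube L U)"
  unfolding convex_def
proof (intro conjI ballI impI)
  fix S R T assume "S \<in> subcube L U" "T \<in> subcube L U" "R \<in> gens" "diff S R \<noteq> 0" "diff R T \<noteq> 0"
  then show "R \<in> subcube L U"
    using diff_subset[of S R] diff_subset[of R T] by (auto simp: subcube_def)
qed (rule subcube_gens)

lemma convexI_subcube:
  assumes "X \<subseteq> subcube L U"
    and "\<And>S R T. \<lbrakk>S \<in> X; T \<in> X; R \<in> subcube L U; diff S R \<noteq> 0; diff R T \<noteq> 0\<rbrakk> \<Longrightarrow> R \<in> X"
  shows "convex X"
  unfolding convex_def
proof (intro conjI ballI impI)
  fix S R T assume *: "S \<in> X" "T \<in> X" "R \<in> gens" "diff S R \<noteq> 0" "diff R T \<noteq> 0"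
  then have "S \<in> subcube L U" "T \<in> subcube L U" using assms(1) by auto
  then have "R \<in> subcube L U"
    using * convex_subcube[of L U] unfolding convex_def by blast
  then show "R \<in> X" using assms(2) * by blast
qed (use assms(1) subcube_gens in blast)

lemma adj_insert:
  assumes "c \<in> s" "s \<subseteq> N" "T \<subseteq> circ s" "T' \<subseteq> circ (s - {c})"
    and K: "K \<in> circ s - T" "K \<in> circ (s - {c}) - T'" "K \<notin> near s c" "K \<notin> near (s - {c}) c"
  shows "adj c s (insert K T) (insert K T') \<longleftrightarrow> adj c s T T'"
proof -
  have "finite T" "finite T'"
    using assms finite_subset[OF _ finite_circ] by blast+
  then have card: "card (insert K T) = card T + 1" "card (insert K T') = card T' + 1"
    using K by auto
  have "insert K T - near s c = insert K T' - near (s - {c}) c \<longleftrightarrow>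
      T - near s c = T' - near (s - {c}) c"
    using K by (simp add: insert_Diff_if insert_ident)
  then show ?thesis
    using assms adj_card[of c s T T'] adj_card[of c s "insert K T" "insert K T'"] card
    by simp
qed

text \<open>
  The signs \<open>+\<close> and \<open>-\<close> of an isolated circle give two summands of the complex that differ by a shift of 4
  in degree. Each of them therefore satisfies the bounds of the whole complex and the shifted bounds of
  the other one.
\<close>

lemma supported_isolated:
  assumes LU: "L \<subseteq> U" "U \<subseteq> N" and iso: "isolated K L U" and sup: "supported (subcube L U) m M"
  shows "supported {S \<in> subcube L U. K \<in> snd S} (m + 4) M"
    and "supported {S \<in> subcube L U. K \<notin> snd S} m (M - 4)"
proof -
  let ?P = "{S \<in> subcube L U. K \<in> snd S}" and ?M = "{S \<in> subcube L U. K \<notin> snd S}"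
  have P: "supported ?P m M"
    by (rule supported_summands[OF convex_subcube _ _ _ _ sup, where S = ?M])
      (use isolated_diff[OF iso] in blast)+
  have M: "supported ?M m M"
    by (rule supported_summands[OF convex_subcube _ _ _ _ sup, where S = ?P])
      (use isolated_diff[OF iso] in blast)+
  let ?h = "\<lambda>(s, T). (s, insert K T)"
  let ?g = "\<lambda>(s, T). (s, T - {K})"
  have K: "K \<in> circ s" if "L \<subseteq> s" "s \<subseteq> U" for s
    using iso that by (auto simp: isolated_def)
  have h: "bij_betw ?h ?M ?P"
    by (rule bij_betw_byWitness[where f' = ?g]) (use K in \<open>auto simp: subcube_def gens_def\<close>)
  have g: "bij_betw ?g ?P ?M"
    by (rule bij_betw_byWitness[where f' = ?h]) (use K in \<open>auto simp: subcube_def gens_def\<close>)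
  have diff_h: "diff (?h S) (?h S') = diff S S'" if "S \<in> ?M" "S' \<in> ?M" for S S'
  proof -
    obtain s T s' T' where eq: "S = (s, T)" "S' = (s', T')" by fastforce
    show ?thesis
    proof (cases "\<exists>c\<in>s. s' = s - {c}")
      case True
      then obtain c where c: "c \<in> s" "s' = s - {c}" by blast
      have s: "s \<subseteq> N" "L \<subseteq> s" "s \<subseteq> U" "L \<subseteq> s'" "s' \<subseteq> U" "c \<in> U - L"
        using that c LU by (auto simp: eq subcube_def gens_def)
      have "adj c s (insert K T) (insert K T') \<longleftrightarrow> adj c s T T'"
        using that c s iso K by (intro adj_insert) (auto simp: eq subcube_def gens_def isolated_def)
      then show ?thesis using c s by (simp add: eq diff_remove)
    next
      case False
      then have "diff (s, T) (s', T') = 0" for T T'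
        using diff_nonzero[of s T s' T'] by blast
      then show ?thesis by (simp add: eq)
    qed
  qed
  have delta_h: "delta (?h S) = delta S + 4" if "S \<in> ?M" for S
  proof -
    obtain s T where eq: "S = (s, T)" by fastforce
    have T: "T \<subseteq> circ s" "K \<in> circ s" "K \<notin> T"
      using that K by (auto simp: eq subcube_def gens_def)
    have "finite T" using T finite_subset[OF _ finite_circ] by blast
    then have "\<tau>\<^sub>s (s, insert K T) = \<tau>\<^sub>s (s, T) + 2"
      using T by (simp add: \<tau>_eq)
    then show ?thesis by (simp add: eq delta_def)
  qed
  have gP: "?g S \<in> ?M" "?h (?g S) = S" if "S \<in> ?P" for S
    using that by (auto simp: subcube_def gens_def)
  have "supported ?P (m + 4) (M + 4)"
    by (rule supported_shift[OF h _ diff_h delta_h M]) (use subcube_gens in auto)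
  from supported_inter[OF P this] show "supported ?P (m + 4) M"
    by (simp add: max_def min_def)
  have "supported ?M (m + (-4)) (M + (-4))"
  proof (rule supported_shift[OF g _ _ _ P])
    show "diff (?g S) (?g S') = diff S S'" if "S \<in> ?P" "S' \<in> ?P" for S S'
      using diff_h[OF gP(1)[OF that(1)] gP(1)[OF that(2)]] gP(2) that by simp
    show "delta (?g S) = delta S + (-4)" if "S \<in> ?P" for S
      using delta_h[OF gP(1)[OF that]] gP(2)[OF that] by simp
  qed (use subcube_gens in auto)
  from supported_inter[OF M this] show "supported ?M m (M - 4)"
    by (simp add: max_def min_def)
qed

lemma subcube_split:
  assumes "c \<in> U - L"
  shows "subcube L U = subcube (insert c L) U \<union> subcube L (U - {c})"
    "subcube (insert c L) U \<inter> subcube L (U - {c}) = {}"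
    "\<lbrakk>S \<in> subcube L (U - {c}); S' \<in> subcube (insert c L) U\<rbrakk> \<Longrightarrow> diff S S' = 0"
  using assms diff_subset[of S S'] by (auto simp: subcube_def)

lemma near_single:
  assumes "s \<subseteq> N" "c \<in> N" "\<not> merges s c"
  obtains C where "near s c = {C}" "C \<in> circ s"
  using assms near_circ[OF assms(2), of s] by (auto simp: near_def merges_def)

lemma near_pair:
  assumes "s \<subseteq> N" "c \<in> N" "merges s c" "K \<in> near s c"
  obtains A where "near s c = {K, A}" "A \<noteq> K" "A \<in> circ s" "K \<in> circ s"
  using assms near_circ[OF assms(2), of s] by (auto simp: near_def merges_def)

lemma near_flip:
  assumes "s \<subseteq> N" "c \<in> N" "x \<in> Pts"
  shows "cl (flip c s) x \<in> near (flip c s) c \<longleftrightarrow> cl s x \<in> near s c"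
  using away_near[of s c x] away_near[of "flip c s" c x] flip_subset[OF assms(1,2)] assms
  by (metis flip_flip)

lemma circ_far_remove:
  assumes "s \<subseteq> N" "c \<in> s"
  shows "circ (s - {c}) - near (s - {c}) c = circ s - near s c"
  using circ_far[of s c] assms by (auto simp: flip_remove)

lemma merges_remove: "\<lbrakk>s \<subseteq> N; c \<in> s\<rbrakk> \<Longrightarrow> merges (s - {c}) c \<longleftrightarrow> \<not> merges s c"
  using merges_flip[of s c] by (auto simp: flip_remove)

lemma diff_abs:
  assumes "c \<in> s" "s \<subseteq> N"
  shows "\<bar>diff (s, T) (s - {c}, T')\<bar> = of_bool (adj c s T T')"
  using assms by (simp add: diff_remove sgn_at_def)

lemma card_singleton_split: "finite T \<Longrightarrow> card T = card (T - {x}) + (if x \<in> T then 1 else 0)"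
  using card_Suc_Diff1[of T x] by auto

text \<open>
  The first Reidemeister move, when the kink circle \<open>K\<close> splits off in the states with marker + at \<open>c\<close>.
  If \<open>K\<close> has the sign \<open>-\<close>, merging it at \<open>c\<close> is multiplication by \<open>1\<close>: such states cancel against those with
  the other marker, and the states with positive \<open>K\<close> remain.
\<close>

lemma supported_leaf_above:
  assumes LU: "c \<in> U - L" "L \<subseteq> U" "U \<subseteq> N" and iso: "isolated K (insert c L) U"
    and K: "\<And>s. \<lbrakk>insert c L \<subseteq> s; s \<subseteq> U\<rbrakk> \<Longrightarrow> merges s c \<and> K \<in> near s c"
    and sup: "supported (subcube (insert c L) U) m M"
  shows "supported (subcube L U) (m + 4) M"
proof -
  have cN: "c \<in> N" using LU by blast
  let ?X3 = "{S \<in> subcube (insert c L) U. K \<in> snd S}"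
  let ?X1 = "{S \<in> subcube (insert c L) U. K \<notin> snd S}"
  let ?X2 = "subcube L (U - {c})"
  let ?Y = "?X1 \<union> ?X2"
  have insU: "insert c L \<subseteq> U" using LU by blast
  have X3: "supported ?X3 (m + 4) M"
    using supported_isolated(1)[OF insU LU(3) iso sup] .
  have Ysub: "?Y \<subseteq> subcube L U" using LU by (auto simp: subcube_def)
  have convY: "convex ?Y"
  proof (rule convexI_subcube[OF Ysub])
    fix S R T assume *: "S \<in> ?Y" "R \<in> subcube L U" "diff S R \<noteq> 0"
    show "R \<in> ?Y"
    proof (cases "R \<in> ?X2")
      case False
      then have R: "R \<in> subcube (insert c L) U" using *(2) subcube_split(1)[OF LU(1)] by blast
      then have "S \<in> ?X1" using * subcube_split(3)[OF LU(1)] by blast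
      then have "K \<notin> snd R"
        using isolated_diff[OF iso _ R *(3)] by blast
      with R show ?thesis by blast
    qed blast
  qed
  \<comment> \<open>\<open>K\<close> is merged with the other circle at \<open>c\<close>, which passes its sign on\<close>
  define h where "h = (\<lambda>(s, T). (s - {c},
    (T - near s c) \<union> (if T \<inter> near s c = {} then {} else near (s - {c}) c)))"
  define g where "g = (\<lambda>(s, T). (insert c s,
    (T - near s c) \<union> (if T \<inter> near s c = {} then {} else near (insert c s) c - {K})))"
  have local: thesis
    if s: "insert c L \<subseteq> s" "s \<subseteq> U"
      and *: "\<And>A C. \<lbrakk>near s c = {K, A}; A \<noteq> K; near (s - {c}) c = {C}; A \<in> circ s;
        C \<in> circ (s - {c}); circ (s - {c}) - {C} = circ s - {K, A}\<rbrakk> \<Longrightarrow> thesis" for s thesis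
  proof -
    have sN: "s \<subseteq> N" "c \<in> s" using s LU by auto
    obtain A where A: "near s c = {K, A}" "A \<noteq> K" "A \<in> circ s"
      using near_pair[OF sN(1) cN, of K] K[OF s] by blast
    obtain C where C: "near (s - {c}) c = {C}" "C \<in> circ (s - {c})"
      using near_single[of "s - {c}" c] merges_remove[OF sN] K[OF s] sN cN by blast
    show ?thesis
      using circ_far_remove[OF sN] by (intro *[OF A(1,2) C(1) A(3) C(2)]) (simp add: A C)
  qed
  have hX1: "h S \<in> ?X2 \<and> g (h S) = S \<and> (\<forall>T'. (fst S - {c}, T') \<in> ?X2 \<longrightarrow>
      (adj c (fst S) (snd S) T' \<longleftrightarrow> (fst S - {c}, T') = h S))" if S: "S \<in> ?X1" for S
  proof -
    obtain s T where eq: "S = (s, T)" by fastforce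
    have s: "insert c L \<subseteq> s" "s \<subseteq> U" "s \<subseteq> N" "c \<in> s" and T: "T \<subseteq> circ s" "K \<notin> T"
      using S by (auto simp: eq subcube_def gens_def)
    obtain A C where AC: "near s c = {K, A}" "A \<noteq> K" "near (s - {c}) c = {C}" "A \<in> circ s"
      "C \<in> circ (s - {c})" "circ (s - {c}) - {C} = circ s - {K, A}"
      by (rule local[OF s(1,2)])
    have finT: "finite T" using T(1) finite_subset[OF _ finite_circ] by blast
    have hS: "h S = (s - {c}, (T - {A}) \<union> (if A \<in> T then {C} else {}))"
      using T by (auto simp: h_def eq AC)
    have C: "C \<notin> T - {A}" using AC T by auto
    have "h S \<in> ?X2"
      unfolding hS using s T LU AC by (auto simp: subcube_def gens_def)
    moreover have "g (h S) = S"
      unfolding hS using s T AC C by (auto simp: g_def eq insert_absorb)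
    moreover have "adj c s T T' \<longleftrightarrow> T' = (T - {A}) \<union> (if A \<in> T then {C} else {})"
      if T': "T' \<subseteq> circ (s - {c})" for T'
    proof -
      have finT': "finite T'" using T' finite_subset[OF _ finite_circ] by blast
      have card_iff: "card T' = card T \<longleftrightarrow> (C \<in> T' \<longleftrightarrow> A \<in> T)" if "T - {A} = T' - {C}"
        unfolding card_singleton_split[OF finT, of A] card_singleton_split[OF finT', of C] that
        by simp
      have "adj c s T T' \<longleftrightarrow> T - {K, A} = T' - {C} \<and> card T' = card T"
        using adj_card[OF s(4,3) T(1) T'] K[OF s(1,2)] by (simp add: AC)
      also have "T - {K, A} = T - {A}" using T by auto
      also have "T - {A} = T' - {C} \<and> card T' = card T \<longleftrightarrow>
        T - {A} = T' - {C} \<and> (C \<in> T' \<longleftrightarrow> A \<in> T)"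
        using card_iff by blast
      also have "\<dots> \<longleftrightarrow> T' = (T - {A}) \<union> (if A \<in> T then {C} else {})"
        using C by auto
      finally show ?thesis .
    qed
    ultimately show ?thesis
      unfolding hS by (auto simp: eq subcube_def gens_def)
  qed
  have gX2: "g S \<in> ?X1 \<and> h (g S) = S" if S: "S \<in> ?X2" for S
  proof -
    obtain s' T' where eq: "S = (s', T')" by fastforce
    define s where "s = insert c s'"
    have s': "L \<subseteq> s'" "s' \<subseteq> U" "c \<notin> s'" "s' = s - {c}" and T': "T' \<subseteq> circ s'"
      using S by (auto simp: eq subcube_def gens_def s_def)
    have s: "insert c L \<subseteq> s" "s \<subseteq> U" "s \<subseteq> N" "c \<in> s"
      using s'(1-3) LU by (auto simp: s_def)
    obtain A C where AC: "near s c = {K, A}" "A \<noteq> K" "near (s - {c}) c = {C}" "A \<in> circ s"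
      "C \<in> circ (s - {c})" "circ (s - {c}) - {C} = circ s - {K, A}"
      by (rule local[OF s(1,2)])
    have gS: "g S = (s, (T' - {C}) \<union> (if C \<in> T' then {A} else {}))"
    proof -
      have "near s' c = {C}" "insert c s' = s"
        using AC(3) s'(3) by (simp_all add: s_def)
      then show ?thesis
        using AC(1,2) by (simp add: g_def eq)
    qed
    have T'': "T' - {C} \<subseteq> circ s - {K, A}"
      using AC(6) T' s'(4) by blast
    then have A: "A \<notin> T' - {C}" "K \<notin> T' - {C}" by auto
    have "g S \<in> ?X1"
      unfolding gS using s T'' AC(2,4) A by (auto simp: subcube_def gens_def)
    moreover have "(if C \<in> T' then {A} else {}) \<inter> {K, A} = (if C \<in> T' then {A} else {})"
      by auto
    then have "h (g S) = S"
      unfolding gS using A AC(1-3) s'(4) [symmetric] by (auto simp: h_def eq)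
    ultimately show ?thesis by blast
  qed
  have Y: "supported ?Y (m + 4) M"
  proof (rule supported_cone[OF convY, where h = h])
    show "bij_betw h ?X1 ?X2"
      by (rule bij_betw_byWitness[where f' = g]) (use hX1 gX2 in blast)+
    show "\<bar>diff S (h S)\<bar> = 1" if S: "S \<in> ?X1" for S
    proof -
      have "c \<in> fst S" "fst S \<subseteq> N" using S by (auto simp: subcube_def gens_def)
      moreover have "h S = (fst S - {c}, snd (h S))" by (simp add: h_def split: prod.split)
      moreover from this have "adj c (fst S) (snd S) (snd (h S))" using hX1[OF S] by metis
      ultimately show ?thesis using diff_abs[of c "fst S" "snd S" "snd (h S)"] by simp
    qed
    show "diff S S' = 0" if S: "S \<in> ?X1" "S' \<in> ?X2" "S' \<noteq> h S" for S S'
    proof (rule ccontr)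
      assume "diff S S' \<noteq> 0"
      then obtain e where e: "e \<in> fst S" "fst S' = fst S - {e}" "adj e (fst S) (snd S) (snd S')"
        using diff_nonzero[of "fst S" "snd S" "fst S'" "snd S'"] by auto
      moreover have "c \<in> fst S" "c \<notin> fst S'" using S by (auto simp: subcube_def)
      ultimately have "e = c" by auto
      show False
      proof -
        have S': "(fst S - {c}, snd S') = S'" "adj c (fst S) (snd S) (snd S')"
          using e \<open>e = c\<close> by (simp_all add: prod_eq_iff)
        have "(fst S - {c}, snd S') \<in> ?X2" unfolding S'(1) by (rule S(2))
        then have "(fst S - {c}, snd S') = h S" using hX1[OF S(1)] S'(2) by blast
        then show False using S(3) unfolding S'(1) by blast
      qed
    qed
    show "?X1 \<inter> ?X2 = {}" using subcube_split(2)[OF LU(1)] by blast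
    show "diff S S' = 0" if "S \<in> ?X2" "S' \<in> ?X1" for S S'
      using that subcube_split(3)[OF LU(1)] by blast
  qed simp
  show ?thesis
  proof (rule supported_extension[OF convex_subcube _ _ _ X3 Y])
    show "subcube L U = ?X3 \<union> ?Y" using subcube_split(1)[OF LU(1)] by blast
    show "?X3 \<inter> ?Y = {}" using subcube_split(2)[OF LU(1)] by blast
    show "diff S S' = 0" if "S \<in> ?Y" "S' \<in> ?X3" for S S'
      using that subcube_split(3)[OF LU(1)] isolated_diff[OF iso] by blast
  qed
qed

text \<open>
  The other kink: \<open>K\<close> splits off in the states with marker \<open>-\<close> at \<open>c\<close>. Up to states where \<open>K\<close> is negative, the
  split at \<open>c\<close> is multiplication by \<open>x\<^sub>K\<close>, so the states with positive \<open>K\<close> cancel against those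
  with the other marker, and the states with negative \<open>K\<close> remain.
\<close>

lemma supported_leaf_below:
  assumes LU: "c \<in> U - L" "L \<subseteq> U" "U \<subseteq> N" and iso: "isolated K L (U - {c})"
    and K: "\<And>s. \<lbrakk>L \<subseteq> s; s \<subseteq> U - {c}\<rbrakk> \<Longrightarrow> merges s c \<and> K \<in> near s c"
    and sup: "supported (subcube L (U - {c})) m M"
  shows "supported (subcube L U) m (M - 4)"
proof -
  have cN: "c \<in> N" using LU by blast
  let ?X3 = "{S \<in> subcube L (U - {c}). K \<notin> snd S}"
  let ?X1 = "{S \<in> subcube L (U - {c}). K \<in> snd S}"
  let ?X2 = "subcube (insert c L) U"
  let ?Y = "?X2 \<union> ?X1"
  have LUc: "L \<subseteq> U - {c}" "U - {c} \<subseteq> N" using LU by auto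
  have X3: "supported ?X3 m (M - 4)"
    using supported_isolated(2)[OF LUc iso sup] .
  have Ysub: "?Y \<subseteq> subcube L U" using LU by (auto simp: subcube_def)
  have convY: "convex ?Y"
  proof (rule convexI_subcube[OF Ysub])
    fix S R T assume *: "T \<in> ?Y" "R \<in> subcube L U" "diff R T \<noteq> 0"
    show "R \<in> ?Y"
    proof (cases "R \<in> ?X2")
      case False
      then have R: "R \<in> subcube L (U - {c})" using *(2) subcube_split(1)[OF LU(1)] by blast
      then have "T \<in> ?X1" using * subcube_split(3)[OF LU(1)] by blast
      then have "K \<in> snd R"
        using isolated_diff[OF iso R _ *(3)] by blast
      with R show ?thesis by blast
    qed blast
  qed
  \<comment> \<open>the remaining circle at \<open>c\<close> inherits the sign that its union with \<open>K\<close> had\<close>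
  define h where "h = (\<lambda>(s, T). (s - {c},
    insert K ((T - near s c) \<union> (if T \<inter> near s c = {} then {} else near (s - {c}) c))))"
  define g where "g = (\<lambda>(s, T). (insert c s,
    (T - near s c) \<union> (if near s c \<subseteq> T then near (insert c s) c else {})))"
  have local: thesis
    if s: "insert c L \<subseteq> s" "s \<subseteq> U"
      and *: "\<And>A C. \<lbrakk>near (s - {c}) c = {K, A}; A \<noteq> K; near s c = {C}; A \<in> circ (s - {c});
        K \<in> circ (s - {c}); C \<in> circ s; circ (s - {c}) - {K, A} = circ s - {C}\<rbrakk> \<Longrightarrow> thesis"
    for s thesis
  proof -
    have sN: "s \<subseteq> N" "c \<in> s" "s - {c} \<subseteq> N" "L \<subseteq> s - {c}" "s - {c} \<subseteq> U - {c}" using s LU by auto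
    have m: "merges (s - {c}) c" "K \<in> near (s - {c}) c"
      using K[OF sN(4,5)] by auto
    obtain A where A: "near (s - {c}) c = {K, A}" "A \<noteq> K" "A \<in> circ (s - {c})" "K \<in> circ (s - {c})"
      using near_pair[OF sN(3) cN m] by blast
    obtain C where C: "near s c = {C}" "C \<in> circ s"
      using near_single[OF sN(1) cN] merges_remove[OF sN(1,2)] m by blast
    show ?thesis
      using circ_far_remove[OF sN(1,2)] by (intro *[OF A(1,2) C(1) A(3,4) C(2)]) (simp add: A C)
  qed
  have hX2: "h S \<in> ?X1 \<and> g (h S) = S \<and> (\<forall>T'. (fst S - {c}, T') \<in> ?X1 \<longrightarrow>
      (adj c (fst S) (snd S) T' \<longleftrightarrow> (fst S - {c}, T') = h S)) \<and> adj c (fst S) (snd S) (snd (h S))"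
    if S: "S \<in> ?X2" for S
  proof -
    obtain s T where eq: "S = (s, T)" by fastforce
    have s: "insert c L \<subseteq> s" "s \<subseteq> U" "s \<subseteq> N" "c \<in> s" and T: "T \<subseteq> circ s"
      using S by (auto simp: eq subcube_def gens_def)
    obtain A C where AC: "near (s - {c}) c = {K, A}" "A \<noteq> K" "near s c = {C}" "A \<in> circ (s - {c})"
      "K \<in> circ (s - {c})" "C \<in> circ s" "circ (s - {c}) - {K, A} = circ s - {C}"
      by (rule local[OF s(1,2)])
    have nm: "\<not> merges s c" using AC(3) by (auto simp: near_def merges_def)
    have finT: "finite T" using T(1) finite_subset[OF _ finite_circ] by blast
    define W where "W = insert K ((T - {C}) \<union> (if C \<in> T then {A} else {}))"
    have hS: "h S = (s - {c}, W)"
      unfolding W_def using AC by (auto simp: h_def eq)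
    have far: "T - {C} \<subseteq> circ (s - {c}) - {K, A}" using AC(7) T by blast
    have W: "W \<subseteq> circ (s - {c})" "K \<in> W"
      unfolding W_def using far AC(4,5) by auto
    have hX1: "h S \<in> ?X1"
      unfolding hS using s W LU by (auto simp: subcube_def gens_def)
    moreover have "g (h S) = S"
    proof -
      have "W - {K, A} = T - {C}" "{K, A} \<subseteq> W \<longleftrightarrow> C \<in> T"
        unfolding W_def using far AC(2) by auto
      then show ?thesis
        unfolding hS using s(4) AC(1,3) by (auto simp: g_def eq insert_absorb)
    qed
    moreover have adj: "adj c s T T' \<longleftrightarrow> T' = W"
      if T': "T' \<subseteq> circ (s - {c})" "K \<in> T'" for T'
    proof -
      have finT': "finite (T' - {K})" "finite T'" using T' finite_subset[OF _ finite_circ] by blast+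
      have card_iff: "card T' = card T + 1 \<longleftrightarrow> (A \<in> T' \<longleftrightarrow> C \<in> T)" if "T - {C} = T' - {K} - {A}"
        unfolding card_singleton_split[OF finT, of C] card_singleton_split[OF finT'(2), of K]
          card_singleton_split[OF finT'(1), of A] that
        using T'(2) AC(2) by simp
      have "adj c s T T' \<longleftrightarrow> T - {C} = T' - {K} - {A} \<and> card T' = card T + 1"
      proof -
        have "T' - {K, A} = T' - {K} - {A}" by blast
        then show ?thesis
          using adj_card[OF s(4,3) T(1) T'(1)] nm unfolding AC(1) AC(3) by simp
      qed
      also have "\<dots> \<longleftrightarrow> T - {C} = T' - {K} - {A} \<and> (A \<in> T' \<longleftrightarrow> C \<in> T)"
        using card_iff by blast
      also have "\<dots> \<longleftrightarrow> T' = W"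
        unfolding W_def using far T'(2) AC(2) by auto
      finally show ?thesis .
    qed
    ultimately show ?thesis
      using adj[OF W] unfolding hS by (auto simp: eq subcube_def gens_def)
  qed
  have gX1: "g S \<in> ?X2 \<and> h (g S) = S" if S: "S \<in> ?X1" for S
  proof -
    obtain s' T' where eq: "S = (s', T')" by fastforce
    define s where "s = insert c s'"
    have s': "L \<subseteq> s'" "s' \<subseteq> U" "c \<notin> s'" "s' = s - {c}" and T': "T' \<subseteq> circ s'" "K \<in> T'"
      using S by (auto simp: eq subcube_def gens_def s_def)
    have s: "insert c L \<subseteq> s" "s \<subseteq> U" "s \<subseteq> N" "c \<in> s"
      using s'(1-3) LU by (auto simp: s_def)
    obtain A C where AC: "near (s - {c}) c = {K, A}" "A \<noteq> K" "near s c = {C}" "A \<in> circ (s - {c})"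
      "K \<in> circ (s - {c})" "C \<in> circ s" "circ (s - {c}) - {K, A} = circ s - {C}"
      by (rule local[OF s(1,2)])
    define V where "V = (T' - {K, A}) \<union> (if A \<in> T' then {C} else {})"
    have gS: "g S = (s, V)"
    proof -
      have "near s' c = {K, A}" "insert c s' = s"
        using AC(1) s'(3) by (simp_all add: s_def)
      then show ?thesis
        using AC(3) T'(2) by (simp add: g_def eq V_def)
    qed
    have T'': "T' - {K, A} \<subseteq> circ s - {C}"
      using AC(7) T' s'(4) by blast
    have "g S \<in> ?X2"
      unfolding gS V_def using s T'' AC(6) by (auto simp: subcube_def gens_def)
    moreover have "insert K ((V - {C}) \<union> (if V \<inter> {C} = {} then {} else {K, A})) = T'"
      unfolding V_def using T'' T'(2) by auto
    then have "h (g S) = S"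
      unfolding gS using AC(1,3) s'(4) [symmetric] T'(2) by (cases "C \<in> V") (simp_all add: h_def eq insert_absorb)
    ultimately show ?thesis by blast
  qed
  have Y: "supported ?Y m (M - 4)"
  proof (rule supported_cone[OF convY, where h = h])
    show "bij_betw h ?X2 ?X1"
      by (rule bij_betw_byWitness[where f' = g]) (use hX2 gX1 in blast)+
    show "\<bar>diff S (h S)\<bar> = 1" if S: "S \<in> ?X2" for S
    proof -
      have "c \<in> fst S" "fst S \<subseteq> N" using S by (auto simp: subcube_def gens_def)
      moreover have "h S = (fst S - {c}, snd (h S))" by (simp add: h_def split: prod.split)
      moreover have "adj c (fst S) (snd S) (snd (h S))" using hX2[OF S] by blast
      ultimately show ?thesis using diff_abs[of c "fst S" "snd S" "snd (h S)"] by simp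
    qed
    show "diff S S' = 0" if S: "S \<in> ?X2" "S' \<in> ?X1" "S' \<noteq> h S" for S S'
    proof (rule ccontr)
      assume "diff S S' \<noteq> 0"
      then obtain e where e: "e \<in> fst S" "fst S' = fst S - {e}" "adj e (fst S) (snd S) (snd S')"
        using diff_nonzero[of "fst S" "snd S" "fst S'" "snd S'"] by auto
      moreover have "c \<in> fst S" "c \<notin> fst S'" using S by (auto simp: subcube_def)
      ultimately have "e = c" by auto
      show False
      proof -
        have S': "(fst S - {c}, snd S') = S'" "adj c (fst S) (snd S) (snd S')"
          using e \<open>e = c\<close> by (simp_all add: prod_eq_iff)
        have "(fst S - {c}, snd S') \<in> ?X1" unfolding S'(1) by (rule S(2))
        then have "(fst S - {c}, snd S') = h S" using hX2[OF S(1)] S'(2) by blast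
        then show False using S(3) unfolding S'(1) by blast
      qed
    qed
    show "?X2 \<inter> ?X1 = {}" using subcube_split(2)[OF LU(1)] by blast
    show "diff S S' = 0" if "S \<in> ?X1" "S' \<in> ?X2" for S S'
      using that subcube_split(3)[OF LU(1)] by blast
  qed simp
  show ?thesis
  proof (rule supported_extension[OF convex_subcube _ _ _ Y X3])
    show "subcube L U = ?Y \<union> ?X3" using subcube_split(1)[OF LU(1)] by blast
    show "?Y \<inter> ?X3 = {}" using subcube_split(2)[OF LU(1)] by blast
    show "diff S S' = 0" if "S \<in> ?X3" "S' \<in> ?Y" for S S'
      using that subcube_split(3)[OF LU(1)] isolated_diff[OF iso] by blast
  qed
qed

end

section \<open>The degrees that carry homology\<close>

context state_cube
begin

text \<open>
  A change of marker moves points only between circles at the crossing in question, and the circle of \<open>x\<close>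
  never becomes one of these.
\<close>

lemma circle_persists:
  assumes "finite F" "F \<subseteq> N" "s \<subseteq> N" and x: "x \<in> Pts"
    and far: "\<And>c. c \<in> F \<Longrightarrow> cl s x \<notin> near s c"
    and y: "y \<in> Pts"
  shows "cl (sym_diff s F) y = cl s x \<longleftrightarrow> cl s y = cl s x"
  using assms(1,2) far y
proof (induction F arbitrary: y)
  case (insert c F)
  define t where "t = sym_diff s F"
  have t: "t \<subseteq> N" "c \<in> N" using insert assms(3) by (auto simp: t_def)
  have eq: "sym_diff s (insert c F) = flip c t"
    using insert(2) by (auto simp: flip_def t_def)
  have IH: "cl t y = cl s x \<longleftrightarrow> cl s y = cl s x" if "y \<in> Pts" for y
    unfolding t_def using insert that by blast
  have near: "cl s x \<notin> near t c"
  proof -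
    have "cl s x \<noteq> cl s (a c)" "cl s x \<noteq> cl s (b c)"
      using insert.prems(2)[of c] by (simp_all add: near_def)
    then have "cl t (a c) \<noteq> cl s x" "cl t (b c) \<noteq> cl s x"
      using IH[OF a_Pts[OF t(2)]] IH[OF b_Pts[OF t(2)]] by metis+
    then show ?thesis unfolding near_def by (metis empty_iff insert_iff)
  qed
  have x': "cl t x = cl s x" using IH x by blast
  have keep: "cl (flip c t) x = cl s x" "cl s x \<notin> near (flip c t) c"
    using away_near[OF t x] near x' by auto
  show ?case
  proof (cases "cl t y \<in> near t c")
    case True
    then have "cl (flip c t) y \<in> near (flip c t) c"
      using near_flip[OF t \<open>y \<in> Pts\<close>] by blast
    then show ?thesis
      using True near keep IH[OF \<open>y \<in> Pts\<close>] unfolding eq by metis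
  next
    case False
    then have "cl (flip c t) y = cl t y"
      using away_near(1)[OF t \<open>y \<in> Pts\<close>] by blast
    then show ?thesis
      using IH[OF \<open>y \<in> Pts\<close>] unfolding eq by simp
  qed
qed simp

lemma isolatedI:
  assumes LU: "L \<subseteq> s\<^sub>0" "s\<^sub>0 \<subseteq> U" "U \<subseteq> N" and x: "x \<in> Pts"
    and far: "\<And>c. c \<in> U - L \<Longrightarrow> cl s\<^sub>0 x \<notin> near s\<^sub>0 c"
  shows "isolated (cl s\<^sub>0 x) L U"
    and "\<lbrakk>L \<subseteq> s; s \<subseteq> U\<rbrakk> \<Longrightarrow> cl s x = cl s\<^sub>0 x"
proof -
  have persist: "cl s y = cl s\<^sub>0 x \<longleftrightarrow> cl s\<^sub>0 y = cl s\<^sub>0 x"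
    if s: "L \<subseteq> s" "s \<subseteq> U" and y: "y \<in> Pts" for s y
  proof -
    define F where "F = sym_diff s\<^sub>0 s"
    have F: "F \<subseteq> U - L" "s = sym_diff s\<^sub>0 F" using s LU by (auto simp: F_def)
    then have "finite F" "F \<subseteq> N" "s\<^sub>0 \<subseteq> N"
      using LU finite_N finite_subset[of F N] by auto
    then show ?thesis
      unfolding F(2) using F(1) far x y by (intro circle_persists) auto
  qed
  show *: "cl s x = cl s\<^sub>0 x" if "L \<subseteq> s" "s \<subseteq> U" for s
    using persist[OF that x] by simp
  show "isolated (cl s\<^sub>0 x) L U"
    unfolding isolated_def
  proof (intro allI impI conjI ballI)
    fix s assume s: "L \<subseteq> s" "s \<subseteq> U"
    show "cl s\<^sub>0 x \<in> circ s"
      using *[OF s] x unfolding circ_def by (metis imageI)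
    fix c assume c: "c \<in> U - L"
    then have "c \<in> N" using LU by blast
    then show "cl s\<^sub>0 x \<notin> near s c"
      using far[OF c] persist[OF s a_Pts[of c]] persist[OF s b_Pts[of c]]
      unfolding near_def by (metis empty_iff insert_iff)
  qed
qed

lemma \<sigma>_insert: "\<lbrakk>c \<in> N - s; s \<subseteq> N\<rbrakk> \<Longrightarrow> \<sigma>\<^sub>s (insert c s) = \<sigma>\<^sub>s s + 2"
  using \<sigma>_remove[of c "insert c s"] by (simp add: insert_absorb)

text \<open>
  For the full cube of a connected diagram these are \<open>2|s\<^sub>+| - N - 4\<close> and \<open>N - 2|s\<^sub>-| + 4\<close>.
\<close>

definition low :: "nat set \<Rightarrow> nat set \<Rightarrow> int" where
  "low L U = 2 * int (card (circ U)) - \<sigma>\<^sub>s U - 4 * int (ncomp L (U - L))"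

definition high :: "nat set \<Rightarrow> nat set \<Rightarrow> int" where
  "high L U = - 2 * int (card (circ L)) - \<sigma>\<^sub>s L + 4 * int (ncomp L (U - L))"

text \<open>
  A single state has zero differential, one component for each circle, and degrees that
  range over \<open>- \<sigma> \<plusminus> 2|s|\<close>.
\<close>

lemma supported_single:
  assumes "L \<subseteq> N"
  shows "supported (subcube L L) (low L L) (high L L)"
proof -
  have X: "convex (subcube L L)" by (rule convex_subcube)
  have b: "card (circ L) \<le> ncomp L {}" by (rule card_circ_le_ncomp)
  have d0: "diff S S' = 0" if "S \<in> subcube L L" "S' \<in> subcube L L" for S S'
  proof (rule ccontr)
    assume "diff S S' \<noteq> 0"
    then obtain c where "c \<in> fst S" "fst S' = fst S - {c}"
      using diff_nonzero[of "fst S" "snd S" "fst S'" "snd S'"] by auto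
    then show False using that by (auto simp: subcube_def)
  qed
  have bd0: "bd (subcube L L) z = (\<lambda>_. 0)" for z
    using d0 by (auto simp: bd_def fun_eq_iff intro!: sum.neutral)
  have deg: "low L L \<le> delta S \<and> delta S \<le> high L L" if S: "S \<in> subcube L L" for S
  proof -
    obtain T where eq: "S = (L, T)" "T \<subseteq> circ L"
      using S by (cases S) (auto simp: subcube_def gens_def)
    then have "card T \<le> card (circ L)" by (simp add: card_mono)
    then show ?thesis
      using b eq by (simp add: low_def high_def delta_def \<tau>_eq)
  qed
  have zero: "z = (\<lambda>_. 0)" if "z \<in> chains (subcube L L) e" "e < low L L \<or> high L L < e" for z e
    using that deg by (fastforce simp: chains_def)
  have "exact_at (subcube L L) e" if "e < low L L \<or> high L L < e" for e
    unfolding exact_at_def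
  proof (intro ballI impI)
    fix z assume "z \<in> chains (subcube L L) e"
    then have "z = (\<lambda>_. 0)" using zero that by blast
    then have "bd (subcube L L) (\<lambda>_. 0) = z" by simp
    moreover have "(\<lambda>_. 0) \<in> chains (subcube L L) (e - 4)" by (simp add: chains_def)
    ultimately show "\<exists>y \<in> chains (subcube L L) (e - 4). bd (subcube L L) y = z" by blast
  qed
  moreover have "torsion_free_at (subcube L L) e" for e
    unfolding torsion_free_at_def
  proof (intro ballI allI impI)
    fix z and n :: int
    assume n: "n \<noteq> 0" and "\<exists>y \<in> chains (subcube L L) (e - 4). bd (subcube L L) y = (\<lambda>s. n * z s)"
    then obtain y where y: "y \<in> chains (subcube L L) (e - 4)" "bd (subcube L L) y = (\<lambda>s. n * z s)"
      by blast
    have "n * z s = 0" for s using fun_cong[OF y(2), of s] by (simp add: bd0)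
    then have "z = (\<lambda>_. 0)" using n by (simp add: fun_eq_iff)
    then have "bd (subcube L L) y = z" by (simp add: bd0)
    then show "\<exists>y \<in> chains (subcube L L) (e - 4). bd (subcube L L) y = z" using y by blast
  qed
  ultimately show ?thesis by (simp add: supported_def)
qed

text \<open>
  The bound \<open>low\<close> depends on \<open>U\<close> and \<open>high\<close> on \<open>L\<close>. Fixing the marker of a crossing alters one of
  these states; its \<open>\<sigma>\<close> then changes by 2 in the favourable direction and the number of its circles by 1,
  so without a change of the number of components both bounds survive. At a leaf the number of components
  may grow by one, which loosens both bounds by 4. The shift by 4 in \<open>supported_leaf_above\<close> and
  \<open>supported_leaf_below\<close> makes up for this in one bound. In the other one the circle that splits off and
  the change of \<open>\<sigma>\<close> contribute 2 each.
\<close>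

theorem supported_subcube:
  assumes "L \<subseteq> U" "U \<subseteq> N"
  shows "supported (subcube L U) (low L U) (high L U)"
  using assms
proof (induction "card (U - L)" arbitrary: L U rule: less_induct)
  case less
  define R where "R = U - L"
  have R: "finite R" "R \<subseteq> N" and LN: "L \<subseteq> N"
    using less.prems finite_N finite_subset[of R N] by (auto simp: R_def)
  define n where "n = ncomp L R"
  have IH_above: "supported (subcube (insert c L) U) (low (insert c L) U) (high (insert c L) U)"
    if "c \<in> R" for c
  proof (rule less.hyps)
    show "card (U - insert c L) < card (U - L)"
      using that R by (intro psubset_card_mono) (auto simp: R_def)
  qed (use that less.prems in \<open>auto simp: R_def\<close>)
  have IH_below: "supported (subcube L (U - {c})) (low L (U - {c})) (high L (U - {c}))"
    if "c \<in> R" for c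
  proof (rule less.hyps)
    show "card (U - {c} - L) < card (U - L)"
      using that R by (intro psubset_card_mono) (auto simp: R_def)
  qed (use that less.prems in \<open>auto simp: R_def\<close>)
  have link_above: "link s (R - {c}) = link (insert c L) (R - {c})"
    if "c \<in> R" "insert c L \<subseteq> s" "s \<subseteq> U" for s c
    using that less.prems R by (intro link_interval[of _ _ U]) (auto simp: R_def)
  have link_below: "link s (R - {c}) = link L (R - {c})"
    if "c \<in> R" "L \<subseteq> s" "s \<subseteq> U - {c}" for s c
    using that less.prems R by (intro link_interval[of _ _ "U - {c}"]) (auto simp: R_def)
  have low_high: "low L U = 2 * int (card (circ U)) - \<sigma>\<^sub>s U - 4 * int n"
    "high L U = - 2 * int (card (circ L)) - \<sigma>\<^sub>s L + 4 * int n"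
    by (simp_all add: low_def high_def n_def R_def)
  have low_high_above: "low (insert c L) U = 2 * int (card (circ U)) - \<sigma>\<^sub>s U - 4 * int (ncomp (insert c L) (R - {c}))"
    "high (insert c L) U = - 2 * int (card (circ (insert c L))) - \<sigma>\<^sub>s L - 2 + 4 * int (ncomp (insert c L) (R - {c}))"
    if "c \<in> R" for c
  proof -
    have "U - insert c L = R - {c}" by (auto simp: R_def)
    moreover have "\<sigma>\<^sub>s (insert c L) = \<sigma>\<^sub>s L + 2"
      using that less.prems by (intro \<sigma>_insert) (auto simp: R_def)
    ultimately show "low (insert c L) U = 2 * int (card (circ U)) - \<sigma>\<^sub>s U - 4 * int (ncomp (insert c L) (R - {c}))"
      "high (insert c L) U = - 2 * int (card (circ (insert c L))) - \<sigma>\<^sub>s L - 2 + 4 * int (ncomp (insert c L) (R - {c}))"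
      by (simp_all add: low_def high_def)
  qed
  have low_high_below: "low L (U - {c}) = 2 * int (card (circ (U - {c}))) - \<sigma>\<^sub>s U + 2 - 4 * int (ncomp L (R - {c}))"
    "high L (U - {c}) = - 2 * int (card (circ L)) - \<sigma>\<^sub>s L + 4 * int (ncomp L (R - {c}))"
    if "c \<in> R" for c
  proof -
    have "U - {c} - L = R - {c}" by (auto simp: R_def)
    moreover have "\<sigma>\<^sub>s (U - {c}) = \<sigma>\<^sub>s U - 2"
      using that less.prems by (intro \<sigma>_remove) (auto simp: R_def)
    ultimately show "low L (U - {c}) = 2 * int (card (circ (U - {c}))) - \<sigma>\<^sub>s U + 2 - 4 * int (ncomp L (R - {c}))"
      "high L (U - {c}) = - 2 * int (card (circ L)) - \<sigma>\<^sub>s L + 4 * int (ncomp L (R - {c}))"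
      by (simp_all add: low_def high_def)
  qed
  have ncomp_L: "ncomp (insert c L) R = n" if "c \<in> R" for c
  proof -
    have "link (insert c L) R = link L R"
      using that less.prems R by (intro link_interval[of _ _ U]) (auto simp: R_def)
    then show ?thesis by (simp add: ncomp_def n_def)
  qed
  have circ_above: "int (card (circ (insert c L))) = int (card (circ L)) + (if merges (insert c L) c then 1 else -1)"
    if "c \<in> R" for c
  proof -
    have "flip c (insert c L) = L" "insert c L \<subseteq> N" "c \<in> N" using that R LN by (auto simp: flip_def R_def)
    then show ?thesis using card_circ_flip[of "insert c L" c] by (simp split: if_splits)
  qed
  have circ_below: "int (card (circ (U - {c}))) = int (card (circ U)) + (if merges (U - {c}) c then 1 else -1)"
    if "c \<in> R" for c
  proof -
    have "flip c (U - {c}) = U" "U - {c} \<subseteq> N" "c \<in> N" using that R less.prems by (auto simp: flip_def R_def)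
    then show ?thesis using card_circ_flip[of "U - {c}" c] by (simp split: if_splits)
  qed
  show ?case
  proof (cases "R = {}")
    case True
    then have "U = L" using less.prems by (auto simp: R_def)
    then show ?thesis using supported_single[OF LN] by simp
  next
    case nonempty: False
    show ?thesis
    proof (cases "\<exists>c\<in>R. (a c, b c) \<in> link (insert c L) (R - {c}) \<and> (a c, b c) \<in> link L (R - {c})")
      case True
      then obtain c where c: "c \<in> R" "(a c, b c) \<in> link (insert c L) (R - {c})"
        "(a c, b c) \<in> link L (R - {c})" by blast
      have nc: "ncomp (insert c L) (R - {c}) = n" "ncomp L (R - {c}) = n"
        using link_nonbridge[OF c(2)] link_nonbridge[OF c(3)] ncomp_L[OF c(1)]
        by (simp_all add: ncomp_def n_def)
      have "supported (subcube (insert c L) U) (low L U) (high L U)"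
        by (rule supported_mono[OF IH_above[OF c(1)]])
          (use circ_above[OF c(1)] in \<open>auto simp: low_high low_high_above[OF c(1)] nc split: if_splits\<close>)
      moreover have "supported (subcube L (U - {c})) (low L U) (high L U)"
        by (rule supported_mono[OF IH_below[OF c(1)]])
          (use circ_below[OF c(1)] in \<open>auto simp: low_high low_high_below[OF c(1)] nc split: if_splits\<close>)
      moreover have "c \<in> U - L" using c(1) by (simp add: R_def)
      ultimately show ?thesis
        using subcube_split by (intro supported_extension[OF convex_subcube, of L U "subcube (insert c L) U" "subcube L (U - {c})"]) auto
    next
      case False
      \<comment> \<open>the smoothings that cut every crossing off lead to a forest\<close>
      \<comment> \<open>\<open>above c\<close>: it is the marker + that cuts \<open>c\<close> off\<close>
      define above where "above c \<longleftrightarrow> (a c, b c) \<notin> link (insert c L) (R - {c})" for c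
      define s\<^sub>0 where "s\<^sub>0 = L \<union> {c \<in> R. above c}"
      have s0: "L \<subseteq> s\<^sub>0" "s\<^sub>0 \<subseteq> U" using less.prems by (auto simp: s\<^sub>0_def R_def)
      have bridge: "(a c, b c) \<notin> link s\<^sub>0 (R - {c})" if c: "c \<in> R" for c
      proof (cases "above c")
        case True
        then have "insert c L \<subseteq> s\<^sub>0" using c by (auto simp: s\<^sub>0_def)
        then show ?thesis using link_above[OF c _ s0(2)] True by (simp add: above_def)
      next
        case nab: False
        then have "s\<^sub>0 \<subseteq> U - {c}" using s0 c by (auto simp: s\<^sub>0_def R_def)
        then show ?thesis using link_below[OF c s0(1)] nab False c by (auto simp: above_def)
      qed
      obtain c x where c: "c \<in> R" and x: "x = a c \<or> x = b c"
        and leaf: "\<And>e. e \<in> R - {c} \<Longrightarrow> cl s\<^sub>0 (a e) \<noteq> cl s\<^sub>0 x \<and> cl s\<^sub>0 (b e) \<noteq> cl s\<^sub>0 x"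
        using forest_leaf[OF R(1) nonempty R(2) bridge] by blast
      have cU: "c \<in> U - L" "c \<in> N" using c R by (auto simp: R_def)
      have xP: "x \<in> Pts" using x cU a_Pts b_Pts by blast
      have far: "cl s\<^sub>0 x \<notin> near s\<^sub>0 e" if "e \<in> R - {c}" for e
        using leaf[OF that] by (auto simp: near_def)
      have near: "cl s x \<in> near s c" for s using x by (auto simp: near_def)
      show ?thesis
      proof (cases "above c")
        case True
        have s0c: "insert c L \<subseteq> s\<^sub>0" using True c by (auto simp: s\<^sub>0_def)
        have iso: "isolated (cl s\<^sub>0 x) (insert c L) U"
          and cl: "\<And>s. \<lbrakk>insert c L \<subseteq> s; s \<subseteq> U\<rbrakk> \<Longrightarrow> cl s x = cl s\<^sub>0 x"
          using isolatedI[OF s0c s0(2) less.prems(2) xP] far by (auto simp: R_def)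
        have m: "merges s c" if "insert c L \<subseteq> s" "s \<subseteq> U" for s
          using link_above[OF c that] True link_cl[OF a_Pts b_Pts, of c c s "R - {c}"] cU
          by (auto simp: above_def merges_def)
        have "supported (subcube L U) (low (insert c L) U + 4) (high (insert c L) U)"
          using m cl near by (intro supported_leaf_above[OF cU(1) less.prems iso _ IH_above[OF c]]) metis
        moreover have "ncomp (insert c L) (R - {c}) \<le> n + 1"
          using ncomp_remove_le[of "insert c L" R c] ncomp_L[OF c] by simp
        moreover have "merges (insert c L) c" by (rule m) (use cU(1) less.prems(1) in auto)
        then have "int (card (circ (insert c L))) = int (card (circ L)) + 1"
          using circ_above[OF c] by simp
        ultimately show ?thesis
          unfolding low_high low_high_above[OF c] by (elim supported_mono) linarith+
      next
        case nab: False
        have s0c: "s\<^sub>0 \<subseteq> U - {c}" using s0 nab c by (auto simp: s\<^sub>0_def R_def)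
        have UcN: "U - {c} \<subseteq> N" using less.prems by blast
        have iso: "isolated (cl s\<^sub>0 x) L (U - {c})"
          and cl: "\<And>s. \<lbrakk>L \<subseteq> s; s \<subseteq> U - {c}\<rbrakk> \<Longrightarrow> cl s x = cl s\<^sub>0 x"
          using isolatedI[OF s0(1) s0c UcN xP] far by (auto simp: R_def)
        have "(a c, b c) \<notin> link L (R - {c})" using False nab c by (auto simp: above_def)
        then have m: "merges s c" if "L \<subseteq> s" "s \<subseteq> U - {c}" for s
          using link_below[OF c that] link_cl[OF a_Pts b_Pts, of c c s "R - {c}"] cU
          by (auto simp: merges_def)
        have "supported (subcube L U) (low L (U - {c})) (high L (U - {c}) - 4)"
          using m cl near by (intro supported_leaf_below[OF cU(1) less.prems iso _ IH_below[OF c]]) metis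
        moreover have "ncomp L (R - {c}) \<le> n + 1"
          using ncomp_remove_le[of L R c] by (simp add: n_def)
        moreover have "merges (U - {c}) c" by (rule m) (use cU(1) less.prems(1) in auto)
        then have "int (card (circ (U - {c}))) = int (card (circ U)) + 1"
          using circ_below[OF c] by simp
        ultimately show ?thesis
          unfolding low_high low_high_below[OF c] by (elim supported_mono) linarith+
      qed
    qed
  qed
qed

end

section \<open>Diagrams with checkerboard orientation\<close>

lemma funpow_in: "\<lbrakk>f ` A \<subseteq> A; x \<in> A\<rbrakk> \<Longrightarrow> (f ^^ n) x \<in> A"
  by (induction n) auto

lemma funpow_return:
  assumes "finite A" "f ` A \<subseteq> A" "inj_on f A" "x \<in> A"
  obtains n where "0 < n" "(f ^^ n) x = x"
proof -
  have inj: "inj_on (f ^^ n) A" for n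
  proof (induction n)
    case (Suc n)
    have "inj_on (f ^^ n \<circ> f) A"
      using Suc assms by (intro comp_inj_on) (auto intro: inj_on_subset)
    then show ?case unfolding funpow_Suc_right .
  qed simp
  have "\<not> inj_on (\<lambda>n. (f ^^ n) x) (UNIV :: nat set)"
  proof
    assume "inj (\<lambda>n. (f ^^ n) x)"
    moreover have "finite (range (\<lambda>n. (f ^^ n) x))"
      by (rule finite_subset[OF _ assms(1)]) (use funpow_in[OF assms(2,4)] in blast)
    ultimately show False using finite_imageD infinite_UNIV_nat by blast
  qed
  then obtain i' j' where "(f ^^ i') x = (f ^^ j') x" "i' \<noteq> j'" by (auto simp: inj_def)
  then obtain i j where ij: "i < j" "(f ^^ i) x = (f ^^ j) x"
    by (metis linorder_neqE_nat)
  have "f ^^ j = f ^^ i \<circ> f ^^ (j - i)"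
    using ij(1) by (simp flip: funpow_add)
  then have "(f ^^ i) ((f ^^ (j - i)) x) = (f ^^ i) x"
    using ij(2) by simp
  then have "(f ^^ (j - i)) x = x"
    using inj_onD[OF inj[of i]] assms(4) funpow_in[OF assms(2,4)] by blast
  with ij(1) that[of "j - i"] show thesis by simp
qed

text \<open>
  Composing a permutation with the transposition of \<open>a\<close> and \<open>b\<close> cuts their cycle in two if there is one,
  and otherwise joins two cycles.
\<close>

lemma orbit_transposition_split:
  assumes f: "f ` A \<subseteq> A" and ab: "a \<in> A" "b \<in> A" "a \<noteq> b"
    and g: "g a = f b" "g b = f a" "\<And>x. \<lbrakk>x \<in> A; x \<noteq> a; x \<noteq> b\<rbrakk> \<Longrightarrow> g x = f x"
    and orbit: "(f ^^ m) b = a"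
  shows "(g ^^ n) a \<noteq> b"
proof -
  define J where "J = (LEAST m. (f ^^ m) b = a)"
  have J: "(f ^^ J) b = a" unfolding J_def using orbit by (rule LeastI)
  have less: "(f ^^ j) b \<noteq> a" if "j < J" for j
    using that not_less_Least unfolding J_def by blast
  have not_b: "(f ^^ j) b \<noteq> b" if "0 < j" "j \<le> J" for j
  proof
    assume *: "(f ^^ j) b = b"
    have "(f ^^ (J - j)) b = a"
      using J * that(2) by (metis comp_apply funpow_add le_add_diff_inverse2)
    then show False using less[of "J - j"] that by auto
  qed
  \<comment> \<open>the cycle of \<open>a\<close> under \<open>g\<close>: the part of the old cycle that leads from \<open>b\<close> to \<open>a\<close>\<close>
  define Z where "Z = insert a {(f ^^ j) b | j. 0 < j \<and> j < J}"
  have inZ: "(f ^^ j) b \<in> Z" if "0 < j" "j \<le> J" for j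
    using that J by (cases "j = J") (auto simp: Z_def)
  have "J > 0" using J ab(3) by (cases J) auto
  have closed: "g x \<in> Z" if xZ: "x \<in> Z" for x
  proof (cases "x = a")
    case True
    then show ?thesis using inZ[of 1] \<open>J > 0\<close> g(1) by simp
  next
    case False
    then obtain j where j: "x = (f ^^ j) b" "0 < j" "j < J" using xZ by (auto simp: Z_def)
    moreover have "x \<in> A" using funpow_in[OF f ab(2)] j by simp
    ultimately have "g x = (f ^^ Suc j) b" using g(3) False not_b[of j] by simp
    then show ?thesis using inZ[of "Suc j"] j by simp
  qed
  have "(g ^^ n) a \<in> Z"
  proof (induction n)
    case 0
    show ?case by (simp add: Z_def)
  qed (simp add: closed)
  moreover have "b \<notin> Z"
  proof
    assume "b \<in> Z"
    then obtain j where "b = (f ^^ j) b" "0 < j" "j < J" using ab(3) unfolding Z_def by blast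
    then show False using not_b[of j] by simp
  qed
  ultimately show ?thesis by metis
qed

lemma orbit_transposition_merge:
  assumes fin: "finite A" and f: "f ` A \<subseteq> A" "inj_on f A" and ab: "a \<in> A" "b \<in> A"
    and g: "g a = f b" "\<And>x. \<lbrakk>x \<in> A; x \<noteq> a; x \<noteq> b\<rbrakk> \<Longrightarrow> g x = f x"
    and orbit: "\<And>m. (f ^^ m) b \<noteq> a"
  obtains n where "(g ^^ n) a = b"
proof -
  define J where "J = (LEAST n. 0 < n \<and> (f ^^ n) b = b)"
  obtain n0 where "0 < n0 \<and> (f ^^ n0) b = b"
    using funpow_return[OF fin f ab(2)] by metis
  then have J: "0 < J \<and> (f ^^ J) b = b" unfolding J_def by (rule LeastI)
  have not_b: "(f ^^ j) b \<noteq> b" if "0 < j" "j < J" for j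
    using that not_less_Least unfolding J_def by blast
  have "Suc j \<le> J \<Longrightarrow> (g ^^ Suc j) a = (f ^^ Suc j) b" for j
  proof (induction j)
    case (Suc j)
    \<comment> \<open>until it returns to \<open>b\<close>, the orbit of \<open>a\<close> under \<open>g\<close> copies that of \<open>b\<close> under \<open>f\<close>\<close>
    have "(f ^^ Suc j) b \<in> A" by (rule funpow_in[OF f(1) ab(2)])
    moreover have "(f ^^ Suc j) b \<noteq> b" using Suc.prems by (intro not_b) simp_all
    ultimately have "g ((f ^^ Suc j) b) = f ((f ^^ Suc j) b)" by (intro g(2) orbit)
    then show ?case using Suc by simp
  qed (simp add: g)
  then have "(g ^^ J) a = (f ^^ J) b" using J by (metis Suc_pred le_refl)
  with J that show thesis by metis
qed

text \<open>
  With \<open>u\<close> the over-information of a diagram this holds exactly for the darts at the ends of over-strands.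
  Later \<open>u\<close> belongs to the alternating diagram, not to the one whose circles are considered.
\<close>

definition checker :: "(nat \<Rightarrow> bool) \<Rightarrow> dart \<Rightarrow> bool" where
  "checker u = (\<lambda>(c, p). even p \<longleftrightarrow> u c)"

text \<open>
  Orienting every edge away from its end that satisfies \<open>checker u\<close> makes in- and outgoing ends alternate
  around each crossing, so that both smoothings inherit the orientation.
\<close>

locale coloured_diagram =
  fixes D :: diagram and u :: "nat \<Rightarrow> bool"
  assumes finite_crossings: "finite (crossings D)"
    and joined: "x \<in> darts D \<Longrightarrow> joined D x \<in> darts D \<and> joined D (joined D x) = x"
    and checker_joined: "x \<in> darts D \<Longrightarrow> checker u (joined D x) \<longleftrightarrow> \<not> checker u x"
begin

text \<open>
  The two outgoing ends at \<open>c\<close>. They are opposite, hence on different arcs of either smoothing.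
\<close>

definition pos :: "nat \<Rightarrow> dart" where
  "pos c = (c, if u c then 0 else 1)"

definition neg :: "nat \<Rightarrow> dart" where
  "neg c = (c, if u c then 2 else 3)"

abbreviation sm :: "nat set \<Rightarrow> dart \<Rightarrow> dart" where
  "sm \<equiv> smoothing D"

lemma dart_cases:
  assumes "x \<in> darts D"
  obtains c where "c \<in> crossings D" "x = (c, 0)" | c where "c \<in> crossings D" "x = (c, 1)"
    | c where "c \<in> crossings D" "x = (c, 2)" | c where "c \<in> crossings D" "x = (c, 3)"
proof -
  obtain c p where x: "x = (c, p)" "c \<in> crossings D" "p < 4" using assms by (auto simp: darts_def)
  then have "p = 0 \<or> p = 1 \<or> p = 2 \<or> p = 3" by auto
  then show thesis using that x by blast
qed

lemma finite_darts: "finite (darts D)"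
  by (simp add: darts_def finite_crossings)

lemma sm_dart: "x \<in> darts D \<Longrightarrow> sm s x \<in> darts D"
  by (auto simp: smoothing_def darts_def split: if_splits)

lemma fst_sm: "fst (sm s x) = fst x"
  by (auto simp: smoothing_def split: prod.split)

lemma sm_sm: "x \<in> darts D \<Longrightarrow> sm s (sm s x) = x"
  by (erule dart_cases) (auto simp: smoothing_def)

lemma checker_sm: "x \<in> darts D \<Longrightarrow> checker u (sm s x) \<longleftrightarrow> \<not> checker u x"
  by (erule dart_cases) (auto simp: smoothing_def checker_def)

lemma sm_flip_other: "fst x \<noteq> c \<Longrightarrow> sm (flip c s) x = sm s x"
  by (cases x) (auto simp: smoothing_def flip_def)

lemma sm_flip: "sm (flip c s) (pos c) = sm s (neg c)" "sm (flip c s) (neg c) = sm s (pos c)"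
  by (auto simp: smoothing_def flip_def pos_def neg_def)

lemma pos_neg:
  "c \<in> crossings D \<Longrightarrow> pos c \<in> darts D" "c \<in> crossings D \<Longrightarrow> neg c \<in> darts D" "pos c \<noteq> neg c"
  "checker u (pos c)" "checker u (neg c)" "fst (pos c) = c" "fst (neg c) = c"
  by (auto simp: pos_def neg_def darts_def checker_def)

lemma checker_at: "\<lbrakk>x \<in> darts D; checker u x\<rbrakk> \<Longrightarrow> x = pos (fst x) \<or> x = neg (fst x)"
  by (erule dart_cases) (auto simp: pos_def neg_def checker_def)

definition rel :: "nat set \<Rightarrow> dart rel" where
  "rel s = {(x, f x) | x f. x \<in> darts D \<and> f \<in> {joined D, sm s}}\<^sup>*"

lemma rel_refl [simp]: "(x, x) \<in> rel s"
  by (simp add: rel_def)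

lemma rel_trans: "\<lbrakk>(x, y) \<in> rel s; (y, z) \<in> rel s\<rbrakk> \<Longrightarrow> (x, z) \<in> rel s"
  unfolding rel_def by (rule rtrancl_trans)

lemma rel_sym: "(x, y) \<in> rel s \<Longrightarrow> (y, x) \<in> rel s"
proof -
  have "sym {(x, f x) | x f. x \<in> darts D \<and> f \<in> {joined D, sm s}}"
  proof (rule symI)
    fix x y assume "(x, y) \<in> {(x, f x) | x f. x \<in> darts D \<and> f \<in> {joined D, sm s}}"
    then obtain f where f: "y = f x" "x \<in> darts D" "f \<in> {joined D, sm s}" by blast
    then have "y \<in> darts D" "x = f y"
      using joined[OF f(2)] sm_dart[OF f(2), of s] sm_sm[OF f(2), of s] by auto
    with f(3) show "(y, x) \<in> {(x, f x) | x f. x \<in> darts D \<and> f \<in> {joined D, sm s}}" by blast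
  qed
  then show "(x, y) \<in> rel s \<Longrightarrow> (y, x) \<in> rel s"
    unfolding rel_def by (meson sym_rtrancl symD)
qed

lemma rel_joined: "x \<in> darts D \<Longrightarrow> (x, joined D x) \<in> rel s"
  unfolding rel_def by (rule r_into_rtrancl) blast

lemma rel_sm: "x \<in> darts D \<Longrightarrow> (x, sm s x) \<in> rel s"
  unfolding rel_def by (rule r_into_rtrancl) blast

lemma rel_induct [consumes 1, case_names refl edge arc]:
  assumes "(x, y) \<in> rel s"
    and "P x"
    and "\<And>y. \<lbrakk>(x, y) \<in> rel s; P y; y \<in> darts D\<rbrakk> \<Longrightarrow> P (joined D y)"
    and "\<And>y. \<lbrakk>(x, y) \<in> rel s; P y; y \<in> darts D\<rbrakk> \<Longrightarrow> P (sm s y)"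
  shows "P y"
  using assms(1) unfolding rel_def
proof (induction rule: rtrancl_induct)
  case base
  then show ?case using assms(2) .
next
  case (step y z)
  then have "(x, y) \<in> rel s" by (simp add: rel_def)
  with step show ?case using assms(3,4) by auto
qed

lemma rel_darts: "\<lbrakk>(x, y) \<in> rel s; x \<in> darts D\<rbrakk> \<Longrightarrow> y \<in> darts D"
  by (induction rule: rel_induct) (auto simp: joined sm_dart)

lemma equiv_rel: "equiv UNIV (rel s)"
  by (auto intro!: equivI refl_onI symI transI intro: rel_sym rel_trans)

lemma orbit_classes_rel: "orbit_classes (darts D) {joined D, sm s} = darts D // rel s"
  by (simp add: orbit_classes_def rel_def)

definition outward :: "dart set" where
  "outward = {x \<in> darts D. checker u x}"

text \<open>
  One step against the orientation: from an outgoing end across the crossing to an incoming one, and from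
  there to the start of its edge. The cycles of this permutation of outgoing ends are the circles.
\<close>

definition follow :: "nat set \<Rightarrow> dart \<Rightarrow> dart" where
  "follow s = joined D \<circ> sm s"

lemma follow_outward: "follow s ` outward \<subseteq> outward"
  by (auto simp: follow_def outward_def joined sm_dart checker_joined checker_sm)

lemma follow_inj: "inj_on (follow s) outward"
  by (rule inj_onI) (metis (no_types, lifting) comp_apply follow_def joined mem_Collect_eq outward_def sm_dart sm_sm)

lemma finite_outward: "finite outward"
  by (simp add: outward_def finite_darts)

lemma rel_follow: "x \<in> darts D \<Longrightarrow> (x, follow s x) \<in> rel s"
  unfolding follow_def comp_apply by (metis rel_joined rel_sm rel_trans sm_dart)

text \<open>
  A circle visits ends of both kinds in turn. Thus reachability by the two involutions amounts
  to reachability by the permutation, finiteness taking care of the steps in the wrong direction.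
\<close>

lemma rel_iff_follow:
  assumes x: "x \<in> outward" and y: "y \<in> outward"
  shows "(x, y) \<in> rel s \<longleftrightarrow> (\<exists>n. (follow s ^^ n) x = y)"
proof
  define Orb where "Orb = range (\<lambda>n. (follow s ^^ n) x)"
  have Orb: "Orb \<subseteq> outward"
    unfolding Orb_def using funpow_in[OF follow_outward x] by blast
  have step: "follow s z \<in> Orb" if z: "z \<in> Orb" for z
  proof -
    obtain n where "z = (follow s ^^ n) x" using z unfolding Orb_def by blast
    then have "follow s z = (follow s ^^ Suc n) x" by simp
    then show ?thesis unfolding Orb_def by (rule range_eqI)
  qed
  have "inj_on (follow s) Orb" using follow_inj Orb by (rule inj_on_subset)
  then have surj: "follow s ` Orb = Orb"
    using step finite_subset[OF Orb finite_outward] by (intro endo_inj_surj) blast+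
  have pull_back: "z \<in> Orb" if z: "follow s z \<in> Orb" "z \<in> outward" for z
  proof -
    obtain z' where "z' \<in> Orb" "follow s z = follow s z'" using z(1) surj by blast
    then show ?thesis using inj_onD[OF follow_inj, of s z z'] z(2) Orb by blast
  qed
  have x_Orb: "x \<in> Orb" unfolding Orb_def by (rule range_eqI[of _ _ 0]) simp
  assume "(x, y) \<in> rel s"
  then have "(checker u y \<longrightarrow> y \<in> Orb) \<and> (\<not> checker u y \<longrightarrow> joined D y \<in> Orb)"
  proof (induction rule: rel_induct)
    case refl
    then show ?case using x x_Orb by (simp add: outward_def)
  next
    case (edge y)
    then show ?case using joined[of y] checker_joined[of y] by auto
  next
    case (arc y)
    show ?case
    proof (cases "checker u y")
      case True
      then have "follow s y \<in> Orb" using arc step by blast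
      then show ?thesis using True arc checker_sm[of y s] by (simp add: follow_def)
    next
      case False
      then have "joined D y \<in> Orb" using arc by blast
      then have "follow s (sm s y) \<in> Orb" using arc sm_sm[of y s] by (simp add: follow_def)
      moreover have "sm s y \<in> outward"
        using arc sm_dart checker_sm False by (simp add: outward_def)
      ultimately show ?thesis using pull_back False arc checker_sm[of y s] by simp
    qed
  qed
  then show "\<exists>n. (follow s ^^ n) x = y"
    using y unfolding Orb_def outward_def by auto
next
  assume "\<exists>n. (follow s ^^ n) x = y"
  then obtain n where "y = (follow s ^^ n) x" by blast
  moreover have "(x, (follow s ^^ n) x) \<in> rel s"
  proof (induction n)
    case (Suc n)
    have "(follow s ^^ n) x \<in> darts D"
      using funpow_in[OF follow_outward x] by (auto simp: outward_def)
    then show ?case using Suc rel_follow rel_trans by (metis comp_apply funpow.simps(2))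
  qed simp
  ultimately show "(x, y) \<in> rel s" by simp
qed

context
  fixes c assumes c: "c \<in> crossings D"
begin

lemma ends_outward: "pos c \<in> outward" "neg c \<in> outward"
  using c by (simp_all add: outward_def pos_neg)

text \<open>
  In terms of permutations a change of marker is composition with a transposition.
\<close>

lemma follow_flip:
  "follow (flip c s) (pos c) = follow s (neg c)" "follow (flip c s) (neg c) = follow s (pos c)"
  "\<lbrakk>x \<in> outward; x \<noteq> pos c; x \<noteq> neg c\<rbrakk> \<Longrightarrow> follow (flip c s) x = follow s x"
proof -
  assume "x \<in> outward" "x \<noteq> pos c" "x \<noteq> neg c"
  then have "fst x \<noteq> c" using checker_at[of x] by (auto simp: outward_def)
  then show "follow (flip c s) x = follow s x" by (simp add: follow_def sm_flip_other)
qed (simp_all add: follow_def sm_flip)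

lemma rel_split:
  assumes "(pos c, neg c) \<in> rel s"
  shows "(pos c, neg c) \<notin> rel (flip c s)"
proof -
  obtain m where m: "(follow s ^^ m) (neg c) = pos c"
    using rel_iff_follow[OF ends_outward(2,1)] rel_sym[OF assms] by blast
  have "(follow (flip c s) ^^ n) (pos c) \<noteq> neg c" for n
    by (rule orbit_transposition_split[OF follow_outward ends_outward pos_neg(3)
          follow_flip(1,2) _ m]) (rule follow_flip(3))
  then show ?thesis using rel_iff_follow[OF ends_outward] by blast
qed

lemma rel_merge_ends:
  assumes "(pos c, neg c) \<notin> rel s"
  shows "(pos c, neg c) \<in> rel (flip c s)"
proof -
  have "(follow s ^^ m) (neg c) \<noteq> pos c" for m
    using rel_iff_follow[OF ends_outward(2,1)] assms rel_sym by blast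
  then obtain n where "(follow (flip c s) ^^ n) (pos c) = neg c"
    using orbit_transposition_merge[OF finite_outward follow_outward follow_inj ends_outward
        follow_flip(1,3)] by metis
  then show ?thesis using rel_iff_follow[OF ends_outward] by blast
qed

lemma rel_at_crossing:
  assumes "x \<in> darts D" "fst x = c"
  shows "(x, pos c) \<in> rel s \<or> (x, neg c) \<in> rel s"
proof (cases "checker u x")
  case True
  then show ?thesis using checker_at[OF assms(1)] assms(2) rel_refl by metis
next
  case False
  then have "sm s x = pos c \<or> sm s x = neg c"
    using checker_at[OF sm_dart[OF assms(1)]] checker_sm[OF assms(1)] fst_sm assms(2) by metis
  then show ?thesis using rel_sm[OF assms(1), of s] by metis
qed

lemma rel_unaffected:
  assumes "(x, pos c) \<notin> rel s" "(x, neg c) \<notin> rel s"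
  shows "(x, y) \<in> rel (flip c s) \<longleftrightarrow> (x, y) \<in> rel s"
proof -
  \<comment> \<open>a path that stays away from \<open>c\<close> does not see the change of marker\<close>
  have same: "sm (flip c s) y = sm s y" if "(x, y) \<in> rel s" "y \<in> darts D" for y
    using rel_at_crossing[OF that(2)] rel_trans[OF that(1)] assms sm_flip_other by metis
  show ?thesis
  proof
    assume "(x, y) \<in> rel (flip c s)"
    then show "(x, y) \<in> rel s"
      by (induction rule: rel_induct) (auto simp: same intro: rel_joined rel_sm rel_trans)
  next
    assume "(x, y) \<in> rel s"
    then show "(x, y) \<in> rel (flip c s)"
    proof (induction rule: rel_induct)
      case (arc y)
      then show ?case using same[of y] rel_sm[of y "flip c s"] by (metis rel_trans)
    qed (auto intro: rel_joined rel_trans)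
  qed
qed

lemma rel_merge:
  assumes "(pos c, neg c) \<notin> rel s"
  shows "(x, y) \<in> rel (flip c s) \<longleftrightarrow> (x, y) \<in> rel s \<or>
    ((x, pos c) \<in> rel s \<and> (y, neg c) \<in> rel s) \<or> ((x, neg c) \<in> rel s \<and> (y, pos c) \<in> rel s)"
proof -
  let ?near = "\<lambda>x. (x, pos c) \<in> rel s \<or> (x, neg c) \<in> rel s"
  let ?nearf = "\<lambda>x. (x, pos c) \<in> rel (flip c s)"
  have pn: "(pos c, neg c) \<in> rel (flip c s)" by (rule rel_merge_ends[OF assms])
  have at_c: "?nearf x" if "x \<in> darts D" "fst x = c" for x
    using rel_at_crossing[OF that, of "flip c s"] pn rel_sym rel_trans by metis
  have up: "(x, y) \<in> rel (flip c s)" if "(x, y) \<in> rel s" for x y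
    using that
  proof (induction rule: rel_induct)
    case (arc y)
    show ?case
    proof (cases "fst y = c")
      case True
      then have "?nearf y" "?nearf (sm s y)"
        using at_c arc sm_dart fst_sm by metis+
      then show ?thesis using arc rel_sym rel_trans by metis
    next
      case False
      then show ?thesis using arc sm_flip_other rel_sm rel_trans by metis
    qed
  qed (auto intro: rel_joined rel_trans)
  have down: "(x, y) \<in> rel s \<or> ?near x \<and> ?near y" if "(x, y) \<in> rel (flip c s)" for x y
    using that
  proof (induction rule: rel_induct)
    case (edge y)
    have "(y, joined D y) \<in> rel s" using edge by (simp add: rel_joined)
    then show ?case using edge.IH rel_sym rel_trans by metis
  next
    case (arc y)
    show ?case
    proof (cases "fst y = c")
      case True
      then have "?near y" "?near (sm (flip c s) y)"
        using rel_at_crossing arc sm_dart fst_sm by metis+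
      then show ?thesis using arc.IH rel_sym rel_trans by metis
    next
      case False
      then have "(y, sm (flip c s) y) \<in> rel s" using arc by (simp add: sm_flip_other rel_sm)
      then show ?thesis using arc.IH rel_sym rel_trans by metis
    qed
  qed simp
  show ?thesis
    using down[of x y] up pn rel_sym rel_trans by metis
qed

end

definition cls :: "nat set \<Rightarrow> dart + nat \<Rightarrow> circle" where
  "cls s = map_sum (\<lambda>x. rel s `` {x}) id"

definition points :: "(dart + nat) set" where
  "points = darts D <+> {..<free_circles D}"

lemma cls_eq: "cls s (Inl x) = cls s (Inl y) \<longleftrightarrow> (x, y) \<in> rel s"
  by (simp add: cls_def eq_equiv_class_iff[OF equiv_rel])

lemma cls_Inr [simp]: "cls s (Inr n) = Inr n"
  by (simp add: cls_def)

lemma cls_Inl_neq [simp]: "cls s (Inl x) \<noteq> Inr n" "Inr n \<noteq> cls s (Inl x)"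
  by (simp_all add: cls_def)

lemma circles_cls: "circles D s = cls s ` points"
  by (force simp: circles_def points_def cls_def orbit_classes_rel quotient_def image_Un Plus_def)

sublocale state_cube "crossings D" points cls "\<lambda>c. Inl (pos c)" "\<lambda>c. Inl (neg c)"
proof
  show "finite points" by (simp add: points_def finite_darts)
next
  fix c assume "c \<in> crossings D"
  then show "Inl (pos c) \<in> points" "Inl (neg c) \<in> points"
    by (simp_all add: points_def pos_neg InlI)
next
  fix s c x y
  assume c: "c \<in> crossings D" and m: "cls s (Inl (pos c)) \<noteq> cls s (Inl (neg c))"
    and "x \<in> points" "y \<in> points"
  have "(pos c, neg c) \<notin> rel s" using m by (simp add: cls_eq)
  note M = rel_merge[OF c this]
  show "(cls (flip c s) x = cls (flip c s) y) =
    (cls s x = cls s y \<or> {cls s x, cls s y} = {cls s (Inl (pos c)), cls s (Inl (neg c))})"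
    by (cases x; cases y) (auto simp: cls_eq M doubleton_eq_iff)
next
  fix s c assume "c \<in> crossings D" "cls s (Inl (pos c)) = cls s (Inl (neg c))"
  then show "cls (flip c s) (Inl (pos c)) \<noteq> cls (flip c s) (Inl (neg c))"
    using rel_split by (simp add: cls_eq)
next
  fix s c x
  assume c: "c \<in> crossings D"
    and x: "cls s x \<noteq> cls s (Inl (pos c))" "cls s x \<noteq> cls s (Inl (neg c))"
  show "cls (flip c s) x = cls s x"
  proof (cases x)
    case (Inl d)
    then have "(d, pos c) \<notin> rel s" "(d, neg c) \<notin> rel s"
      using x by (simp_all add: cls_eq)
    note rel_unaffected[OF c this]
    then show ?thesis by (auto simp: Inl cls_def)
  qed simp
qed (simp add: finite_crossings)

end

section \<open>Khovanov homology groups\<close>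

lemma trivial_quotient:
  assumes "comm_group A" "subgroup I A" "carrier A \<subseteq> I"
  shows "trivial_group (A Mod I)"
proof -
  interpret comm_group A by fact
  interpret normal I A by (rule subgroup_imp_normal[OF assms(2)])
  have "I #>\<^bsub>A\<^esub> x = I" if "x \<in> carrier A" for x
    using that assms(3) subgroup_axioms by (intro coset_join2) auto
  then have "carrier (A Mod I) = {\<one>\<^bsub>A Mod I\<^esub>}"
    by (auto simp: carrier_FactGroup)
  then show ?thesis
    unfolding trivial_group_def using factorgroup_is_group by blast
qed

lemma trivial_torsion_quotient:
  assumes "comm_group A" "subgroup I A"
    and "\<And>x n. \<lbrakk>x \<in> carrier A; 0 < n; x [^]\<^bsub>A\<^esub> (n::nat) \<in> I\<rbrakk> \<Longrightarrow> x \<in> I"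
  shows "trivial_group (torsion_subgroup (A Mod I))"
proof -
  interpret comm_group A by fact
  interpret I: normal I A by (rule subgroup_imp_normal[OF assms(2)])
  interpret Q: group "A Mod I" by (rule I.factorgroup_is_group)
  have "X = \<one>\<^bsub>A Mod I\<^esub>"
    if X: "X \<in> carrier (A Mod I)" and n: "0 < n" "X [^]\<^bsub>A Mod I\<^esub> (n::nat) = \<one>\<^bsub>A Mod I\<^esub>" for X n
  proof -
    obtain x where x: "x \<in> carrier A" "X = I #>\<^bsub>A\<^esub> x"
      using X by (auto simp: carrier_FactGroup)
    have "I #>\<^bsub>A\<^esub> (x [^]\<^bsub>A\<^esub> n) = X [^]\<^bsub>A Mod I\<^esub> n"
      unfolding x(2) by (rule I.FactGroup_pow[OF x(1), symmetric])
    also have "\<dots> = I" unfolding n(2) by (rule one_FactGroup)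
    finally have "x [^]\<^bsub>A\<^esub> n \<in> I"
      by (rule coset_join1) (use x(1) assms(2) in auto)
    then have "x \<in> I" using assms(3) x(1) n(1) by blast
    then show ?thesis
      unfolding x(2) one_FactGroup by (rule coset_join2[OF x(1) assms(2)])
  qed
  then show ?thesis
    unfolding torsion_subgroup_def by (intro Q.trivial_group_subgroup_generated) auto
qed

context coloured_diagram
begin

lemma circ_circles: "circ s = circles D s"
  by (simp add: circ_def circles_cls)

text \<open>
  All four ends at \<open>c\<close> lie on the circles of the two outgoing ones.
\<close>

lemma touches_near:
  assumes c: "c \<in> crossings D" and C: "C \<in> circ s"
  shows "touches C c \<longleftrightarrow> C \<in> near s c"
proof -
  obtain x where x: "x \<in> points" "C = cls s x" using C by (auto simp: circ_def)
  show ?thesis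
  proof (cases x)
    case (Inl d)
    then have d: "d \<in> darts D" "C = Inl (rel s `` {d})"
      using x by (auto simp: points_def cls_def)
    have "touches C c \<longleftrightarrow> (\<exists>p. (d, (c, p)) \<in> rel s)"
      by (auto simp: touches_def d)
    also have "\<dots> \<longleftrightarrow> (d, pos c) \<in> rel s \<or> (d, neg c) \<in> rel s"
    proof
      assume "\<exists>p. (d, (c, p)) \<in> rel s"
      then obtain p where p: "(d, (c, p)) \<in> rel s" by blast
      then have "(c, p) \<in> darts D" using rel_darts d(1) by blast
      then show "(d, pos c) \<in> rel s \<or> (d, neg c) \<in> rel s"
        using rel_at_crossing[OF c, of "(c, p)" s] p rel_trans by (metis fst_conv)
    qed (auto simp: pos_def neg_def)
    also have "\<dots> \<longleftrightarrow> C \<in> near s c"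
      using x Inl by (simp add: near_def cls_eq)
    finally show ?thesis .
  next
    case (Inr n)
    then show ?thesis using x by (simp add: touches_def near_def)
  qed
qed

lemma incidence_remove:
  assumes s: "s \<subseteq> crossings D" "c \<in> s" and T: "T \<subseteq> circ s" "T' \<subseteq> circ (s - {c})"
  shows "incidence D (s, T) (s - {c}, T') = of_bool (T - near s c = T' - near (s - {c}) c)"
proof -
  have c: "c \<in> crossings D" using s by blast
  have "sym_diff s (s - {c}) = {e} \<longleftrightarrow> e = c" for e
    using s(2) by auto
  moreover have "(\<forall>C \<in> circ s \<union> circ (s - {c}). \<not> touches C c \<longrightarrow> (C \<in> T \<longleftrightarrow> C \<in> T')) \<longleftrightarrow>
      T - near s c = T' - near (s - {c}) c"
    using T touches_near[OF c, of _ s] touches_near[OF c, of _ "s - {c}"] by blast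
  ultimately show ?thesis
    by (simp add: incidence_def circ_circles [symmetric])
qed

lemma \<sigma>_eq: "\<sigma> D S = \<sigma>\<^sub>s (fst S)"
  by (simp add: \<sigma>_def \<sigma>\<^sub>s_def)

lemma \<tau>_eq': "\<tau> D S = \<tau>\<^sub>s S"
  by (simp add: \<tau>_def \<tau>\<^sub>s_def circ_circles)

lemma enhanced_states_eq:
  "enhanced_states D i j = {S \<in> gens. \<sigma>\<^sub>s (fst S) = i \<and> \<sigma>\<^sub>s (fst S) + 2 * \<tau>\<^sub>s S = j}"
  by (auto simp: enhanced_states_def gens_def \<sigma>_eq \<tau>_eq' circ_circles)

lemma finite_enhanced_states: "finite (enhanced_states D i j)"
  by (simp add: enhanced_states_eq)

lemma diff_bidegree:
  assumes "S \<in> gens" "S' \<in> gens" "diff S S' \<noteq> 0"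
  shows "S' \<in> enhanced_states D (i - 2) j \<longleftrightarrow> S \<in> enhanced_states D i j"
proof -
  obtain s T s' T' where eq: "S = (s, T)" "S' = (s', T')" by fastforce
  obtain c where c: "c \<in> s" "s' = s - {c}" "adj c s T T'"
    using assms(3) unfolding eq by (rule diff_nonzero)
  have "s \<subseteq> crossings D" using assms(1) by (auto simp: eq gens_def)
  then have "\<sigma>\<^sub>s s' = \<sigma>\<^sub>s s - 2" using \<sigma>_remove c by simp
  moreover have "\<tau>\<^sub>s (s', T') = \<tau>\<^sub>s (s, T) + 1" using c by (simp add: adj_def)
  ultimately show ?thesis using assms(1,2) by (auto simp: enhanced_states_eq eq)
qed

lemma boundary_coefficient:
  assumes S: "S \<in> enhanced_states D i j" and S': "S' \<in> enhanced_states D (i - 2) j"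
  shows "(- 1) ^ sign_exponent D S S' * incidence D S S' = diff S S'"
proof -
  obtain s T s' T' where eq: "S = (s, T)" "S' = (s', T')" by fastforce
  have sT: "s \<subseteq> crossings D" "T \<subseteq> circ s" "s' \<subseteq> crossings D" "T' \<subseteq> circ s'"
    and deg: "\<sigma>\<^sub>s s' = \<sigma>\<^sub>s s - 2" "\<tau>\<^sub>s (s', T') = \<tau>\<^sub>s (s, T) + 1"
    using S S' by (auto simp: eq enhanced_states_eq gens_def)
  show ?thesis
  proof (cases "\<exists>c\<in>s. s' = s - {c}")
    case True
    then obtain c where c: "c \<in> s" "s' = s - {c}" by blast
    have "adj c s T T' \<longleftrightarrow> T - near s c = T' - near (s - {c}) c"
      using deg by (simp add: adj_def c)
    moreover have "sym_diff s s' = {c}" using c by auto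
    then have "sign_exponent D S S' = card {x \<in> crossings D - s. c < x}"
      by (simp add: sign_exponent_def eq)
    ultimately show ?thesis
      using sT c incidence_remove[of s c T T'] by (simp add: eq diff_remove sgn_at_def)
  next
    case False
    have "sym_diff s s' \<noteq> {c}" for c
    proof
      assume *: "sym_diff s s' = {c}"
      have "x \<in> s' \<longleftrightarrow> (x \<in> s) \<noteq> (x = c)" for x
        using eqset_imp_iff[OF *, of x] by auto
      then have "s' = flip c s" by (auto simp: flip_def)
      moreover have "c \<notin> s" using calculation False by (auto simp: flip_def)
      ultimately have "s' = insert c s" "c \<notin> s" "c \<in> crossings D"
        using sT by (auto simp: flip_def)
      then show False using \<sigma>_insert[of c s] deg sT by simp
    qed
    then have "incidence D S S' = 0" by (simp add: incidence_def eq)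
    moreover have "diff S S' = 0"
      using False diff_nonzero[of s T s' T'] unfolding eq by blast
    ultimately show ?thesis by simp
  qed
qed

text \<open>
  The differential of bidegree \<open>(i, j)\<close> is the restriction of the one on the whole cube: matrix entries
  outside of the bidegrees in question vanish by \<open>diff_bidegree\<close>.
\<close>

lemma lookup_boundary:
  assumes z: "Poly_Mapping.keys z \<subseteq> enhanced_states D i j"
  shows "Poly_Mapping.lookup (boundary D i j z) = bd gens (Poly_Mapping.lookup z)"
proof
  fix t
  let ?z = "Poly_Mapping.lookup z" and ?E = "enhanced_states D i j" and ?E' = "enhanced_states D (i - 2) j"
  have z0: "?z s = 0" if "s \<notin> ?E" for s
    using z that by (meson in_keys_iff subsetD)
  have pick: "(\<Sum>s'\<in>A. k s' * (if t = s' then 1 else 0)) = (if t \<in> A then k t else 0)"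
    if "finite A" for k :: "enhanced_state \<Rightarrow> int" and A
    using that by (simp add: if_distrib cong: if_cong)
  have "Poly_Mapping.lookup (boundary D i j z) t = (\<Sum>s\<in>Poly_Mapping.keys z. ?z s *
      (if t \<in> ?E' then (- 1) ^ sign_exponent D s t * incidence D s t else 0))"
    unfolding boundary_def frag_extend_def Poly_Mapping.lookup_sum lookup_frag_cmul
    by (simp add: pick finite_enhanced_states)
  also have "\<dots> = (\<Sum>s\<in>?E. ?z s *
      (if t \<in> ?E' then (- 1) ^ sign_exponent D s t * incidence D s t else 0))"
    by (rule sum.mono_neutral_left[OF finite_enhanced_states z]) (auto simp: in_keys_iff)
  also have "\<dots> = (\<Sum>s\<in>?E. if t \<in> gens then ?z s * diff s t else 0)"
  proof (rule sum.cong[OF refl])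
    fix s assume s: "s \<in> ?E"
    then have "s \<in> gens" by (simp add: enhanced_states_eq)
    then show "?z s * (if t \<in> ?E' then (- 1) ^ sign_exponent D s t * incidence D s t else 0) =
        (if t \<in> gens then ?z s * diff s t else 0)"
      using s boundary_coefficient[OF s, of t] diff_bidegree[of s t i j]
      by (cases "t \<in> ?E'") (auto simp: enhanced_states_eq)
  qed
  also have "\<dots> = (\<Sum>s\<in>gens. if t \<in> gens then ?z s * diff s t else 0)"
    by (rule sum.mono_neutral_left) (auto simp: z0, simp add: enhanced_states_eq)
  also have "\<dots> = bd gens ?z t"
    by (simp add: bd_def)
  finally show "Poly_Mapping.lookup (boundary D i j z) t = bd gens ?z t" .
qed

lemma chains_lookup:
  assumes "Poly_Mapping.keys z \<subseteq> enhanced_states D i j"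
  shows "Poly_Mapping.lookup z \<in> chains gens (j - 2 * i)"
  using assms by (fastforce simp: chains_def enhanced_states_eq delta_def in_keys_iff subset_iff)

lemma boundary_keys:
  assumes "Poly_Mapping.keys z \<subseteq> enhanced_states D i j"
  shows "Poly_Mapping.keys (boundary D i j z) \<subseteq> enhanced_states D (i - 2) j"
proof
  fix t assume "t \<in> Poly_Mapping.keys (boundary D i j z)"
  then have "bd gens (Poly_Mapping.lookup z) t \<noteq> 0"
    by (simp add: in_keys_iff lookup_boundary[OF assms])
  then have t: "t \<in> gens" and "(\<Sum>s\<in>gens. Poly_Mapping.lookup z s * diff s t) \<noteq> 0"
    by (auto simp: bd_def split: if_splits)
  then obtain s where "s \<in> gens" "Poly_Mapping.lookup z s * diff s t \<noteq> 0"
    by (metis (no_types, lifting) sum.not_neutral_contains_not_neutral)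
  moreover from this have "s \<in> enhanced_states D i j"
    using assms by (auto simp: in_keys_iff)
  ultimately show "t \<in> enhanced_states D (i - 2) j"
    using diff_bidegree[of s t i j] t by simp
qed

lemma boundary_boundary:
  assumes "Poly_Mapping.keys z \<subseteq> enhanced_states D (i + 2) j"
  shows "boundary D i j (boundary D (i + 2) j z) = 0"
proof (rule poly_mapping_eqI)
  fix t
  have "convex gens" by (simp add: convex_def)
  then show "Poly_Mapping.lookup (boundary D i j (boundary D (i + 2) j z)) t = Poly_Mapping.lookup 0 t"
    using lookup_boundary[OF assms] lookup_boundary[of "boundary D (i + 2) j z" i j]
      boundary_keys[OF assms] bd_bd by simp
qed

text \<open>
  A chain found in the ungraded complex may be projected to the right bidegree.
\<close>

lemma bounding_chain:
  assumes z: "Poly_Mapping.keys z \<subseteq> enhanced_states D i j"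
    and y: "bd gens y = Poly_Mapping.lookup z"
  obtains w where "Poly_Mapping.keys w \<subseteq> enhanced_states D (i + 2) j" "boundary D (i + 2) j w = z"
proof -
  let ?E = "enhanced_states D (i + 2) j"
  define w where "w = (\<Sum>s\<in>?E. frag_cmul (y s) (frag_of s))"
  have lookup_w: "Poly_Mapping.lookup w s = (if s \<in> ?E then y s else 0)" for s
  proof -
    have "Poly_Mapping.lookup w s = (\<Sum>s'\<in>?E. if s' = s then y s else 0)"
      unfolding w_def lookup_sum by (intro sum.cong) (auto simp: lookup_frag_of)
    then show ?thesis by (simp add: finite_enhanced_states)
  qed
  have keys: "Poly_Mapping.keys w \<subseteq> ?E"
    by (rule subsetI) (simp add: in_keys_iff lookup_w split: if_splits)
  have "boundary D (i + 2) j w = z"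
  proof (rule poly_mapping_eqI)
    fix t
    have terms: "Poly_Mapping.lookup w s * diff s t = (if t \<in> enhanced_states D i j then y s * diff s t else 0)"
      if "s \<in> gens" "t \<in> gens" for s
      using diff_bidegree[OF that, of "i + 2" j] by (auto simp: lookup_w)
    have "bd gens (Poly_Mapping.lookup w) t = (if t \<in> enhanced_states D i j then bd gens y t else 0)"
      by (auto simp: bd_def terms)
    also have "\<dots> = Poly_Mapping.lookup z t"
      using subsetD[OF z, of t] by (auto simp: y in_keys_iff)
    finally show "Poly_Mapping.lookup (boundary D (i + 2) j w) t = Poly_Mapping.lookup z t"
      by (simp add: lookup_boundary[OF keys])
  qed
  with keys that show thesis by blast
qed

lemma boundary_hom: "group_hom (chain_group D i j) (chain_group D (i - 2) j) (boundary D i j)"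
proof (rule group_hom.intro)
  show "group_hom_axioms (chain_group D i j) (chain_group D (i - 2) j) (boundary D i j)"
  proof
    have "boundary D i j (x + y) = boundary D i j x + boundary D i j y" for x y
      by (simp add: boundary_def frag_extend_add)
    then show "boundary D i j \<in> hom (chain_group D i j) (chain_group D (i - 2) j)"
      by (intro homI) (simp_all add: chain_group_def boundary_keys)
  qed
qed (simp_all add: chain_group_def)

lemma cycle_group:
  "comm_group (cycle_group D i j)"
  "subgroup (boundary D (i + 2) j ` carrier (chain_group D (i + 2) j)) (cycle_group D i j)"
  "x \<in> carrier (cycle_group D i j) \<longleftrightarrow>
     Poly_Mapping.keys x \<subseteq> enhanced_states D i j \<and> boundary D i j x = 0"
  "x [^]\<^bsub>cycle_group D i j\<^esub> (n::nat) = frag_cmul (int n) x"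
proof -
  let ?G = "chain_group D i j"
  interpret d: group_hom ?G "chain_group D (i - 2) j" "boundary D i j" by (rule boundary_hom)
  interpret d': group_hom "chain_group D (i + 2) j" ?G "boundary D (i + 2) j"
    using boundary_hom[of "i + 2" j] by simp
  let ?K = "kernel ?G (chain_group D (i - 2) j) (boundary D i j)"
  have K: "subgroup ?K ?G" by (rule d.subgroup_kernel)
  have carrier: "carrier (cycle_group D i j) = ?K"
    unfolding cycle_group_def by (rule subgroup.carrier_subgroup_generated_subgroup[OF K])
  show x: "x \<in> carrier (cycle_group D i j) \<longleftrightarrow>
     Poly_Mapping.keys x \<subseteq> enhanced_states D i j \<and> boundary D i j x = 0" for x
    unfolding carrier by (simp add: kernel_def chain_group_def)
  show "comm_group (cycle_group D i j)"
    unfolding cycle_group_def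
    by (intro group.abelian_subgroup_generated) (simp_all add: chain_group_def abelian_free_Abelian_group)
  have "boundary D (i + 2) j ` carrier (chain_group D (i + 2) j) \<subseteq> ?K"
  proof (rule image_subsetI)
    fix y assume y: "y \<in> carrier (chain_group D (i + 2) j)"
    then have "boundary D i j (boundary D (i + 2) j y) = 0"
      by (intro boundary_boundary) (simp add: chain_group_def)
    then show "boundary D (i + 2) j y \<in> ?K"
      using d'.hom_closed[OF y] by (simp add: kernel_def chain_group_def)
  qed
  then show "subgroup (boundary D (i + 2) j ` carrier (chain_group D (i + 2) j)) (cycle_group D i j)"
    unfolding cycle_group_def using d'.img_is_subgroup
    by (rule d.G.subgroup_of_subgroup_generated)
  show "x [^]\<^bsub>cycle_group D i j\<^esub> n = frag_cmul (int n) x"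
    unfolding cycle_group_def pow_subgroup_generated by (simp add: chain_group_def)
qed

lemma trivial_homology:
  assumes "exact_at gens (j - 2 * i)"
  shows "trivial_group (Khovanov_homology D i j)"
  unfolding Khovanov_homology_def
proof (rule trivial_quotient[OF cycle_group(1,2)], rule subsetI)
  fix z assume "z \<in> carrier (cycle_group D i j)"
  then have z: "Poly_Mapping.keys z \<subseteq> enhanced_states D i j" "boundary D i j z = 0"
    by (simp_all add: cycle_group(3))
  have "bd gens (Poly_Mapping.lookup z) = (\<lambda>_. 0)"
    using lookup_boundary[OF z(1)] z(2) by (simp add: fun_eq_iff)
  then obtain y where "bd gens y = Poly_Mapping.lookup z"
    using exact_atE[OF assms chains_lookup[OF z(1)]] by blast
  then obtain w where "Poly_Mapping.keys w \<subseteq> enhanced_states D (i + 2) j" "boundary D (i + 2) j w = z"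
    by (rule bounding_chain[OF z(1)])
  then show "z \<in> boundary D (i + 2) j ` carrier (chain_group D (i + 2) j)"
    by (auto simp: chain_group_def)
qed

lemma trivial_torsion:
  assumes "torsion_free_at gens (j - 2 * i)"
  shows "trivial_group (torsion_subgroup (Khovanov_homology D i j))"
  unfolding Khovanov_homology_def
proof (rule trivial_torsion_quotient[OF cycle_group(1,2)])
  fix z and n :: nat
  assume "z \<in> carrier (cycle_group D i j)" "0 < n"
    "z [^]\<^bsub>cycle_group D i j\<^esub> n \<in> boundary D (i + 2) j ` carrier (chain_group D (i + 2) j)"
  then obtain x where z: "Poly_Mapping.keys z \<subseteq> enhanced_states D i j"
    and x: "Poly_Mapping.keys x \<subseteq> enhanced_states D (i + 2) j" "boundary D (i + 2) j x = frag_cmul (int n) z"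
    by (auto simp: cycle_group(3,4) chain_group_def)
  have "bd gens (Poly_Mapping.lookup x) = (\<lambda>s. int n * Poly_Mapping.lookup z s)"
    using lookup_boundary[OF x(1)] x(2) by (simp add: fun_eq_iff)
  moreover have "Poly_Mapping.lookup x \<in> chains gens (j - 2 * i - 4)"
    using chains_lookup[OF x(1)] by (simp add: algebra_simps)
  ultimately obtain y where "bd gens y = Poly_Mapping.lookup z"
    using torsion_free_atE[OF assms chains_lookup[OF z]] \<open>0 < n\<close> by (metis of_nat_0_less_iff less_irrefl)
  then obtain w where "Poly_Mapping.keys w \<subseteq> enhanced_states D (i + 2) j" "boundary D (i + 2) j w = z"
    by (rule bounding_chain[OF z])
  then show "z \<in> boundary D (i + 2) j ` carrier (chain_group D (i + 2) j)"
    by (auto simp: chain_group_def)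
qed

end

section \<open>Circles of the extreme states\<close>

context coloured_diagram
begin

lemma finite_quotient_rel: "finite (darts D // rel s)"
  by (simp add: quotient_def finite_darts)

lemma card_circ: "card (circ s) = card (darts D // rel s) + free_circles D"
proof -
  have "card (Inl ` (darts D // rel s) :: circle set) = card (darts D // rel s)"
    by (intro card_image) simp
  moreover have "card (Inr ` {..<free_circles D} :: circle set) = free_circles D"
    by (subst card_image) simp_all
  moreover have "Inl ` (darts D // rel s) \<inter> Inr ` {..<free_circles D} = ({} :: circle set)"
    by auto
  ultimately show ?thesis
    by (simp add: circ_circles circles_def orbit_classes_rel card_Un_disjoint finite_quotient_rel)
qed

text \<open>
  Each change of marker alters the number of circles by one.
\<close>

lemma card_circ_change:
  assumes "finite F" "F \<subseteq> crossings D" "s \<subseteq> crossings D"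
  shows "card (circ s) \<le> card (circ (sym_diff s F)) + card F"
  using assms
proof (induction F)
  case (insert c F)
  have "sym_diff s (insert c F) = flip c (sym_diff s F)"
    using insert.hyps by (auto simp: flip_def)
  moreover have "sym_diff s F \<subseteq> crossings D" using insert.prems by auto
  ultimately have "card (circ (sym_diff s F)) \<le> card (circ (sym_diff s (insert c F))) + 1"
    using card_circ_flip[of "sym_diff s F" c] insert.prems by (simp split: if_splits)
  then show ?case using insert by auto
qed simp

lemma link_graph:
  assumes "(x, y) \<in> {(x, f x) | x f. x \<in> darts D \<and> f \<in> {joined D, rot}}\<^sup>*"
  shows "(Inl x, Inl y) \<in> link s (crossings D)"
  using assms
proof (induction rule: rtrancl_induct)
  case (step y z)
  then have y: "y \<in> darts D" and z: "z = joined D y \<or> z = rot y" by auto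
  then have zd: "z \<in> darts D" using joined by (auto simp: rot_def darts_def split: prod.splits)
  have pts: "Inl x \<in> points" if "x \<in> darts D" for x using that by (simp add: points_def InlI)
  have to_pos: "(Inl x, Inl (pos (fst x))) \<in> link s (crossings D)" if x: "x \<in> darts D" for x
  proof -
    have c: "fst x \<in> crossings D" using x by (auto simp: darts_def)
    then have "pos (fst x) \<in> darts D" "neg (fst x) \<in> darts D" by (simp_all add: pos_neg)
    moreover have "(x, pos (fst x)) \<in> rel s \<or> (x, neg (fst x)) \<in> rel s"
      by (rule rel_at_crossing[OF c x refl])
    ultimately have "(Inl x, Inl (pos (fst x))) \<in> link s (crossings D) \<or>
        (Inl x, Inl (neg (fst x))) \<in> link s (crossings D)"
      using x pts by (metis cls_eq link_cl)
    then show ?thesis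
      using link_sym[OF link_edge[OF c]] link_trans by blast
  qed
  from z have "(Inl y, Inl z) \<in> link s (crossings D)"
  proof
    assume "z = joined D y"
    then show ?thesis using rel_joined[OF y] y zd pts by (intro link_cl) (simp_all add: cls_eq)
  next
    assume "z = rot y"
    then have "fst z = fst y" by (simp add: rot_def split: prod.splits)
    then show ?thesis using to_pos[OF y] to_pos[OF zd] link_sym link_trans by metis
  qed
  with step.IH show ?case by (rule link_trans)
qed simp

text \<open>
  The graph of the whole cube has the components of the diagram: the ends at a crossing are connected
  by its edge, and those of an edge of the diagram lie on one circle.
\<close>

lemma ncomp_le:
  "ncomp s (crossings D) \<le> card (graph_components D) + free_circles D"
proof -
  let ?r = "link s (crossings D)"
  let ?g = "{(x, f x) | x f. x \<in> darts D \<and> f \<in> {joined D, rot}}\<^sup>*"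
  have gc: "graph_components D = darts D // ?g"
    by (simp add: graph_components_def orbit_classes_def)
  define h where "h X = ?r `` {Inl (SOME x. x \<in> X)}" for X :: "dart set"
  have "points // ?r \<subseteq> h ` graph_components D \<union> (\<lambda>n. ?r `` {Inr n}) ` {..<free_circles D}"
  proof
    fix X assume "X \<in> points // ?r"
    then obtain p where p: "p \<in> points" "X = ?r `` {p}" by (auto simp: quotient_def)
    show "X \<in> h ` graph_components D \<union> (\<lambda>n. ?r `` {Inr n}) ` {..<free_circles D}"
    proof (cases p)
      case (Inl x)
      let ?C = "?g `` {x}"
      have "x \<in> ?C" by simp
      then have "(SOME x. x \<in> ?C) \<in> ?C" by (rule someI)
      then have "(Inl x, Inl (SOME x. x \<in> ?C)) \<in> ?r" by (intro link_graph) simp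
      then have "X = h ?C" unfolding p(2) Inl h_def by (rule equiv_class_eq[OF equiv_link])
      moreover have "?C \<in> graph_components D"
        using p Inl unfolding gc by (auto simp: points_def intro: quotientI)
      ultimately show ?thesis by blast
    next
      case (Inr n)
      then show ?thesis using p by (auto simp: points_def)
    qed
  qed
  moreover have fin: "finite (graph_components D)"
    by (simp add: gc quotient_def finite_darts)
  ultimately have "ncomp s (crossings D) \<le>
      card (h ` graph_components D \<union> (\<lambda>n. ?r `` {Inr n}) ` {..<free_circles D})"
    unfolding ncomp_def by (intro card_mono) auto
  also have "\<dots> \<le> card (h ` graph_components D) + card ((\<lambda>n. ?r `` {Inr n}) ` {..<free_circles D})"
    by (rule card_Un_le)
  also have "\<dots> \<le> card (graph_components D) + free_circles D"
    using card_image_le[OF fin, of h] card_image_le[of "{..<free_circles D}" "\<lambda>n. ?r `` {Inr n}"]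
    by simp
  finally show ?thesis .
qed

text \<open>
  The full cube consists of the states between \<open>{}\<close> and all of \<open>crossings D\<close>, and its graph is connected.
\<close>

theorem homology_support:
  assumes "non_split D"
  defines "lo \<equiv> 2 * int (card (circles D (crossings D))) - int (card (crossings D)) - 4"
    and "hi \<equiv> int (card (crossings D)) - 2 * int (card (circles D {})) + 4"
  shows "j - 2 * i < lo \<or> hi < j - 2 * i \<Longrightarrow> trivial_group (Khovanov_homology D i j)"
    and "j - 2 * i < lo + 4 \<or> hi < j - 2 * i \<Longrightarrow> trivial_group (torsion_subgroup (Khovanov_homology D i j))"
proof -
  have n: "ncomp {} (crossings D) \<le> 1"
    using ncomp_le[of "{}"] assms(1) by (simp add: non_split_def)
  have "subcube {} (crossings D) = gens" by (auto simp: subcube_def gens_def)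
  then have "supported gens (low {} (crossings D)) (high {} (crossings D))"
    using supported_subcube[of "{}" "crossings D"] by simp
  then have sup: "supported gens lo hi"
    by (rule supported_mono)
      (use n in \<open>simp_all add: low_def high_def lo_def hi_def circ_circles \<sigma>\<^sub>s_def\<close>)
  show "trivial_group (Khovanov_homology D i j)" if "j - 2 * i < lo \<or> hi < j - 2 * i"
    using sup that by (intro trivial_homology) (auto simp: supported_def)
  show "trivial_group (torsion_subgroup (Khovanov_homology D i j))" if "j - 2 * i < lo + 4 \<or> hi < j - 2 * i"
  proof (rule trivial_torsion)
    have "convex gens" by (simp add: convex_def)
    then show "torsion_free_at gens (j - 2 * i)"
      using sup that exact_torsion_free[of gens "j - 2 * i"] by (auto simp: supported_def)
  qed
qed

end

lemma change_crossings_simps [simp]: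
  "darts (change_crossings A D) = darts D" "joined (change_crossings A D) = joined D"
  "crossings (change_crossings A D) = crossings D" "free_circles (change_crossings A D) = free_circles D"
  by (simp_all add: change_crossings_def darts_def)

lemma smoothing_change_crossings:
  "smoothing (change_crossings A D) s = smoothing D (sym_diff s A)"
  by (rule ext) (auto simp: smoothing_def change_crossings_def split: prod.splits)

lemma circles_change_crossings:
  "circles (change_crossings A D) s = circles D (sym_diff s A)"
  unfolding circles_def smoothing_change_crossings by simp

lemma alternating_coloured:
  assumes "link_diagram D" "alternating (change_crossings A D)"
  shows "coloured_diagram D (even_over (change_crossings A D))"
proof
  have is_over: "is_over (change_crossings A D) = checker (even_over (change_crossings A D))"
    by (simp add: is_over_def checker_def)
  show "checker (even_over (change_crossings A D)) (joined D x) \<longleftrightarrow>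
      \<not> checker (even_over (change_crossings A D)) x" if "x \<in> darts D" for x
    using assms(2) that unfolding alternating_def is_over by auto
qed (use assms(1) in \<open>auto simp: link_diagram_def\<close>)

lemma faces_change_crossings: "faces (change_crossings A D) = faces D"
  by (simp add: faces_def)

text \<open>
  A walk around a face of an alternating diagram leaves all crossings along over-strands, and then it
  follows a circle of the state with only negative markers, or all of them along under-strands, and then
  it follows a circle of the state with only positive markers. Distinct faces belong to distinct circles.
\<close>

lemma (in coloured_diagram) card_faces_le:
  assumes u: "u = even_over D"
  shows "card (faces D) \<le> card (darts D // rel (crossings D)) + card (darts D // rel {})"
proof -
  define f where "f = rot_inv \<circ> joined D"
  define g where "g = {(x, h x) | x h. x \<in> darts D \<and> h \<in> {f}}\<^sup>*"
  have faces: "faces D = darts D // g"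
    by (simp add: faces_def orbit_classes_def g_def f_def)
  have f_darts: "f x \<in> darts D" and f_checker: "checker u (f x) \<longleftrightarrow> checker u x" if x: "x \<in> darts D" for x
  proof -
    have "rot_inv y \<in> darts D \<and> (checker u (rot_inv y) \<longleftrightarrow> \<not> checker u y)" if "y \<in> darts D" for y
      using that by (rule dart_cases) (auto simp: rot_inv_def darts_def checker_def)
    then show "f x \<in> darts D" "checker u (f x) \<longleftrightarrow> checker u x"
      using joined[OF x] checker_joined[OF x] by (auto simp: f_def)
  qed
  \<comment> \<open>a face turns at every crossing like the smoothing of one of the extreme states\<close>
  define st where "st b = (if b then {} else crossings D)" for b
  have f_follow: "f x = sm (st (checker u x)) (joined D x)" if x: "x \<in> darts D" for x
  proof -
    have y: "joined D x \<in> darts D" "checker u (joined D x) \<longleftrightarrow> \<not> checker u x"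
      using joined[OF x] checker_joined[OF x] by auto
    have "rot_inv y = sm (st (\<not> checker u y)) y" if "y \<in> darts D" for y
      using that by (rule dart_cases) (auto simp: rot_inv_def smoothing_def st_def checker_def u)
    from this[OF y(1)] y(2) show ?thesis by (simp add: f_def)
  qed
  have f_inj: "inj_on f (darts D)"
  proof -
    have "rot (rot_inv y) = y" if "y \<in> darts D" for y
      using that by (rule dart_cases) (auto simp: rot_inv_def rot_def)
    then have "joined D (rot (f x)) = x" if "x \<in> darts D" for x
      using joined[OF that] by (simp add: f_def)
    then show ?thesis by (rule inj_on_inverseI)
  qed
  have g_step: "(x, f y) \<in> g" if "(x, y) \<in> g" "y \<in> darts D" for x y
    using that unfolding g_def by (intro rtrancl_into_rtrancl[OF that(1)[unfolded g_def]]) blast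
  have g_darts: "g `` {x} \<subseteq> darts D" if x: "x \<in> darts D" for x
  proof
    fix y assume "y \<in> g `` {x}"
    then have "(x, y) \<in> g" by blast
    then show "y \<in> darts D"
      unfolding g_def by (induction rule: rtrancl_induct) (auto simp: x f_darts)
  qed
  have g_back: "(x, y) \<in> g" if xy: "(x, f y) \<in> g" "y \<in> darts D" "x \<in> darts D" for x y
  proof -
    have "f ` (g `` {x}) = g `` {x}"
    proof (rule endo_inj_surj)
      show "finite (g `` {x})" using g_darts[OF xy(3)] finite_darts by (rule finite_subset)
      show "f ` (g `` {x}) \<subseteq> g `` {x}" using g_step g_darts[OF xy(3)] by blast
      show "inj_on f (g `` {x})" using f_inj g_darts[OF xy(3)] by (rule inj_on_subset)
    qed
    then obtain z where "(x, z) \<in> g" "f y = f z" using xy(1) by blast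
    moreover from this have "z \<in> darts D" using g_darts[OF xy(3)] by blast
    ultimately show ?thesis using inj_onD[OF f_inj, of y z] xy(2) by simp
  qed
  have rel_g: "(x, y) \<in> g"
    if x: "x \<in> darts D" and y: "checker u y = checker u x" and xy: "(x, y) \<in> rel (st (checker u x))" for x y
  proof -
    let ?s = "st (checker u x)"
    have "(checker u y = checker u x \<longrightarrow> (x, y) \<in> g) \<and> (checker u y \<noteq> checker u x \<longrightarrow> (x, sm ?s y) \<in> g)"
      using xy
    proof (induction rule: rel_induct)
      case refl
      show ?case by (simp add: g_def)
    next
      case (edge z)
      have z: "joined D z \<in> darts D" "joined D (joined D z) = z"
        "checker u (joined D z) \<longleftrightarrow> \<not> checker u z"
        using joined[OF edge.hyps(2)] checker_joined[OF edge.hyps(2)] by auto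
      show ?case
      proof (cases "checker u z = checker u x")
        case True
        then have "(x, f z) \<in> g" using edge g_step by blast
        then show ?thesis using True z f_follow[OF edge.hyps(2)] by simp
      next
        case False
        then have eq: "checker u (joined D z) = checker u x" using z by auto
        have "(x, sm ?s z) \<in> g" using False edge.IH by blast
        then have "(x, f (joined D z)) \<in> g"
          using f_follow[OF z(1)] eq z(2) by simp
        then show ?thesis using g_back[OF _ z(1) x] eq by simp
      qed
    next
      case (arc z)
      then show ?case using checker_sm[of z ?s] sm_sm[of z ?s] by auto
    qed
    then show ?thesis using y by blast
  qed
  define F where "F b = {g `` {x} | x. x \<in> darts D \<and> checker u x = b}" for b
  have F_le: "card (F b) \<le> card (darts D // rel (st b))" for b
  proof -
    define rep where "rep X = (SOME x. x \<in> darts D \<and> checker u x = b \<and> X = g `` {x})" for X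
    have rep: "rep X \<in> darts D \<and> checker u (rep X) = b \<and> X = g `` {rep X}" if "X \<in> F b" for X
    proof -
      have "\<exists>x. x \<in> darts D \<and> checker u x = b \<and> X = g `` {x}" using that by (auto simp: F_def)
      then show ?thesis unfolding rep_def by (rule someI_ex)
    qed
    show ?thesis
    proof (rule card_inj_on_le[OF _ _ finite_quotient_rel])
      show "(\<lambda>X. rel (st b) `` {rep X}) ` F b \<subseteq> darts D // rel (st b)"
        using rep by (auto intro: quotientI)
      show "inj_on (\<lambda>X. rel (st b) `` {rep X}) (F b)"
      proof (rule inj_onI)
        fix X Y assume XY: "X \<in> F b" "Y \<in> F b" "rel (st b) `` {rep X} = rel (st b) `` {rep Y}"
        have "(rep X, rep Y) \<in> rel (st b)"
          using XY(3) by (simp add: eq_equiv_class_iff[OF equiv_rel])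
        then have "(rep X, rep Y) \<in> g" "(rep Y, rep X) \<in> g"
          using rep[OF XY(1)] rep[OF XY(2)] rel_g[of "rep X" "rep Y"] rel_g[of "rep Y" "rep X"] rel_sym
          by auto
        then have "g `` {rep X} = g `` {rep Y}"
          unfolding g_def by (auto intro: rtrancl_trans)
        then show "X = Y" using rep[OF XY(1)] rep[OF XY(2)] by metis
      qed
    qed
  qed
  have "faces D = F True \<union> F False"
    by (auto simp: faces quotient_def F_def)
  then have "card (faces D) \<le> card (F True) + card (F False)"
    by (simp add: card_Un_le)
  also have "\<dots> \<le> card (darts D // rel (st True)) + card (darts D // rel (st False))"
    by (intro add_mono F_le)
  finally show ?thesis by (simp add: st_def)
qed

lemma (in coloured_diagram) extreme_circles_alternating:
  assumes "link_diagram D" "non_split D" "u = even_over D"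
  shows "card (crossings D) + 2 \<le> card (circ (crossings D)) + card (circ {})"
  using card_faces_le[OF assms(3)] assms(1,2)
  by (simp add: card_circ link_diagram_def non_split_def)

text \<open>
  The extreme states of \<open>D\<close> are states of the alternating diagram that differ from its extreme states
  at the \<open>card A\<close> changed crossings. Euler's formula counts the circles of the latter.
\<close>

lemma extreme_circles_almost_alternating:
  assumes D: "link_diagram D" "non_split D" and A: "A \<subseteq> crossings D" "alternating (change_crossings A D)"
  shows "card (crossings D) + 2 \<le> card (circles D (crossings D)) + card (circles D {}) + 2 * card A"
proof -
  define D' where "D' = change_crossings A D"
  interpret coloured_diagram D "even_over D'"
    unfolding D'_def by (rule alternating_coloured[OF D(1) A(2)])
  interpret D': coloured_diagram D' "even_over D'"
    using coloured_diagram_axioms by (simp add: coloured_diagram_def D'_def)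
  have "link_diagram D'" "non_split D'"
    using D by (simp_all add: D'_def link_diagram_def non_split_def faces_change_crossings graph_components_def)
  then have "card (crossings D') + 2 \<le> card (D'.circ (crossings D')) + card (D'.circ {})"
    by (rule D'.extreme_circles_alternating) simp
  then have alt: "card (crossings D) + 2 \<le>
      card (circ (sym_diff (crossings D) A)) + card (circ (sym_diff {} A))"
    unfolding D'.circ_circles circ_circles by (simp add: D'_def circles_change_crossings)
  have fin: "finite A" using A(1) finite_crossings finite_subset by blast
  have "sym_diff (crossings D) A \<subseteq> crossings D" "sym_diff (sym_diff (crossings D) A) A = crossings D"
    "sym_diff (sym_diff {} A) A = {}"
    using A(1) by auto
  then have "card (circ (sym_diff (crossings D) A)) \<le> card (circ (crossings D)) + card A"
    "card (circ (sym_diff {} A)) \<le> card (circ {}) + card A"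
    using card_circ_change[OF fin A(1), of "sym_diff (crossings D) A"]
      card_circ_change[OF fin A(1), of "sym_diff {} A"] A(1) by auto
  with alt show ?thesis by (simp add: circ_circles)
qed

theorem corollary5p8:
  fixes D :: diagram and k :: nat
  assumes "link_diagram D"
    and "non_split D"
    and "almost_alternating k D"
    and "\<forall>c \<in> crossings D. \<not> nugatory D c"
  shows "H_thick (int k) (int k) D \<and> TH_thick (int k) (int k - 1) D"
proof -
  obtain A where A: "A \<subseteq> crossings D" "card A = k" "alternating (change_crossings A D)"
    using assms(3) by (auto simp: almost_alternating_def)
  interpret coloured_diagram D "even_over (change_crossings A D)"
    by (rule alternating_coloured[OF assms(1) A(3)])
  have count: "card (crossings D) + 2 \<le> card (circles D (crossings D)) + card (circles D {}) + 2 * k"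
    using extreme_circles_almost_alternating[OF assms(1,2) A(1,3)] A(2) by simp
  note supp = homology_support[OF assms(2)]
  have "H_thick (int k) (int k) D"
    unfolding H_thick_def
  proof (intro allI impI)
    fix i j assume "\<not> thick_range D (int k) (int k) i j"
    then show "trivial_group (Khovanov_homology D i j)"
      using count by (intro supp(1)) (auto simp: thick_range_def Let_def)
  qed
  moreover have "TH_thick (int k) (int k - 1) D"
    unfolding TH_thick_def
  proof (intro allI impI)
    fix i j assume "\<not> thick_range D (int k) (int k - 1) i j"
    then show "trivial_group (torsion_subgroup (Khovanov_homology D i j))"
      using count by (intro supp(2)) (auto simp: thick_range_def Let_def)
  qed
  ultimately show ?thesis ..
qed

end
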